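(* Let $K$ be a connected self-similar set of finite type (the invariant set of an IFS $\{S_j\}_{j=1}^N$ of finite type on $\mathbb R^d$) satisfying the open set condition. Then $K$ admits space-filling curves.
   Context: An IFS is a finite family $\{S_j\}_{j=1}^N$, $N\ge2$, of contractive similitudes of $\mathbb R^d$ with contraction ratios $r_1,\dots,r_N\in(0,1)$; its invariant set $K$ (a self-similar set) is the unique nonempty compact set with $K=\bigcup_jS_j(K)$. For a word $I=i_1\dots i_n$ over $\{1,\dots,N\}$ let $S_I=S_{i_1}\circ\dots\circ S_{i_n}$, $r_I=r_{i_1}\cdots r_{i_n}$, and $r_{\min}=\min_jr_j$. Open set condition: there is a nonempty open $U$ with $\bigcup_iS_i(U)\subset U$ and the $S_i(U)$ pairwise disjoint. Finite type: the IFS is of finite type if its set of neighbour maps is finite, i.e. the set of all maps $S_I^{-1}\circ S_J$, where $I,J$ range over finite nonempty words neither of which is a prefix of the other, with $r_{\min}\le r_I/r_J\le r_{\min}^{-1}$ and $S_I(K)\cap S_J(K)\ne\emptyset$, is finite. Space-filling curve means optimal parametrization: with $s=\dim_HK$ (so $0<\mathcal H^s(K)<\infty$), an onto map $\psi:[0,1]\to K$ such that (i) there are full-measure $K'\subset K$, $I'\subset[0,1]$ with $\psi:I'\to K'$ bijective; (ii) with $c=\mathcal H^s(K)$, $\mathcal H^s(\psi(X))=c\,\mathcal L(X)$ for Borel $X\subset[0,1]$ and $\mathcal L(\psi^{-1}(B))=c^{-1}\mathcal H^s(B)$ for Borel $B\subset K$; (iii) $|\psi(x)-\psi(y)|\le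 c'|x-y|^{1/s}$ for some $c'>0$ and all $x,y$. *)

theory Defs
  imports "HOL-Analysis.Analysis" "HOL-Library.Sublist"
begin

section \<open>Hausdorff measure and dimension\<close>

text \<open>
  The case distinction implements the usual conventions: the empty set has weight 0 and, for
  exponent 0, every nonempty set has weight 1 (whereas \<open>0 powr 0 = 0\<close> in HOL).
\<close>

definition hausdorff_weight :: "real \<Rightarrow> 'a::metric_space set \<Rightarrow> ennreal" where
  "hausdorff_weight s U =
     (if U = {} then 0 else if s = 0 then 1 else ennreal (diameter U powr s))"

text \<open>
  Boundedness has to be demanded explicitly, since \<open>diameter\<close> is an unspecified real number
  on unbounded sets.
\<close>

definition hausdorff_delta :: "real \<Rightarrow> real \<Rightarrow> 'a::metric_space set \<Rightarrow> ennreal" where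
  "hausdorff_delta s \<delta> A =
     (INF U\<in>{U :: nat \<Rightarrow> 'a set. A \<subseteq> (\<Union>i. U i) \<and> (\<forall>i. bounded (U i) \<and> diameter (U i) \<le> \<delta>)}.
        (\<Sum>i. hausdorff_weight s (U i)))"

text \<open>
  An outer measure, defined on all sets; no normalizing constant is used. The supremum is the
  limit for \<open>\<delta>\<close> tending to 0, by monotonicity.
\<close>

definition hausdorff_measure :: "real \<Rightarrow> 'a::metric_space set \<Rightarrow> ennreal" where
  "hausdorff_measure s A = (SUP \<delta>\<in>{0<..}. hausdorff_delta s \<delta> A)"

text \<open>
  In a Euclidean space the set on the right-hand side contains every \<open>s\<close> above the dimension
  of the space, so the real-valued infimum is meaningful.
\<close>

definition hausdorff_dim :: "'a::euclidean_space set \<Rightarrow> real" where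
  "hausdorff_dim A = Inf {s. 0 \<le> s \<and> hausdorff_measure s A = 0}"


section \<open>Iterated function systems of similitudes\<close>

definition similitude :: "real \<Rightarrow> ('a::metric_space \<Rightarrow> 'a) \<Rightarrow> bool" where
  "similitude \<rho> f \<longleftrightarrow> (\<forall>x y. dist (f x) (f y) = \<rho> * dist x y)"

definition similitude_ifs ::
    "nat \<Rightarrow> (nat \<Rightarrow> 'a::euclidean_space \<Rightarrow> 'a) \<Rightarrow> (nat \<Rightarrow> real) \<Rightarrow> bool" where
  "similitude_ifs N S r \<longleftrightarrow>
     2 \<le> N \<and> (\<forall>j\<in>{1..N}. 0 < r j \<and> r j < 1 \<and> similitude (r j) (S j))"

definition invariant_set ::
    "nat \<Rightarrow> (nat \<Rightarrow> 'a::euclidean_space \<Rightarrow> 'a) \<Rightarrow> 'a set \<Rightarrow> bool" where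
  "invariant_set N S K \<longleftrightarrow> K \<noteq> {} \<and> compact K \<and> K = (\<Union>j\<in>{1..N}. S j ` K)"

definition open_set_condition ::
    "nat \<Rightarrow> (nat \<Rightarrow> 'a::euclidean_space \<Rightarrow> 'a) \<Rightarrow> bool" where
  "open_set_condition N S \<longleftrightarrow>
     (\<exists>U. open U \<and> U \<noteq> {} \<and> (\<Union>i\<in>{1..N}. S i ` U) \<subseteq> U \<and>
          disjoint_family_on (\<lambda>i. S i ` U) {1..N})"

primrec word_map :: "(nat \<Rightarrow> 'a \<Rightarrow> 'a) \<Rightarrow> nat list \<Rightarrow> 'a \<Rightarrow> 'a" where
  "word_map S [] = id"
| "word_map S (i # I) = S i \<circ> word_map S I"

definition word_ratio :: "(nat \<Rightarrow> real) \<Rightarrow> nat list \<Rightarrow> real" where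
  "word_ratio r I = prod_list (map r I)"

definition ratio_min :: "nat \<Rightarrow> (nat \<Rightarrow> real) \<Rightarrow> real" where
  "ratio_min N r = Min (r ` {1..N})"

definition neighbour_maps ::
    "nat \<Rightarrow> (nat \<Rightarrow> 'a::euclidean_space \<Rightarrow> 'a) \<Rightarrow> (nat \<Rightarrow> real) \<Rightarrow> 'a set \<Rightarrow> ('a \<Rightarrow> 'a) set" where
  "neighbour_maps N S r K =
     {inv (word_map S I) \<circ> word_map S J | I J.
        I \<noteq> [] \<and> J \<noteq> [] \<and> set I \<subseteq> {1..N} \<and> set J \<subseteq> {1..N} \<and>
        \<not> prefix I J \<and> \<not> prefix J I \<and>
        ratio_min N r \<le> word_ratio r I / word_ratio r J \<and>
        word_ratio r I / word_ratio r J \<le> inverse (ratio_min N r) \<and>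
        word_map S I ` K \<inter> word_map S J ` K \<noteq> {}}"

definition finite_type ::
    "nat \<Rightarrow> (nat \<Rightarrow> 'a::euclidean_space \<Rightarrow> 'a) \<Rightarrow> (nat \<Rightarrow> real) \<Rightarrow> 'a set \<Rightarrow> bool" where
  "finite_type N S r K \<longleftrightarrow> finite (neighbour_maps N S r K)"


section \<open>Space-filling curves\<close>

text \<open>
  Only the restriction of \<open>\<psi>\<close> to the unit interval matters. Finiteness and positivity of
  \<open>c\<close> need not be required: the fourth conjunct with \<open>B = K\<close> reads \<open>1 = inverse c * c\<close> in
  \<open>ennreal\<close>, which fails for \<open>c = 0\<close> and for \<open>c = \<infinity>\<close>. The preimages there
  are Borel sets, since \<open>\<psi>\<close> is continuous on the unit interval by the Hoelder condition.
\<close>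

definition space_filling_curve :: "'a::euclidean_space set \<Rightarrow> (real \<Rightarrow> 'a) \<Rightarrow> bool" where
  "space_filling_curve K \<psi> \<longleftrightarrow>
     (let s = hausdorff_dim K; c = hausdorff_measure s K in
        \<psi> ` {0..1} = K \<and>
        (\<exists>K' I'. K' \<subseteq> K \<and> hausdorff_measure s (K - K') = 0 \<and>
                 I' \<subseteq> {0..1} \<and> {0..1} - I' \<in> null_sets lebesgue \<and>
                 bij_betw \<psi> I' K') \<and>
        (\<forall>X\<in>sets borel. X \<subseteq> {0..1} \<longrightarrow>
           hausdorff_measure s (\<psi> ` X) = c * emeasure lborel X) \<and>
        (\<forall>B\<in>sets borel. B \<subseteq> K \<longrightarrow>
           emeasure lborel ({0..1} \<inter> \<psi> -` B) = inverse c * hausdorff_measure s B) \<and>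
        (\<exists>c'>0. \<forall>x\<in>{0..1}. \<forall>y\<in>{0..1}.
           dist (\<psi> x) (\<psi> y) \<le> c' * \<bar>x - y\<bar> powr (1 / s)))"

end

theory Submission imports Defs begin

text \<open>
  The curve is the limit of discrete curves. Level \<open>n\<close> is a list of pieces, each of which lives in
  the cell of a word; consecutive pieces live in touching cells, every cell is visited, and the
  children of a piece live in subcells of its cell. Several pieces may share a cell, and the weight
  \<open>r\<^sub>I\<^sup>s\<close> of the cell must be divided between them. The division is possible if every piece
  \<^emph>\<open>owns\<close> a subcell a bounded number of levels later, that is, if the subcell is visited by
  descendants of this piece only: the share of a piece is the weight of all words that it eventually
  owns. The words without an owner have exponentially small weight, so the shares add up to the
  weights of the cells, and each share is at least a fixed fraction of the weight. Laying out the
  shares along the unit interval gives a map onto \<open>K\<close> that is Hoelder continuous with exponent \<open>1/s\<close>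
  (\<open>psi_hoelder\<close>, \<open>psi_onto\<close>).

  The curve spends a time equal to the weight in each cell. The open set condition bounds the number
  of cells of a given size near a point, whence \<open>K\<close> has positive measure (\<open>hausdorff_K_positive\<close>).
  Covering by cells shows that the Hausdorff measure is at most proportional to time on open
  sets, by outer regularity on Borel sets, and equality follows by passing to complements
  (\<open>hausdorff_borel_eq\<close>). Almost every time lies in owned cells of arbitrarily large level and is spent
  in exactly the cells that contain the current point; such a time is determined by its point
  (\<open>regular_injective\<close>).

  It remains to construct the pieces. Finite type yields a finite \<^emph>\<open>skeleton\<close> \<open>A\<close> of
  contact points such that the graph of cells that touch in images of \<open>A\<close> is connected on every level
  (\<open>finite_type_skeleton\<close>). If in no level a cell has three neighbours in this graph, the cells can be
  visited along a path, each once (\<open>piece_system_chain\<close>). Otherwise put a cycle through the points of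
  \<open>A\<close> into every cell. The union of the cycles of the subcells has a tree-like closed tour, which is
  cut at the points of \<open>A\<close> into trails, one for each edge of the cycle of the large cell. A cell with
  three neighbours makes it possible to leave some subcells out of the tour at first
  (\<open>core_exists\<close>); inserted later, such a cell belongs to a single trail. Two trails that visit the
  same cell may exchange the parts between their first and last visits, and because different points
  of \<open>A\<close> are far apart compared with the subcells, such exchanges provide every trail with an edge of
  a prescribed type (\<open>trail_plan\<close>). As a consequence every edge owns a cell two levels later
  (\<open>piece_system_branching\<close>). The order of the points of \<open>A\<close> in the large cell is determined by the
  order in the subcells; a periodic sequence of orders makes the plans of all levels fit together
  (\<open>plan_sequence\<close>).
\<close>

section \<open>Hausdorff measure as an outer measure\<close>

lemma hausdorff_delta_cover_le:
  assumes "A \<subseteq> (\<Union>i. U i)" "\<And>i. bounded (U i)" "\<And>i. diameter (U i) \<le> \<delta>"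
  shows "hausdorff_delta s \<delta> A \<le> (\<Sum>i. hausdorff_weight s (U i))"
  unfolding hausdorff_delta_def by (rule INF_lower) (use assms in auto)

lemma hausdorff_delta_le_measure:
  assumes "\<delta> > 0"
  shows "hausdorff_delta s \<delta> A \<le> hausdorff_measure s A"
  unfolding hausdorff_measure_def by (rule SUP_upper) (use assms in auto)

lemma hausdorff_measure_leI:
  assumes "\<And>\<delta>. \<delta> > 0 \<Longrightarrow> hausdorff_delta s \<delta> A \<le> c"
  shows "hausdorff_measure s A \<le> c"
  unfolding hausdorff_measure_def by (rule SUP_least) (use assms in auto)

lemma hausdorff_measure_mono:
  assumes "A \<subseteq> B"
  shows "hausdorff_measure s A \<le> hausdorff_measure s B"
proof -
  have "hausdorff_delta s \<delta> A \<le> hausdorff_delta s \<delta> B" for \<delta>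
    unfolding hausdorff_delta_def by (rule INF_superset_mono) (use assms in auto)
  then show ?thesis
    unfolding hausdorff_measure_def by (intro SUP_mono) auto
qed

lemma hausdorff_weight_empty [simp]: "hausdorff_weight s {} = 0"
  by (simp add: hausdorff_weight_def)

lemma hausdorff_measure_empty [simp]: "hausdorff_measure s {} = 0"
proof -
  have "hausdorff_delta s \<delta> ({}::'a set) \<le> 0" if "\<delta> > 0" for \<delta> :: real
    using hausdorff_delta_cover_le[of "{}" "\<lambda>_. {}::'a set" \<delta> s] that by simp
  then have "hausdorff_measure s ({}::'a set) \<le> 0"
    by (rule hausdorff_measure_leI)
  then show ?thesis by simp
qed

lemma hausdorff_delta_near_optimal_cover:
  assumes "hausdorff_delta s \<delta> A < c"
  obtains U where "A \<subseteq> (\<Union>i. U i)" "\<And>i. bounded (U i)" "\<And>i. diameter (U i) \<le> \<delta>"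
    "(\<Sum>i::nat. hausdorff_weight s (U i)) < c"
  using assms unfolding hausdorff_delta_def INF_less_iff by auto

lemma hausdorff_delta_countably_subadditive:
  "hausdorff_delta s \<delta> (\<Union>i::nat. A i) \<le> (\<Sum>i. hausdorff_delta s \<delta> (A i))"
proof (cases "(\<Sum>i. hausdorff_delta s \<delta> (A i)) = \<infinity>")
  case True
  then show ?thesis by simp
next
  case False
  show ?thesis
  proof (rule ennreal_le_epsilon)
    fix e :: real
    assume e: "0 < e"
    have fin: "hausdorff_delta s \<delta> (A i) < \<infinity>" for i
      by (metis False ennreal_suminf_lessD less_top infinity_ennreal_def)
    have "\<exists>U. A i \<subseteq> (\<Union>j::nat. U j) \<and> (\<forall>j. bounded (U j) \<and> diameter (U j) \<le> \<delta>) \<and>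
        (\<Sum>j. hausdorff_weight s (U j)) \<le> hausdorff_delta s \<delta> (A i) + ennreal (e * (1/2) ^ Suc i)" for i
    proof -
      have "hausdorff_delta s \<delta> (A i) < hausdorff_delta s \<delta> (A i) + ennreal (e * (1/2) ^ Suc i)"
        using fin[of i] e by (simp add: ennreal_less_zero_iff less_top)
      then obtain U where "A i \<subseteq> (\<Union>j. U j)" "\<And>j. bounded (U j)" "\<And>j. diameter (U j) \<le> \<delta>"
        "(\<Sum>j::nat. hausdorff_weight s (U j)) < hausdorff_delta s \<delta> (A i) + ennreal (e * (1/2) ^ Suc i)"
        using hausdorff_delta_near_optimal_cover by metis
      then show ?thesis by (meson less_imp_le)
    qed
    then obtain U where U: "\<And>i. A i \<subseteq> (\<Union>j::nat. U i j)"
        "\<And>i j. bounded (U i j) \<and> diameter (U i j) \<le> \<delta>"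
        "\<And>i. (\<Sum>j. hausdorff_weight s (U i j))
            \<le> hausdorff_delta s \<delta> (A i) + ennreal (e * (1/2) ^ Suc i)"
      by metis
    define V where "V n = (case prod_decode n of (i, j) \<Rightarrow> U i j)" for n
    have cov: "(\<Union>i. A i) \<subseteq> (\<Union>n. V n)"
    proof
      fix x assume "x \<in> (\<Union>i. A i)"
      then obtain i j where "x \<in> U i j" using U(1) by blast
      then have "x \<in> V (prod_encode (i, j))" by (simp add: V_def)
      then show "x \<in> (\<Union>n. V n)" by blast
    qed
    have "hausdorff_delta s \<delta> (\<Union>i. A i) \<le> (\<Sum>n. hausdorff_weight s (V n))"
      by (rule hausdorff_delta_cover_le[OF cov]) (auto simp: V_def U(2) split: prod.split)
    also have "\<dots> = (\<Sum>n. (\<lambda>(i, j). hausdorff_weight s (U i j)) (prod_decode n))"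
      by (intro arg_cong[where f=suminf]) (auto simp: V_def split: prod.split)
    also have "\<dots> = (\<Sum>i. \<Sum>j. hausdorff_weight s (U i j))"
      by (intro suminf_ennreal_2dimen) auto
    also have "\<dots> \<le> (\<Sum>i. hausdorff_delta s \<delta> (A i) + ennreal (e * (1/2) ^ Suc i))"
      by (intro suminf_le) (use U(3) in auto)
    also have "\<dots> = (\<Sum>i. hausdorff_delta s \<delta> (A i)) + (\<Sum>i. ennreal (e * (1/2) ^ Suc i))"
      by (rule suminf_add[symmetric]) auto
    also have "(\<Sum>i. ennreal (e * (1/2) ^ Suc i)) = ennreal e"
      using sums_mult[OF power_half_series, of e] e by (intro suminf_ennreal_eq) auto
    finally show "hausdorff_delta s \<delta> (\<Union>i. A i) \<le> (\<Sum>i. hausdorff_delta s \<delta> (A i)) + ennreal e" .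
  qed
qed

lemma hausdorff_measure_countably_subadditive:
  "hausdorff_measure s (\<Union>i::nat. A i) \<le> (\<Sum>i. hausdorff_measure s (A i))"
proof (rule hausdorff_measure_leI)
  fix \<delta> :: real assume "\<delta> > 0"
  have "hausdorff_delta s \<delta> (\<Union>i. A i) \<le> (\<Sum>i. hausdorff_delta s \<delta> (A i))"
    by (rule hausdorff_delta_countably_subadditive)
  also have "\<dots> \<le> (\<Sum>i. hausdorff_measure s (A i))"
    by (intro suminf_le hausdorff_delta_le_measure \<open>\<delta> > 0\<close>) auto
  finally show "hausdorff_delta s \<delta> (\<Union>i. A i) \<le> (\<Sum>i. hausdorff_measure s (A i))" .
qed

lemma hausdorff_measure_Un_le:
  "hausdorff_measure s (A \<union> B) \<le> hausdorff_measure s A + hausdorff_measure s B"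
proof -
  define C where "C i = (if i = 0 then A else if i = 1 then B else {})" for i :: nat
  have "A \<union> B = (\<Union>i. C i)" by (auto simp: C_def split: if_splits)
  then have "hausdorff_measure s (A \<union> B) \<le> (\<Sum>i. hausdorff_measure s (C i))"
    by (simp add: hausdorff_measure_countably_subadditive)
  also have "\<dots> = (\<Sum>i<2. hausdorff_measure s (C i))"
    by (rule suminf_finite) (auto simp: C_def)
  also have "\<dots> = hausdorff_measure s A + hausdorff_measure s B"
    by (simp add: C_def numeral_2_eq_2)
  finally show ?thesis .
qed

lemma hausdorff_measure_UN_finite_le:
  assumes "finite I"
  shows "hausdorff_measure s (\<Union>i\<in>I. A i) \<le> (\<Sum>i\<in>I. hausdorff_measure s (A i))"
  using assms
proof (induction I)
  case (insert x F)
  then show ?case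
    using hausdorff_measure_Un_le[of s "A x" "\<Union>i\<in>F. A i"] by (auto intro: order_trans add_left_mono)
qed auto

lemma diameter_le_of_dist_le:
  fixes A :: "'a::metric_space set"
  assumes "\<And>x y. x \<in> A \<Longrightarrow> y \<in> A \<Longrightarrow> dist x y \<le> d" "0 \<le> d"
  shows "bounded A" "diameter A \<le> d"
proof -
  show "bounded A"
  proof (cases "A = {}")
    case False
    then obtain x where "x \<in> A" by auto
    then show ?thesis unfolding bounded_def using assms by blast
  qed auto
  show "diameter A \<le> d"
    unfolding diameter_def using assms by (auto intro!: cSUP_least)
qed

lemma hausdorff_measure_similitude_le:
  fixes f :: "'a::metric_space \<Rightarrow> 'a"
  assumes f: "similitude \<rho> f" and \<rho>: "0 < \<rho>" and s: "0 < s"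
  shows "hausdorff_measure s (f ` A) \<le> ennreal (\<rho> powr s) * hausdorff_measure s A"
proof (rule hausdorff_measure_leI)
  fix \<delta> :: real assume \<delta>: "\<delta> > 0"
  have bd: "bounded (f ` U)" "diameter (f ` U) \<le> \<rho> * diameter U" if U: "bounded U" for U
  proof -
    have d: "dist (f x) (f y) \<le> \<rho> * diameter U" if "x \<in> U" "y \<in> U" for x y
      using f that \<rho> diameter_bounded_bound[OF U, of x y]
      by (auto simp: similitude_def intro!: mult_left_mono)
    show "bounded (f ` U)" "diameter (f ` U) \<le> \<rho> * diameter U"
      using d diameter_le_of_dist_le[of "f ` U" "\<rho> * diameter U"] \<rho> diameter_ge_0[OF U] by auto
  qed
  have w: "hausdorff_weight s (f ` U) \<le> ennreal (\<rho> powr s) * hausdorff_weight s U"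
    if U: "bounded U" for U
  proof (cases "U = {}")
    case False
    have "diameter (f ` U) powr s \<le> (\<rho> * diameter U) powr s"
      using bd[OF U] s diameter_ge_0[OF bd(1)[OF U]] by (intro powr_mono2) auto
    also have "\<dots> = \<rho> powr s * diameter U powr s"
      using \<rho> diameter_ge_0[OF U] by (simp add: powr_mult)
    finally show ?thesis
      using False s by (simp add: hausdorff_weight_def ennreal_mult[symmetric] ennreal_leI)
  qed auto
  have "hausdorff_delta s \<delta> (f ` A) \<le> ennreal (\<rho> powr s) * hausdorff_delta s (\<delta>/\<rho>) A"
  proof -
    have "hausdorff_delta s \<delta> (f ` A) \<le> ennreal (\<rho> powr s) * (\<Sum>i. hausdorff_weight s (U i))"
      if U: "A \<subseteq> (\<Union>i::nat. U i)" "\<forall>i. bounded (U i) \<and> diameter (U i) \<le> \<delta>/\<rho>" for U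
    proof -
      have "hausdorff_delta s \<delta> (f ` A) \<le> (\<Sum>i. hausdorff_weight s (f ` U i))"
      proof (rule hausdorff_delta_cover_le)
        show "f ` A \<subseteq> (\<Union>i. f ` U i)" using U(1) by blast
        show "bounded (f ` U i)" for i using U(2) bd by blast
        show "diameter (f ` U i) \<le> \<delta>" for i
          using bd(2)[of "U i"] U(2) \<rho>
          by (metis order_trans pos_le_divide_eq mult.commute)
      qed
      also have "\<dots> \<le> (\<Sum>i. ennreal (\<rho> powr s) * hausdorff_weight s (U i))"
        using w U(2) by (intro suminf_le) auto
      finally show ?thesis by simp
    qed
    then have "hausdorff_delta s \<delta> (f ` A) / ennreal (\<rho> powr s) \<le> hausdorff_delta s (\<delta>/\<rho>) A"
      unfolding hausdorff_delta_def[of s "\<delta>/\<rho>"] using \<rho>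
      by (intro INF_greatest, intro divide_le_posI_ennreal) (auto simp: mult.commute)
    then have "ennreal (\<rho> powr s) * (hausdorff_delta s \<delta> (f ` A) / ennreal (\<rho> powr s))
        \<le> ennreal (\<rho> powr s) * hausdorff_delta s (\<delta>/\<rho>) A"
      by (rule mult_left_mono) auto
    moreover have "ennreal (\<rho> powr s) * (hausdorff_delta s \<delta> (f ` A) / ennreal (\<rho> powr s))
        = hausdorff_delta s \<delta> (f ` A)"
      using \<rho> by (simp add: ennreal_times_divide mult.commute[of "ennreal _"] mult_divide_eq_ennreal)
    ultimately show ?thesis by simp
  qed
  also have "\<dots> \<le> ennreal (\<rho> powr s) * hausdorff_measure s A"
    using \<rho> \<delta> by (intro mult_left_mono hausdorff_delta_le_measure) auto
  finally show "hausdorff_delta s \<delta> (f ` A) \<le> ennreal (\<rho> powr s) * hausdorff_measure s A" .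
qed

text \<open>
  A map that is Hoelder continuous with exponent \<open>1/s\<close> does not increase \<open>s\<close>-dimensional size: an
  interval of length \<open>l\<close> has an image of diameter at most \<open>C l powr (1/s)\<close>, whose weight is at most
  \<open>C powr s * l\<close>.
\<close>

lemma hausdorff_null_Hoelder_image:
  fixes \<psi> :: "real \<Rightarrow> 'a::metric_space"
  assumes s: "0 < s" and C: "0 < C"
    and hoelder: "\<And>x y. x \<in> {0..1} \<Longrightarrow> y \<in> {0..1} \<Longrightarrow> dist (\<psi> x) (\<psi> y) \<le> C * \<bar>x - y\<bar> powr (1/s)"
    and Z: "Z \<in> null_sets lebesgue" "Z \<subseteq> {0..1}"
  shows "hausdorff_measure s (\<psi> ` Z) = 0"
proof -
  have "hausdorff_measure s (\<psi> ` Z) \<le> 0"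
  proof (rule hausdorff_measure_leI, rule ennreal_le_epsilon)
    fix \<delta> e :: real assume \<delta>: "\<delta> > 0" and e: "0 < e"
    define \<epsilon> where "\<epsilon> = min (e / C powr s) ((\<delta>/C) powr s)"
    have \<epsilon>: "\<epsilon> > 0" using e \<delta> C by (simp add: \<epsilon>_def)
    have ZL: "Z \<in> lmeasurable" "measure lebesgue Z = 0"
      using Z by (auto simp: fmeasurable_def measure_def null_sets_def)
    obtain \<D> where D: "countable \<D>" "\<And>K. K \<in> \<D> \<Longrightarrow> K \<subseteq> cbox 0 1 \<and> K \<noteq> {} \<and> (\<exists>c d. K = cbox c d)"
        "pairwise (\<lambda>A B. interior A \<inter> interior B = {}) \<D>" "Z \<subseteq> \<Union>\<D>" "\<Union>\<D> \<in> lmeasurable"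
        "measure lebesgue (\<Union>\<D>) \<le> measure lebesgue Z + \<epsilon>"
      using measurable_outer_intervals_bounded[OF ZL(1) _ \<epsilon>, of 0 1] Z(2)
      by (metis (no_types, lifting) box_real(2))
    \<comment> \<open>The intervals do not overlap, so their total length is the measure of their union.\<close>
    have len: "(\<Sum>K\<in>\<F>. measure lebesgue K) \<le> \<epsilon>" if \<F>: "finite \<F>" "\<F> \<subseteq> \<D>" for \<F>
    proof -
      have "(\<Sum>K\<in>\<F>. measure lebesgue K) = measure lebesgue (\<Union>\<F>)"
      proof (rule measure_negligible_finite_Union[symmetric, OF \<F>(1)])
        show "K \<in> lmeasurable" if "K \<in> \<F>" for K
          using D(2)[of K] \<F>(2) that by auto
        show "pairwise (\<lambda>S T. negligible (S \<inter> T)) \<F>"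
        proof (intro pairwiseI)
          fix A B assume AB: "A \<in> \<F>" "B \<in> \<F>" "A \<noteq> B"
          then have "interior A \<inter> interior B = {}"
            using D(3) \<F>(2) by (meson pairwiseD subsetD)
          then have "interior (A \<inter> B) = {}" by simp
          moreover obtain c d where "A = cbox c d" using D(2)[of A] AB \<F>(2) by auto
          moreover obtain c' d' where "B = cbox c' d'" using D(2)[of B] AB \<F>(2) by auto
          ultimately show "negligible (A \<inter> B)"
            by (simp only: Int_interval interior_cbox negligible_interval(1))
        qed
      qed
      also have "\<dots> \<le> measure lebesgue (\<Union>\<D>)"
      proof (rule measure_mono_fmeasurable[OF _ _ D(5)])
        have "K \<in> sets lebesgue" if K: "K \<in> \<F>" for K
        proof -
          obtain c d where "K = cbox c d" using D(2)[of K] K \<F>(2) by auto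
          then show ?thesis by simp
        qed
        then show "\<Union>\<F> \<in> sets lebesgue" using \<F>(1) by blast
      qed (use \<F> in auto)
      finally show ?thesis using D(6) ZL(2) by simp
    qed
    have len1: "measure lebesgue K \<le> \<epsilon>" if "K \<in> \<D>" for K
      using len[of "{K}"] that by simp
    have img: "bounded (\<psi> ` K)" "diameter (\<psi> ` K) \<le> C * measure lebesgue K powr (1/s)" if "K \<in> \<D>" for K
    proof -
      obtain c d where K: "K = {c..d}" "c \<le> d" "K \<subseteq> {0..1}"
        using D(2)[of K] \<open>K \<in> \<D>\<close> by auto
      have "dist x y \<le> C * measure lebesgue K powr (1/s)" if "x \<in> \<psi> ` K" "y \<in> \<psi> ` K" for x y
      proof -
        obtain u v where uv: "u \<in> K" "v \<in> K" "x = \<psi> u" "y = \<psi> v" using \<open>x \<in> \<psi> ` K\<close> \<open>y \<in> \<psi> ` K\<close> by auto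
        have "dist x y \<le> C * \<bar>u - v\<bar> powr (1/s)" using hoelder[of u v] uv K(3) by blast
        also have "\<dots> \<le> C * measure lebesgue K powr (1/s)"
          using uv K C s by (intro mult_left_mono powr_mono2) auto
        finally show ?thesis .
      qed
      then show "bounded (\<psi> ` K)" "diameter (\<psi> ` K) \<le> C * measure lebesgue K powr (1/s)"
        using diameter_le_of_dist_le[of "\<psi> ` K" "C * measure lebesgue K powr (1/s)"] C by auto
    qed
    have weight: "hausdorff_weight s (\<psi> ` K) \<le> ennreal (C powr s * measure lebesgue K)" if "K \<in> \<D>" for K
    proof -
      have "diameter (\<psi> ` K) powr s \<le> (C * measure lebesgue K powr (1/s)) powr s"
        using img[OF that] s by (intro powr_mono2) (auto simp: diameter_ge_0)
      also have "\<dots> = C powr s * measure lebesgue K"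
        using C s by (simp add: powr_mult powr_powr)
      finally show ?thesis
        using s by (auto simp: hausdorff_weight_def intro!: ennreal_leI)
    qed
    define U where "U i = (if i \<in> to_nat_on \<D> ` \<D> then \<psi> ` (from_nat_into \<D> i) else {})" for i
    have U_eq: "U (to_nat_on \<D> K) = \<psi> ` K" if "K \<in> \<D>" for K
      using that D(1) by (simp add: U_def)
    have "hausdorff_delta s \<delta> (\<psi> ` Z) \<le> (\<Sum>i. hausdorff_weight s (U i))"
    proof (rule hausdorff_delta_cover_le)
      show "\<psi> ` Z \<subseteq> (\<Union>i. U i)"
      proof (rule image_subsetI)
        fix z assume "z \<in> Z"
        then obtain K where "K \<in> \<D>" "z \<in> K" using D(4) by auto
        then have "\<psi> z \<in> U (to_nat_on \<D> K)" by (auto simp: U_eq)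
        then show "\<psi> z \<in> (\<Union>i. U i)" by blast
      qed
      show "bounded (U i)" for i using img(1) D(1) by (auto simp: U_def)
      show "diameter (U i) \<le> \<delta>" for i
      proof (cases "i \<in> to_nat_on \<D> ` \<D>")
        case True
        then obtain K where K: "K \<in> \<D>" "U i = \<psi> ` K" using U_eq by auto
        have "diameter (\<psi> ` K) \<le> C * \<epsilon> powr (1/s)"
          using img(2)[OF K(1)] len1[OF K(1)] C s
          by (smt (verit) divide_nonneg_pos measure_nonneg mult_left_mono powr_mono2)
        also have "\<dots> \<le> C * ((\<delta>/C) powr s) powr (1/s)"
          using C s \<epsilon> by (intro mult_left_mono powr_mono2) (auto simp: \<epsilon>_def)
        also have "\<dots> = \<delta>" using C s \<delta> by (simp add: powr_powr)
        finally show ?thesis using K by simp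
      qed (use \<delta> in \<open>auto simp: U_def\<close>)
    qed
    also have "\<dots> \<le> ennreal e"
    proof (rule suminf_le_const)
      show "summable (\<lambda>i. hausdorff_weight s (U i))" by simp
      fix n
      define \<F> where "\<F> = {K \<in> \<D>. to_nat_on \<D> K < n}"
      have inj: "inj_on (to_nat_on \<D>) \<D>" using D(1) by (rule inj_on_to_nat_on)
      have fin: "finite \<F>"
      proof (rule finite_imageD)
        show "finite (to_nat_on \<D> ` \<F>)" by (rule finite_subset[of _ "{..<n}"]) (auto simp: \<F>_def)
        show "inj_on (to_nat_on \<D>) \<F>" using inj by (rule inj_on_subset) (auto simp: \<F>_def)
      qed
      have "(\<Sum>i<n. hausdorff_weight s (U i)) = (\<Sum>i\<in>to_nat_on \<D> ` \<F>. hausdorff_weight s (U i))"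
        by (rule sum.mono_neutral_right) (auto simp: \<F>_def U_def)
      also have "\<dots> = (\<Sum>K\<in>\<F>. hausdorff_weight s (U (to_nat_on \<D> K)))"
        by (rule sum.reindex_cong[OF inj_on_subset[OF inj]]) (auto simp: \<F>_def)
      also have "\<dots> \<le> (\<Sum>K\<in>\<F>. ennreal (C powr s * measure lebesgue K))"
        by (rule sum_mono) (use weight U_eq in \<open>auto simp: \<F>_def\<close>)
      also have "\<dots> = ennreal (C powr s * (\<Sum>K\<in>\<F>. measure lebesgue K))"
        by (subst sum_ennreal) (auto simp: sum_distrib_left)
      also have "\<dots> \<le> ennreal (C powr s * \<epsilon>)"
        using len[of \<F>] fin by (intro ennreal_leI mult_left_mono) (auto simp: \<F>_def)
      also have "\<dots> \<le> ennreal e"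
      proof (rule ennreal_leI)
        have "C powr s * \<epsilon> \<le> C powr s * (e / C powr s)"
          by (intro mult_left_mono) (auto simp: \<epsilon>_def)
        then show "C powr s * \<epsilon> \<le> e" using C by simp
      qed
      finally show "(\<Sum>i<n. hausdorff_weight s (U i)) \<le> ennreal e" .
    qed
    finally show "hausdorff_delta s \<delta> (\<psi> ` Z) \<le> 0 + ennreal e" by simp
  qed
  then show ?thesis by simp
qed

text \<open>
  Shrinking the mesh multiplies the \<open>t\<close>-weights by at most \<open>\<delta> powr (t - s)\<close> compared with the
  \<open>s\<close>-weights, so a set of positive finite \<open>s\<close>-measure has dimension \<open>s\<close>.
\<close>

lemma hausdorff_delta_exponent_le:
  assumes st: "0 \<le> s" "s < t" and \<delta>: "0 < \<delta>"
  shows "hausdorff_delta t \<delta> A \<le> ennreal (\<delta> powr (t - s)) * hausdorff_delta s \<delta> A"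
proof -
  have w: "hausdorff_weight t U \<le> ennreal (\<delta> powr (t - s)) * hausdorff_weight s U"
    if U: "bounded U" "diameter U \<le> \<delta>" for U :: "'a set"
  proof (cases "U = {}")
    case False
    have d0: "0 \<le> diameter U" using U by (simp add: diameter_ge_0)
    have le: "diameter U powr t \<le> \<delta> powr (t - s) * (if s = 0 then 1 else diameter U powr s)"
    proof (cases "diameter U = 0 \<or> s = 0")
      case False
      have "diameter U powr t = diameter U powr (t - s) * diameter U powr s"
        by (simp add: powr_add[symmetric])
      also have "\<dots> \<le> \<delta> powr (t - s) * diameter U powr s"
        using U d0 st by (intro mult_right_mono powr_mono2) auto
      finally show ?thesis using False by simp
    next
      case True
      then show ?thesis using U d0 st powr_mono2[of t "diameter U" \<delta>] by auto
    qed
    then show ?thesis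
      using False st by (auto simp: hausdorff_weight_def ennreal_mult[symmetric] intro!: ennreal_leI)
  qed auto
  have "hausdorff_delta t \<delta> A / ennreal (\<delta> powr (t - s)) \<le> hausdorff_delta s \<delta> A"
    unfolding hausdorff_delta_def[of s]
  proof (intro INF_greatest, intro divide_le_posI_ennreal)
    fix U :: "nat \<Rightarrow> 'a set"
    assume "U \<in> {U. A \<subseteq> (\<Union>i. U i) \<and> (\<forall>i. bounded (U i) \<and> diameter (U i) \<le> \<delta>)}"
    then have U: "A \<subseteq> (\<Union>i. U i)" "\<And>i. bounded (U i)" "\<And>i. diameter (U i) \<le> \<delta>" by auto
    have "hausdorff_delta t \<delta> A \<le> (\<Sum>i. hausdorff_weight t (U i))"
      using U by (rule hausdorff_delta_cover_le)
    also have "\<dots> \<le> (\<Sum>i. ennreal (\<delta> powr (t - s)) * hausdorff_weight s (U i))"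
      using w U by (intro suminf_le) auto
    finally show "hausdorff_delta t \<delta> A \<le> ennreal (\<delta> powr (t - s)) * (\<Sum>i. hausdorff_weight s (U i))"
      by (simp add: mult.commute)
  qed (use \<delta> in auto)
  then have "ennreal (\<delta> powr (t - s)) * (hausdorff_delta t \<delta> A / ennreal (\<delta> powr (t - s)))
      \<le> ennreal (\<delta> powr (t - s)) * hausdorff_delta s \<delta> A"
    by (rule mult_left_mono) auto
  moreover have "ennreal (\<delta> powr (t - s)) * (hausdorff_delta t \<delta> A / ennreal (\<delta> powr (t - s)))
      = hausdorff_delta t \<delta> A"
    using \<delta> by (simp add: ennreal_times_divide mult.commute[of "ennreal _"] mult_divide_eq_ennreal)
  ultimately show ?thesis by simp
qed

lemma hausdorff_delta_antimono:
  assumes "\<delta> \<le> \<delta>'"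
  shows "hausdorff_delta s \<delta>' A \<le> hausdorff_delta s \<delta> A"
  unfolding hausdorff_delta_def by (rule INF_superset_mono) (auto intro: order.trans[OF _ assms])

lemma hausdorff_measure_above_finite:
  assumes st: "0 \<le> s" "s < t" and fin: "hausdorff_measure s A < \<infinity>"
  shows "hausdorff_measure t A = 0"
proof -
  obtain m where m: "hausdorff_measure s A = ennreal m" "0 \<le> m"
    using fin by (cases "hausdorff_measure s A") auto
  have "hausdorff_measure t A \<le> 0"
  proof (rule hausdorff_measure_leI, rule ennreal_le_epsilon)
    fix \<delta> e :: real assume \<delta>: "\<delta> > 0" and e: "0 < e"
    define \<eta> where "\<eta> = min \<delta> ((e / (m + 1)) powr (1 / (t - s)))"
    have "0 < e / (m + 1)" using e m by simp
    then have \<eta>: "\<eta> > 0" using \<delta> by (simp only: \<eta>_def min_less_iff_conj powr_gt_zero) auto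
    have "\<eta> powr (t - s) \<le> ((e / (m + 1)) powr (1 / (t - s))) powr (t - s)"
      using st \<eta> by (intro powr_mono2) (auto simp: \<eta>_def)
    also have "\<dots> = e / (m + 1)" using st e m by (subst powr_powr) auto
    finally have le: "\<eta> powr (t - s) * m \<le> e"
      using m e by (smt (verit) divide_nonneg_nonneg mult_left_mono mult_right_mono nonzero_eq_divide_eq)
    have "hausdorff_delta t \<delta> A \<le> hausdorff_delta t \<eta> A"
      by (rule hausdorff_delta_antimono) (simp add: \<eta>_def)
    also have "\<dots> \<le> ennreal (\<eta> powr (t - s)) * hausdorff_delta s \<eta> A"
      using st \<eta> by (rule hausdorff_delta_exponent_le)
    also have "\<dots> \<le> ennreal (\<eta> powr (t - s)) * ennreal m"
      using hausdorff_delta_le_measure[OF \<eta>, of s A] m by (intro mult_left_mono) auto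
    also have "\<dots> \<le> ennreal e"
      using le m by (simp add: ennreal_mult[symmetric] ennreal_leI)
    finally show "hausdorff_delta t \<delta> A \<le> 0 + ennreal e" by simp
  qed
  then show ?thesis by simp
qed

lemma hausdorff_dim_eqI:
  fixes A :: "'a::euclidean_space set"
  assumes s: "0 \<le> s" and pos: "0 < hausdorff_measure s A" and fin: "hausdorff_measure s A < \<infinity>"
  shows "hausdorff_dim A = s"
proof -
  have above: "t \<in> {t. 0 \<le> t \<and> hausdorff_measure t A = 0}" if st: "s < t" for t
  proof -
    have "hausdorff_measure t A = 0" using s st fin by (rule hausdorff_measure_above_finite)
    moreover have "0 \<le> t" using s st by linarith
    ultimately show ?thesis by blast
  qed
  have below: "s \<le> t" if "t \<in> {t. 0 \<le> t \<and> hausdorff_measure t A = 0}" for t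
  proof (rule ccontr)
    assume "\<not> s \<le> t"
    then have "hausdorff_measure s A = 0"
      using that by (intro hausdorff_measure_above_finite[of t s A]) auto
    then show False using pos by simp
  qed
  have bdd: "bdd_below {t. 0 \<le> t \<and> hausdorff_measure t A = 0}"
    using below by (rule bdd_belowI)
  have "Inf {t. 0 \<le> t \<and> hausdorff_measure t A = 0} \<le> s"
  proof (rule field_le_epsilon)
    fix e :: real assume "0 < e"
    then show "Inf {t. 0 \<le> t \<and> hausdorff_measure t A = 0} \<le> s + e"
      by (intro cInf_lower above bdd) auto
  qed
  moreover have "s \<le> Inf {t. 0 \<le> t \<and> hausdorff_measure t A = 0}"
    by (rule cInf_greatest) (use above[of "s+1"] below in auto)
  ultimately show ?thesis unfolding hausdorff_dim_def by simp
qed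

section \<open>Words and cells\<close>

definition words :: "nat \<Rightarrow> nat \<Rightarrow> nat list set" where
  "words N n = {w. set w \<subseteq> {1..N} \<and> length w = n}"

lemma words_0 [simp]: "words N 0 = {[]}"
  by (auto simp: words_def)

lemma finite_words [simp]: "finite (words N n)"
  unfolding words_def by (rule finite_lists_length_eq) auto

lemma card_words: "card (words N n) = N ^ n"
  using card_lists_length_eq[of "{1..N}" n] by (simp add: words_def)

lemma words_length: "w \<in> words N n \<Longrightarrow> length w = n"
  by (simp add: words_def)

lemma words_append: "u \<in> words N m \<Longrightarrow> v \<in> words N n \<Longrightarrow> u @ v \<in> words N (m + n)"
  by (auto simp: words_def)

lemma words_append_split:
  assumes "w \<in> words N (m + n)"
  obtains u v where "w = u @ v" "u \<in> words N m" "v \<in> words N n"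
proof
  show "w = take m w @ drop m w" by simp
  show "take m w \<in> words N m" "drop m w \<in> words N n"
    using assms by (auto simp: words_def dest: in_set_takeD in_set_dropD)
qed

lemma words_add: "words N (m + n) = (\<lambda>(u, v). u @ v) ` (words N m \<times> words N n)"
  by (auto intro: words_append elim!: words_append_split simp: image_iff)

lemma words_1: "words N 1 = (\<lambda>j. [j]) ` {1..N}"
  by (auto simp: words_def length_Suc_conv)

lemma inj_on_append_words: "inj_on (\<lambda>(u, v). u @ v) (words N m \<times> words N n)"
  by (auto simp: inj_on_def words_def)

lemma sum_words_add:
  "(\<Sum>w\<in>words N (m + n). f w) = (\<Sum>u\<in>words N m. \<Sum>v\<in>words N n. f (u @ v))"
  unfolding words_add sum.reindex[OF inj_on_append_words] sum.cartesian_product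
  by (simp add: case_prod_unfold)

lemma word_map_append: "word_map S (I @ J) = word_map S I \<circ> word_map S J"
  by (induction I) (auto simp: fun_eq_iff)

lemma word_ratio_append [simp]: "word_ratio r (I @ J) = word_ratio r I * word_ratio r J"
  by (simp add: word_ratio_def)

lemma word_ratio_Nil [simp]: "word_ratio r [] = 1"
  and word_ratio_Cons [simp]: "word_ratio r (i # I) = r i * word_ratio r I"
  by (simp_all add: word_ratio_def)

locale similitude_system =
  fixes N :: nat and S :: "nat \<Rightarrow> 'a::euclidean_space \<Rightarrow> 'a" and r :: "nat \<Rightarrow> real" and K :: "'a set"
  assumes sys: "similitude_ifs N S r" and inv: "invariant_set N S K"
begin

lemma N_ge_2: "2 \<le> N"
  using sys by (simp add: similitude_ifs_def)

lemma ratio_bounds: "j \<in> {1..N} \<Longrightarrow> 0 < r j" "j \<in> {1..N} \<Longrightarrow> r j < 1"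
  using sys by (auto simp: similitude_ifs_def)

lemma letters_ne: "r ` {1..N} \<noteq> {}"
  using N_ge_2 by auto

definition rmin where "rmin = ratio_min N r"
definition rmax where "rmax = Max (r ` {1..N})"

lemma rmin_le: "j \<in> {1..N} \<Longrightarrow> rmin \<le> r j"
  by (simp add: rmin_def ratio_min_def)

lemma rmax_ge: "j \<in> {1..N} \<Longrightarrow> r j \<le> rmax"
  by (simp add: rmax_def)

lemma rmin_pos: "0 < rmin" and rmin_less_1: "rmin < 1"
proof -
  have "rmin \<in> r ` {1..N}" using letters_ne by (simp add: rmin_def ratio_min_def)
  then show "0 < rmin" "rmin < 1" using ratio_bounds by auto
qed

lemma rmax_pos: "0 < rmax" and rmax_less_1: "rmax < 1"
proof -
  have "rmax \<in> r ` {1..N}" using letters_ne by (simp add: rmax_def)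
  then show "0 < rmax" "rmax < 1" using ratio_bounds by auto
qed

lemma word_ratio_pos: "I \<in> words N n \<Longrightarrow> 0 < word_ratio r I"
  unfolding words_def word_ratio_def by (induction I arbitrary: n) (auto simp: ratio_bounds)

lemma word_ratio_le: "I \<in> words N n \<Longrightarrow> word_ratio r I \<le> rmax ^ n"
proof (induction I arbitrary: n)
  case (Cons i I)
  then obtain m where m: "n = Suc m" "I \<in> words N m" "i \<in> {1..N}" by (auto simp: words_def)
  then show ?case
    using Cons.IH[of m] rmax_ge[of i] ratio_bounds(1)[of i] word_ratio_pos[of I m] rmax_pos
    by (simp add: mult_mono)
qed (simp add: words_def)

lemma word_ratio_ge: "I \<in> words N n \<Longrightarrow> rmin ^ n \<le> word_ratio r I"
proof (induction I arbitrary: n)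
  case (Cons i I)
  then obtain m where m: "n = Suc m" "I \<in> words N m" "i \<in> {1..N}" by (auto simp: words_def)
  then show ?case
    using Cons.IH[of m] rmin_le[of i] ratio_bounds(1)[of i] rmin_pos
    by (auto intro!: mult_mono simp: less_imp_le)
qed (simp add: words_def)

lemma word_map_dist:
  assumes "I \<in> words N n"
  shows "dist (word_map S I x) (word_map S I y) = word_ratio r I * dist x y"
  using assms
proof (induction I arbitrary: n)
  case (Cons i I)
  then obtain m where m: "n = Suc m" "I \<in> words N m" "i \<in> {1..N}" by (auto simp: words_def)
  then have "similitude (r i) (S i)" using sys by (auto simp: similitude_ifs_def)
  then show ?case using Cons.IH[OF m(2)] by (simp add: similitude_def)
qed simp

lemma word_map_similitude: "I \<in> words N n \<Longrightarrow> similitude (word_ratio r I) (word_map S I)"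
  by (simp add: similitude_def word_map_dist)

lemma word_map_inj: "I \<in> words N n \<Longrightarrow> inj (word_map S I)"
  by (rule injI) (metis dist_eq_0_iff mult_eq_0_iff order_less_irrefl word_map_dist word_ratio_pos)

lemma continuous_on_word_map: "I \<in> words N n \<Longrightarrow> continuous_on A (word_map S I)"
proof (rule continuous_on_subset[of UNIV])
  assume I: "I \<in> words N n"
  have "(word_ratio r I)-lipschitz_on UNIV (word_map S I)"
    by (rule lipschitz_onI) (use I word_map_dist[OF I] word_ratio_pos[OF I] in auto)
  then show "continuous_on UNIV (word_map S I)" by (rule lipschitz_on_continuous_on)
qed auto

definition cell where "cell I = word_map S I ` K"

lemma K_ne: "K \<noteq> {}" and K_compact: "compact K" and K_eq: "K = (\<Union>j\<in>{1..N}. S j ` K)"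
  using inv by (auto simp: invariant_set_def)

lemma cell_Nil [simp]: "cell [] = K"
  by (simp add: cell_def)

lemma cell_append: "cell (I @ J) = word_map S I ` cell J"
  by (auto simp: cell_def word_map_append)

lemma cell_ne: "cell I \<noteq> {}"
  using K_ne by (simp add: cell_def)

lemma cell_compact: "I \<in> words N n \<Longrightarrow> compact (cell I)"
  unfolding cell_def by (intro compact_continuous_image continuous_on_word_map K_compact)

lemma K_cells: "K = (\<Union>I\<in>words N n. cell I)"
proof (induction n)
  case (Suc n)
  have "words N (1 + n) = (\<lambda>(u, v). u @ v) ` (words N 1 \<times> words N n)" by (rule words_add)
  then have "(\<Union>I\<in>words N (Suc n). cell I) = (\<Union>j\<in>{1..N}. \<Union>I\<in>words N n. cell ([j] @ I))"
    by (fastforce simp: words_1[unfolded One_nat_def])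
  also have "\<dots> = (\<Union>j\<in>{1..N}. S j ` (\<Union>I\<in>words N n. cell I))"
    by (simp only: cell_append image_UN word_map.simps comp_id)
  also have "\<dots> = K" using Suc K_eq by simp
  finally show ?case by simp
qed simp

lemma cell_subcells: "cell I = (\<Union>J\<in>words N n. cell (I @ J))"
proof -
  have "cell I = word_map S I ` (\<Union>J\<in>words N n. cell J)"
    using K_cells[of n] by (simp add: cell_def)
  then show ?thesis by (simp only: image_UN cell_append)
qed

lemma cell_append_subset: "J \<in> words N n \<Longrightarrow> cell (I @ J) \<subseteq> cell I"
  using cell_subcells[of I n] by blast

lemma cell_subset_K: "I \<in> words N n \<Longrightarrow> cell I \<subseteq> K"
  using K_cells[of n] by blast

definition diamK where "diamK = diameter K"

lemma dist_K_le: "x \<in> K \<Longrightarrow> y \<in> K \<Longrightarrow> dist x y \<le> diamK"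
  unfolding diamK_def by (rule diameter_bounded_bound[OF compact_imp_bounded[OF K_compact]])

lemma diamK_nonneg: "0 \<le> diamK"
  using K_ne dist_K_le by (metis all_not_in_conv zero_le_dist order_trans)

lemma dist_cell_le:
  assumes "I \<in> words N n" "x \<in> cell I" "y \<in> cell I"
  shows "dist x y \<le> word_ratio r I * diamK"
  using assms word_ratio_pos[OF assms(1)] dist_K_le
  by (auto simp: cell_def word_map_dist intro!: mult_left_mono)

lemma dist_cell_le_level:
  assumes "I \<in> words N n" "x \<in> cell I" "y \<in> cell I"
  shows "dist x y \<le> rmax ^ n * diamK"
  using dist_cell_le[OF assms] word_ratio_le[OF assms(1)] diamK_nonneg
  by (meson mult_right_mono order_trans)

lemma rmax_power_tendsto_0: "(\<lambda>n. rmax ^ n) \<longlonglongrightarrow> 0"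
  using rmax_pos rmax_less_1 by (intro LIMSEQ_power_zero) auto

end

section \<open>The similarity dimension\<close>

locale moran_system = similitude_system +
  fixes s :: real
  assumes s_pos: "0 < s" and moran: "(\<Sum>j\<in>{1..N}. r j powr s) = 1"
begin

definition wt where "wt I = word_ratio r I powr s"

lemma wt_Nil [simp]: "wt [] = 1"
  by (simp add: wt_def)

lemma wt_append: "I \<in> words N m \<Longrightarrow> J \<in> words N n \<Longrightarrow> wt (I @ J) = wt I * wt J"
  using word_ratio_pos[of I m] word_ratio_pos[of J n] by (simp add: wt_def powr_mult)

lemma wt_pos: "I \<in> words N n \<Longrightarrow> 0 < wt I"
  using word_ratio_pos[of I n] by (simp add: wt_def)

lemma sum_wt: "(\<Sum>I\<in>words N n. wt I) = 1"
proof (induction n)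
  case (Suc n)
  have "(\<Sum>I\<in>words N (1 + n). wt I) = (\<Sum>u\<in>words N 1. \<Sum>v\<in>words N n. wt (u @ v))"
    by (rule sum_words_add)
  also have "\<dots> = (\<Sum>u\<in>words N 1. \<Sum>v\<in>words N n. wt u * wt v)"
    by (intro sum.cong refl wt_append)
  also have "\<dots> = (\<Sum>u\<in>words N 1. wt u)"
    using Suc by (simp add: sum_distrib_left[symmetric])
  also have "\<dots> = (\<Sum>j\<in>{1..N}. r j powr s)"
    unfolding words_1 by (subst sum.reindex) (auto simp: wt_def inj_on_def)
  finally show ?case using moran by simp
qed simp

lemma sum_wt_append: "I \<in> words N m \<Longrightarrow> (\<Sum>J\<in>words N n. wt (I @ J)) = wt I"
proof -
  assume I: "I \<in> words N m"
  have "(\<Sum>J\<in>words N n. wt (I @ J)) = (\<Sum>J\<in>words N n. wt I * wt J)"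
    using I by (intro sum.cong refl) (auto simp: wt_append)
  then show ?thesis by (simp add: sum_distrib_left[symmetric] sum_wt)
qed

lemma wt_le: "I \<in> words N n \<Longrightarrow> wt I \<le> (rmax powr s) ^ n"
proof -
  assume I: "I \<in> words N n"
  have "wt I \<le> (rmax ^ n) powr s"
    unfolding wt_def using word_ratio_le[OF I] word_ratio_pos[OF I] s_pos by (intro powr_mono2) auto
  then show ?thesis using rmax_pos by (simp add: powr_power[symmetric] powr_realpow[symmetric] powr_powr mult.commute)
qed

lemma wt_ge: "I \<in> words N n \<Longrightarrow> (rmin powr s) ^ n \<le> wt I"
proof -
  assume I: "I \<in> words N n"
  have "(rmin ^ n) powr s \<le> wt I"
    unfolding wt_def using word_ratio_ge[OF I] rmin_pos s_pos by (intro powr_mono2) auto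
  then show ?thesis using rmin_pos by (simp add: powr_power[symmetric] powr_realpow[symmetric] powr_powr mult.commute)
qed

lemma rmax_powr: "0 < rmax powr s" "rmax powr s < 1"
  using rmax_pos rmax_less_1 s_pos powr_less_mono2[of s rmax 1] by auto

lemma rmin_powr: "0 < rmin powr s" "rmin powr s < 1"
  using rmin_pos rmin_less_1 s_pos powr_less_mono2[of s rmin 1] by auto

lemma ratio_eq_wt: "I \<in> words N n \<Longrightarrow> word_ratio r I = wt I powr (1/s)"
  using s_pos word_ratio_pos[of I n] by (simp add: wt_def powr_powr)

end

lemma similarity_dimension_exists:
  assumes "similitude_ifs N S r"
  shows "\<exists>s>0. (\<Sum>j\<in>{1..N}. r j powr s) = 1"
proof -
  have N: "2 \<le> N" and r: "\<And>j. j \<in> {1..N} \<Longrightarrow> 0 < r j \<and> r j < 1"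
    using assms by (auto simp: similitude_ifs_def)
  define f where "f t = (\<Sum>j\<in>{1..N}. r j powr t)" for t
  have "((\<lambda>t. f t) \<longlongrightarrow> (\<Sum>j\<in>{1..N}. 0)) at_top"
    unfolding f_def
  proof (intro tendsto_sum)
    fix j assume "j \<in> {1..N}"
    then have "0 < r j" "ln (r j) < 0" using r[of j] by auto
    then have "((\<lambda>t. exp (t * ln (r j))) \<longlongrightarrow> 0) at_top"
      by (intro filterlim_compose[OF exp_at_bot] filterlim_tendsto_neg_mult_at_bot[OF tendsto_const, of "ln (r j)", simplified mult.commute] filterlim_ident)
    then show "((\<lambda>t. r j powr t) \<longlongrightarrow> 0) at_top" using \<open>0 < r j\<close> by (simp add: powr_def)
  qed
  then have "eventually (\<lambda>t. f t < 1) at_top" by (intro order_tendstoD(2)) auto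
  then obtain b where b: "\<And>t. t \<ge> b \<Longrightarrow> f t < 1" by (auto simp: eventually_at_top_linorder)
  have f0: "f 0 = real N"
    unfolding f_def using r by (subst sum.cong[where h="\<lambda>_. 1"]) (auto, fastforce)
  have "continuous_on {0..max b 0} f"
    unfolding f_def using r by (intro continuous_intros) fastforce+
  then have "\<exists>x\<ge>0. x \<le> max b 0 \<and> f x = 1"
    using b[of "max b 0"] f0 N by (intro IVT2') auto
  then obtain x where "0 \<le> x" "f x = 1" by auto
  then have "0 < x" "f x = 1" using f0 N by (auto simp: less_le)
  then show ?thesis unfolding f_def by blast
qed

section \<open>Ordered systems of pieces and their weights\<close>

text \<open>
  The curve is produced from a tree of \<^emph>\<open>pieces\<close>. The pieces of level \<open>n\<close> form a list, the list
  of the next level is obtained by replacing every piece by the list of its children, and each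
  piece \<open>p\<close> lives in the cell of a word \<open>wd p\<close>. Several pieces may live in the same cell: they
  are the successive visits of the curve to this cell.
\<close>

primrec chain_level :: "'p list \<Rightarrow> ('p \<Rightarrow> 'p list) \<Rightarrow> nat \<Rightarrow> 'p list" where
  "chain_level L ch 0 = L"
| "chain_level L ch (Suc n) = concat (map ch (chain_level L ch n))"

lemma chain_level_add: "chain_level L ch (m + n) = chain_level (chain_level L ch m) ch n"
  by (induction n) auto

lemma chain_level_Nil [simp]: "chain_level [] ch n = []"
  by (induction n) auto

lemma chain_level_append: "chain_level (xs @ ys) ch n = chain_level xs ch n @ chain_level ys ch n"
  by (induction n) auto

lemma chain_level_conv_concat: "chain_level L ch n = concat (map (\<lambda>p. chain_level [p] ch n) L)"
proof (induction L)
  case (Cons a L)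
  then show ?case using chain_level_append[of "[a]" L ch n] by simp
qed simp

lemma distinct_concat_map_disjoint:
  assumes "distinct (concat (map f xs))" "x \<in> set xs" "y \<in> set xs" "z \<in> set (f x)" "z \<in> set (f y)"
  shows "x = y"
  using assms by (induction xs) auto

locale piece_system = moran_system N S r K s
  for N :: nat and S :: "nat \<Rightarrow> 'a::euclidean_space \<Rightarrow> 'a" and r K s +
  fixes q :: nat and L0 :: "'p list" and ch :: "'p \<Rightarrow> 'p list" and wd :: "'p \<Rightarrow> nat list"
  assumes q_pos: "0 < q"
    and level_distinct: "distinct (chain_level L0 ch n)"
    and wd_root: "p \<in> set L0 \<Longrightarrow> wd p = []"
    and wd_child: "\<lbrakk>p \<in> set (chain_level L0 ch n); p' \<in> set (ch p)\<rbrakk> \<Longrightarrow> \<exists>b\<in>words N q. wd p' = wd p @ b"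
    and wd_onto: "I \<in> words N (n * q) \<Longrightarrow> \<exists>p\<in>set (chain_level L0 ch n). wd p = I"
    and owned_subcell: "p \<in> set (chain_level L0 ch n) \<Longrightarrow> \<exists>b\<in>words N (2 * q).
          \<forall>p'\<in>set (chain_level L0 ch (n + 2)). wd p' = wd p @ b \<longrightarrow> p' \<in> set (chain_level [p] ch 2)"
    and touch: "successively (\<lambda>p p'. cell (wd p) \<inter> cell (wd p') \<noteq> {}) (chain_level L0 ch n)"
begin

abbreviation lv where "lv \<equiv> chain_level L0 ch"
abbreviation desc where "desc j p \<equiv> set (chain_level [p] ch j)"

lemma wd_level: "p \<in> set (lv n) \<Longrightarrow> wd p \<in> words N (n * q)"
proof (induction n arbitrary: p)
  case 0
  then show ?case using wd_root by simp
next
  case (Suc n)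
  then obtain p0 where p0: "p0 \<in> set (lv n)" "p \<in> set (ch p0)" by auto
  then obtain b where "b \<in> words N q" "wd p = wd p0 @ b" using wd_child by blast
  then show ?case using words_append[OF Suc.IH[OF p0(1)], of b q] by (simp add: add.commute)
qed

lemma level_desc: "set (lv (n + j)) = (\<Union>p\<in>set (lv n). desc j p)"
  unfolding chain_level_add by (subst chain_level_conv_concat) simp

lemma desc_level: "p \<in> set (lv n) \<Longrightarrow> p' \<in> desc j p \<Longrightarrow> p' \<in> set (lv (n + j))"
  using level_desc by blast

lemma desc_unique: "\<lbrakk>p \<in> set (lv n); p' \<in> set (lv n); x \<in> desc j p; x \<in> desc j p'\<rbrakk> \<Longrightarrow> p = p'"
  using level_distinct[of "n + j"] unfolding chain_level_add
  by (subst (asm) chain_level_conv_concat) (rule distinct_concat_map_disjoint)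

lemma wd_desc: "\<lbrakk>p \<in> set (lv n); p' \<in> desc j p\<rbrakk> \<Longrightarrow> \<exists>b\<in>words N (j * q). wd p' = wd p @ b"
proof (induction j arbitrary: p')
  case (Suc j)
  then obtain p1 where p1: "p1 \<in> desc j p" "p' \<in> set (ch p1)" by auto
  obtain b where b: "b \<in> words N (j * q)" "wd p1 = wd p @ b" using Suc.IH Suc.prems(1) p1(1) by blast
  obtain c where c: "c \<in> words N q" "wd p' = wd p1 @ c"
    using wd_child[OF desc_level[OF Suc.prems(1) p1(1)] p1(2)] by blast
  show ?case
    using words_append[OF b(1) c(1)] b c by (intro bexI[of _ "b @ c"]) (auto simp: add.commute)
qed simp

text \<open>
  Pieces that live in the same cell compete for its weight. The weight of a deeper cell that only
  descendants of one piece visit can already be attributed to this piece.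
\<close>

definition owned where
  "owned n j p = {w \<in> words N ((n + j) * q). \<forall>p'\<in>set (lv (n + j)). wd p' = w \<longrightarrow> p' \<in> desc j p}"

definition unowned where
  "unowned n j = words N ((n + j) * q) - (\<Union>p\<in>set (lv n). owned n j p)"

lemma finite_owned [simp]: "finite (owned n j p)"
  by (auto simp: owned_def)

lemma owned_disjoint:
  assumes "p \<in> set (lv n)" "p' \<in> set (lv n)" "w \<in> owned n j p" "w \<in> owned n j p'"
  shows "p = p'"
proof -
  obtain x where "x \<in> set (lv (n + j))" "wd x = w"
    using wd_onto[of w "n + j"] assms(3) by (auto simp: owned_def)
  then show ?thesis using assms desc_unique[of p n p' x j] by (auto simp: owned_def)
qed

lemma owned_prefix:
  assumes "p \<in> set (lv n)" "w \<in> owned n j p"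
  shows "\<exists>b\<in>words N (j * q). w = wd p @ b"
proof -
  obtain x where "x \<in> set (lv (n + j))" "wd x = w"
    using wd_onto[of w "n + j"] assms(2) by (auto simp: owned_def)
  then show ?thesis using assms wd_desc[of p n x j] by (auto simp: owned_def)
qed

lemma owned_trans:
  assumes p: "p \<in> set (lv n)" and p': "p' \<in> desc i p" and w: "w \<in> owned (n + i) j p'"
  shows "w \<in> owned n (i + j) p"
proof -
  have "set (chain_level [p'] ch j) \<subseteq> desc (i + j) p"
    unfolding chain_level_add by (subst (2) chain_level_conv_concat) (use p' in auto)
  then show ?thesis using w by (auto simp: owned_def add.assoc)
qed

lemma owned_append:
  assumes w: "w \<in> owned n j p" and c: "c \<in> words N (i * q)"
  shows "w @ c \<in> owned n (j + i) p"
proof -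
  have "w \<in> words N ((n + j) * q)" using w by (simp add: owned_def)
  then have wc: "w @ c \<in> words N ((n + (j + i)) * q)"
    using words_append[OF _ c] by (fastforce simp: algebra_simps)
  moreover have "x \<in> desc (j + i) p" if x: "x \<in> set (lv (n + (j + i)))" "wd x = w @ c" for x
  proof -
    obtain y where y: "y \<in> set (lv (n + j))" "x \<in> desc i y"
      using x level_desc[of "n + j" i] by (auto simp: add.assoc)
    obtain b where b: "b \<in> words N (i * q)" "wd x = wd y @ b" using wd_desc[OF y] by blast
    then have "wd y = w" using x(2) c by (auto simp: words_def)
    then have "y \<in> desc j p" using w y(1) by (simp add: owned_def)
    then show ?thesis
      unfolding chain_level_add by (subst chain_level_conv_concat) (use y(2) in auto)
  qed
  ultimately show ?thesis by (auto simp: owned_def)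
qed

definition own_frac where "own_frac = (rmin powr s) ^ (2 * q)"

lemma own_frac: "0 < own_frac" "own_frac < 1"
  using rmin_powr q_pos by (auto simp: own_frac_def power_less_one_iff)

lemma owns_some:
  assumes "p \<in> set (lv n)"
  shows "\<exists>b\<in>words N (2 * q). wd p @ b \<in> owned n 2 p \<and> own_frac * wt (wd p) \<le> wt (wd p @ b)"
proof -
  obtain b where b1: "b \<in> words N (2 * q)"
    "\<forall>p'\<in>set (lv (n + 2)). wd p' = wd p @ b \<longrightarrow> p' \<in> desc 2 p"
    using owned_subcell[OF assms] by blast
  have "wd p @ b \<in> words N (n * q + 2 * q)" by (rule words_append[OF wd_level[OF assms] b1(1)])
  also have "n * q + 2 * q = (n + 2) * q" by (simp only: distrib_right)
  finally have b: "b \<in> words N (2 * q)" "wd p @ b \<in> owned n 2 p"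
    using b1 unfolding owned_def by blast+
  have "own_frac * wt (wd p) \<le> wt (wd p @ b)"
    using wt_append[OF wd_level[OF assms] b(1)] wt_ge[OF b(1)] wt_pos[OF wd_level[OF assms]]
    by (simp add: own_frac_def)
  then show ?thesis using b by blast
qed

text \<open>
  Among the extensions of an unowned word by two levels, at least one is owned; hence the total
  weight of the unowned words decays geometrically.
\<close>

lemma unowned_decay: "(\<Sum>w\<in>unowned n (j + 2). wt w) \<le> (1 - own_frac) * (\<Sum>w\<in>unowned n j. wt w)"
proof -
  have V: "w \<in> words N ((n + j) * q)" if "w \<in> unowned n j" for w
    using that by (simp add: unowned_def)
  have "\<exists>b\<in>words N (2 * q). w @ b \<notin> unowned n (j + 2) \<and> own_frac * wt w \<le> wt (w @ b)"
    if w: "w \<in> unowned n j" for w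
  proof -
    obtain x where x: "x \<in> set (lv (n + j))" "wd x = w" using wd_onto[OF V[OF w]] by auto
    obtain b where b: "b \<in> words N (2 * q)" "w @ b \<in> owned (n + j) 2 x" "own_frac * wt w \<le> wt (w @ b)"
      using owns_some[OF x(1)] x(2) by auto
    obtain p where p: "p \<in> set (lv n)" "x \<in> desc j p" using x(1) level_desc[of n j] by auto
    have "w @ b \<in> owned n (j + 2) p" by (rule owned_trans[OF p b(2)])
    then show ?thesis using b p by (auto simp: unowned_def)
  qed
  then obtain b where b: "\<And>w. w \<in> unowned n j \<Longrightarrow> b w \<in> words N (2 * q)"
     "\<And>w. w \<in> unowned n j \<Longrightarrow> w @ b w \<notin> unowned n (j + 2)"
     "\<And>w. w \<in> unowned n j \<Longrightarrow> own_frac * wt w \<le> wt (w @ b w)"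
    by metis
  let ?X = "Sigma (unowned n j) (\<lambda>w. words N (2 * q) - {b w})"
  have sub: "unowned n (j + 2) \<subseteq> (\<lambda>(w, c). w @ c) ` ?X"
  proof
    fix v assume v: "v \<in> unowned n (j + 2)"
    have "(n + (j + 2)) * q = (n + j) * q + 2 * q" by (simp only: distrib_right add.assoc)
    then have "v \<in> words N ((n + j) * q + 2 * q)" using v unfolding unowned_def by (metis DiffD1)
    then obtain w c where wc: "v = w @ c" "w \<in> words N ((n + j) * q)" "c \<in> words N (2 * q)"
      by (rule words_append_split)
    have "w \<in> unowned n j"
    proof (rule ccontr)
      assume "w \<notin> unowned n j"
      then obtain p where "p \<in> set (lv n)" "w \<in> owned n j p" using wc by (auto simp: unowned_def)
      then have "v \<in> (\<Union>p\<in>set (lv n). owned n (j + 2) p)" using owned_append[of w n j p c 2] wc by auto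
      then show False using v by (simp add: unowned_def)
    qed
    moreover have "c \<noteq> b w" using b(2)[OF calculation] v wc by auto
    ultimately show "v \<in> (\<lambda>(w, c). w @ c) ` ?X" using wc by force
  qed
  have finV: "finite (unowned n i)" for i by (simp add: unowned_def)
  have inj: "inj_on (\<lambda>(w, c). w @ c) ?X"
    by (rule inj_on_subset[OF inj_on_append_words[of N "(n + j) * q" "2 * q"]]) (use V in auto)
  have "(\<Sum>w\<in>unowned n (j + 2). wt w) \<le> (\<Sum>w\<in>(\<lambda>(w, c). w @ c) ` ?X. wt w)"
  proof (rule sum_mono2[OF _ sub])
    show "finite ((\<lambda>(w, c). w @ c) ` ?X)" using finV by auto
    fix v assume "v \<in> (\<lambda>(w, c). w @ c) ` ?X - unowned n (j + 2)"
    then obtain w c where "v = w @ c" "w \<in> words N ((n + j) * q)" "c \<in> words N (2 * q)" using V by auto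
    then show "0 \<le> wt v" using wt_pos[OF words_append] by (simp add: less_imp_le)
  qed
  also have "\<dots> = (\<Sum>w\<in>unowned n j. \<Sum>c\<in>words N (2 * q) - {b w}. wt (w @ c))"
    unfolding sum.reindex[OF inj] using finV by (subst sum.Sigma) (auto simp: case_prod_unfold)
  also have "\<dots> = (\<Sum>w\<in>unowned n j. wt w - wt (w @ b w))"
  proof (intro sum.cong refl)
    fix w assume w: "w \<in> unowned n j"
    have "(\<Sum>c\<in>words N (2 * q). wt (w @ c)) = wt (w @ b w) + (\<Sum>c\<in>words N (2 * q) - {b w}. wt (w @ c))"
      using b(1)[OF w] by (intro sum.remove) auto
    then show "(\<Sum>c\<in>words N (2 * q) - {b w}. wt (w @ c)) = wt w - wt (w @ b w)"
      using sum_wt_append[OF V[OF w], of "2 * q"] by simp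
  qed
  also have "\<dots> \<le> (\<Sum>w\<in>unowned n j. (1 - own_frac) * wt w)"
    using b(3) by (intro sum_mono) (simp add: algebra_simps)
  finally show ?thesis by (simp add: sum_distrib_left)
qed

lemma unowned_le: "(\<Sum>w\<in>unowned n (2 * i). wt w) \<le> (1 - own_frac) ^ i"
proof (induction i)
  case 0
  have "(\<Sum>w\<in>unowned n 0. wt w) \<le> (\<Sum>w\<in>words N ((n + 0) * q). wt w)"
    by (rule sum_mono2) (auto simp: unowned_def intro: wt_pos less_imp_le)
  then show ?case by (simp add: sum_wt)
next
  case (Suc i)
  have "(\<Sum>w\<in>unowned n (2 * i + 2). wt w) \<le> (1 - own_frac) * (\<Sum>w\<in>unowned n (2 * i). wt w)"
    by (rule unowned_decay)
  also have "\<dots> \<le> (1 - own_frac) * (1 - own_frac) ^ i"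
    using Suc own_frac by (intro mult_left_mono) auto
  finally show ?case by simp
qed

text \<open>
  The share of the cell that a piece will receive is the total weight of the words that it
  eventually owns.
\<close>

definition share where "share n j p = (\<Sum>w\<in>owned n j p. wt w)"
definition om where "om n p = lim (\<lambda>j. share n j p)"

lemma sum_share_word_le:
  assumes "I \<in> words N (n * q)"
  shows "(\<Sum>p\<in>{p \<in> set (lv n). wd p = I}. share n j p) \<le> wt I"
proof -
  let ?P = "{p \<in> set (lv n). wd p = I}"
  have "(\<Sum>p\<in>?P. share n j p) = (\<Sum>w\<in>(\<Union>p\<in>?P. owned n j p). wt w)"
    unfolding share_def by (rule sum.UNION_disjoint[symmetric]) (use owned_disjoint in auto)
  also have "\<dots> \<le> (\<Sum>w\<in>(\<lambda>b. I @ b) ` words N (j * q). wt w)"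
  proof (rule sum_mono2)
    show "(\<Union>p\<in>?P. owned n j p) \<subseteq> (\<lambda>b. I @ b) ` words N (j * q)" using owned_prefix by fastforce
    fix w assume "w \<in> (\<lambda>b. I @ b) ` words N (j * q) - (\<Union>p\<in>?P. owned n j p)"
    then show "0 \<le> wt w" using wt_pos[OF words_append[OF assms]] by (auto simp: less_imp_le)
  qed auto
  also have "\<dots> = wt I"
    using sum_wt_append[OF assms] by (subst sum.reindex) (auto simp: inj_on_def)
  finally show ?thesis .
qed

lemma share_nonneg: "0 \<le> share n j p"
  unfolding share_def by (rule sum_nonneg) (auto simp: owned_def intro: wt_pos less_imp_le)

lemma share_le: "p \<in> set (lv n) \<Longrightarrow> share n j p \<le> wt (wd p)"
  using sum_share_word_le[OF wd_level, of p n j]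
    member_le_sum[of p "{p' \<in> set (lv n). wd p' = wd p}" "\<lambda>p. share n j p"] share_nonneg by fastforce

lemma share_mono: "share n j p \<le> share n (Suc j) p"
proof -
  let ?X = "owned n j p \<times> words N q"
  have V: "w \<in> words N ((n + j) * q)" if "w \<in> owned n j p" for w
    using that by (simp add: owned_def)
  have inj: "inj_on (\<lambda>(w, c). w @ c) ?X"
    by (rule inj_on_subset[OF inj_on_append_words[of N "(n + j) * q" q]]) (use V in auto)
  have "share n j p = (\<Sum>w\<in>owned n j p. \<Sum>c\<in>words N q. wt (w @ c))"
    unfolding share_def by (intro sum.cong refl sum_wt_append[symmetric]) (rule V)
  also have "\<dots> = (\<Sum>v\<in>(\<lambda>(w, c). w @ c) ` ?X. wt v)"
    unfolding sum.reindex[OF inj] by (simp add: sum.cartesian_product case_prod_unfold)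
  also have "\<dots> \<le> share n (Suc j) p"
    unfolding share_def
  proof (rule sum_mono2)
    show "(\<lambda>(w, c). w @ c) ` ?X \<subseteq> owned n (Suc j) p" using owned_append[of _ n j p _ 1] by auto
  qed (auto simp: owned_def intro: wt_pos less_imp_le)
  finally show ?thesis .
qed

lemma share_tendsto: "p \<in> set (lv n) \<Longrightarrow> (\<lambda>j. share n j p) \<longlonglongrightarrow> om n p"
proof -
  assume p: "p \<in> set (lv n)"
  have "convergent (\<lambda>j. share n j p)"
  proof (rule Bseq_mono_convergent)
    show "Bseq (\<lambda>j. share n j p)" using share_le[OF p] share_nonneg by (intro BseqI'[where K="wt (wd p)"]) auto
    show "\<forall>m k. m \<le> k \<longrightarrow> share n m p \<le> share n k p"
      using lift_Suc_mono_le[of "\<lambda>j. share n j p"] share_mono by auto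
  qed
  then show ?thesis by (simp add: om_def convergent_LIMSEQ_iff)
qed

lemma sum_om_word_le:
  "I \<in> words N (n * q) \<Longrightarrow> (\<Sum>p\<in>{p \<in> set (lv n). wd p = I}. om n p) \<le> wt I"
  by (rule LIMSEQ_le_const2[OF tendsto_sum[where f="\<lambda>p j. share n j p"]])
     (auto intro: share_tendsto sum_share_word_le)

lemma sum_om: "(\<Sum>p\<in>set (lv n). om n p) = 1"
proof -
  have eq: "(\<Sum>p\<in>set (lv n). share n j p) = 1 - (\<Sum>w\<in>unowned n j. wt w)" for j
  proof -
    have "(\<Sum>p\<in>set (lv n). share n j p) = (\<Sum>w\<in>(\<Union>p\<in>set (lv n). owned n j p). wt w)"
      unfolding share_def by (rule sum.UNION_disjoint[symmetric]) (use owned_disjoint in auto)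
    moreover have "(\<Sum>w\<in>words N ((n + j) * q). wt w)
        = (\<Sum>w\<in>(\<Union>p\<in>set (lv n). owned n j p). wt w) + (\<Sum>w\<in>unowned n j. wt w)"
      unfolding unowned_def by (subst add.commute, rule sum.subset_diff) (auto simp: owned_def)
    ultimately show ?thesis by (simp add: sum_wt)
  qed
  have nn: "0 \<le> (\<Sum>w\<in>unowned n j. wt w)" for j
    by (rule sum_nonneg) (auto simp: unowned_def intro: wt_pos less_imp_le)
  have "(\<lambda>i. \<Sum>w\<in>unowned n (2 * i). wt w) \<longlonglongrightarrow> 0"
    by (rule tendsto_sandwich[OF _ _ tendsto_const LIMSEQ_power_zero[of "1 - own_frac"]])
       (use nn unowned_le own_frac in auto)
  then have "(\<lambda>i. 1 - (\<Sum>w\<in>unowned n (2 * i). wt w)) \<longlonglongrightarrow> 1 - 0"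
    by (intro tendsto_diff tendsto_const)
  then have 1: "(\<lambda>i. \<Sum>p\<in>set (lv n). share n (2 * i) p) \<longlonglongrightarrow> 1" unfolding eq by simp
  have "(\<lambda>j. \<Sum>p\<in>set (lv n). share n j p) \<longlonglongrightarrow> (\<Sum>p\<in>set (lv n). om n p)"
    by (intro tendsto_sum share_tendsto)
  then have "(\<lambda>i. \<Sum>p\<in>set (lv n). share n (2 * i) p) \<longlonglongrightarrow> (\<Sum>p\<in>set (lv n). om n p)"
    by (rule LIMSEQ_subseq_LIMSEQ[where f="\<lambda>i. 2 * i", unfolded o_def]) (auto simp: strict_mono_def)
  then show ?thesis using 1 LIMSEQ_unique by blast
qed

lemma sum_mono_eq_imp_eq:
  fixes f g :: "'b \<Rightarrow> real"
  assumes "finite A" "\<And>x. x \<in> A \<Longrightarrow> f x \<le> g x" "(\<Sum>x\<in>A. f x) = (\<Sum>x\<in>A. g x)" "x \<in> A"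
  shows "f x = g x"
  using sum_nonneg_eq_0_iff[of A "\<lambda>x. g x - f x"] assms by (simp add: sum_subtractf)

lemma sum_om_word:
  assumes "I \<in> words N (n * q)"
  shows "(\<Sum>p\<in>{p \<in> set (lv n). wd p = I}. om n p) = wt I"
proof (rule sum_mono_eq_imp_eq[OF finite_words _ _ assms])
  show "(\<Sum>p\<in>{p \<in> set (lv n). wd p = I}. om n p) \<le> wt I" if "I \<in> words N (n * q)" for I
    using that by (rule sum_om_word_le)
  have "(\<Sum>I\<in>words N (n * q). \<Sum>p\<in>{p \<in> set (lv n). wd p = I}. om n p) = (\<Sum>p\<in>set (lv n). om n p)"
    by (rule sum.group) (use wd_level in auto)
  then show "(\<Sum>I\<in>words N (n * q). \<Sum>p\<in>{p \<in> set (lv n). wd p = I}. om n p) = (\<Sum>I\<in>words N (n * q). wt I)"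
    by (simp add: sum_om sum_wt)
qed

lemma om_le: "p \<in> set (lv n) \<Longrightarrow> om n p \<le> wt (wd p)"
  by (rule LIMSEQ_le_const2[OF share_tendsto]) (auto intro: share_le)

lemma om_ge: "p \<in> set (lv n) \<Longrightarrow> own_frac * wt (wd p) \<le> om n p"
proof -
  assume p: "p \<in> set (lv n)"
  obtain b where b: "wd p @ b \<in> owned n 2 p" "own_frac * wt (wd p) \<le> wt (wd p @ b)"
    using owns_some[OF p] by blast
  have "own_frac * wt (wd p) \<le> share n j p" if "2 \<le> j" for j
  proof -
    have "wt (wd p @ b) \<le> share n 2 p"
      unfolding share_def
      by (rule member_le_sum[OF b(1)]) (auto simp: owned_def intro: wt_pos less_imp_le)
    also have "\<dots> \<le> share n j p" using lift_Suc_mono_le[of "\<lambda>j. share n j p", OF share_mono that] .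
    finally show ?thesis using b(2) by linarith
  qed
  then show ?thesis by (intro LIMSEQ_le_const[OF share_tendsto[OF p]]) blast
qed

lemma om_pos: "p \<in> set (lv n) \<Longrightarrow> 0 < om n p"
  using om_ge[of p n] own_frac wt_pos[OF wd_level, of p n] by (smt (verit) mult_pos_pos)

lemma om_children:
  assumes "p \<in> set (lv n)"
  shows "om n p = (\<Sum>p'\<in>set (ch p). om (Suc n) p')"
proof -
  have le: "(\<Sum>p'\<in>set (ch p). om (Suc n) p') \<le> om n p" if p: "p \<in> set (lv n)" for p
  proof (rule LIMSEQ_le)
    have c: "p' \<in> set (lv (Suc n))" if "p' \<in> set (ch p)" for p' using that p by auto
    show "(\<lambda>j. \<Sum>p'\<in>set (ch p). share (Suc n) j p') \<longlonglongrightarrow> (\<Sum>p'\<in>set (ch p). om (Suc n) p')"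
      by (intro tendsto_sum share_tendsto c)
    show "(\<lambda>j. share n (Suc j) p) \<longlonglongrightarrow> om n p"
      using share_tendsto[OF p] by (rule LIMSEQ_Suc)
    have "(\<Sum>p'\<in>set (ch p). share (Suc n) j p') \<le> share n (Suc j) p" for j
    proof -
      have "(\<Sum>p'\<in>set (ch p). share (Suc n) j p') = (\<Sum>w\<in>(\<Union>p'\<in>set (ch p). owned (Suc n) j p'). wt w)"
        unfolding share_def by (rule sum.UNION_disjoint[symmetric]) (use owned_disjoint[OF c c] in \<open>auto simp del: chain_level.simps\<close>)
      also have "\<dots> \<le> share n (Suc j) p"
        unfolding share_def
      proof (rule sum_mono2)
        show "(\<Union>p'\<in>set (ch p). owned (Suc n) j p') \<subseteq> owned n (Suc j) p"
          using owned_trans[OF p, of _ 1 _ j] by auto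
      qed (auto simp: owned_def intro: wt_pos less_imp_le)
      finally show ?thesis .
    qed
    then show "\<exists>N. \<forall>j\<ge>N. (\<Sum>p'\<in>set (ch p). share (Suc n) j p') \<le> share n (Suc j) p" by blast
  qed
  have "(\<Sum>p\<in>set (lv n). \<Sum>p'\<in>set (ch p). om (Suc n) p') = (\<Sum>p'\<in>set (lv (Suc n)). om (Suc n) p')"
  proof -
    have "set (lv (Suc n)) = (\<Union>p\<in>set (lv n). set (ch p))" by simp
    moreover have "(\<Sum>p'\<in>(\<Union>p\<in>set (lv n). set (ch p)). om (Suc n) p') = (\<Sum>p\<in>set (lv n). \<Sum>p'\<in>set (ch p). om (Suc n) p')"
      by (rule sum.UNION_disjoint) (use desc_unique[of _ n _ _ 1] in auto)
    ultimately show ?thesis by simp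
  qed
  then have "(\<Sum>p\<in>set (lv n). \<Sum>p'\<in>set (ch p). om (Suc n) p') = (\<Sum>p\<in>set (lv n). om n p)"
    by (simp only: sum_om)
  then have "(\<Sum>p'\<in>set (ch p). om (Suc n) p') = om n p"
    using sum_mono_eq_imp_eq[OF finite_set le] assms by fast
  then show ?thesis by simp
qed

end

section \<open>Laying out pieces along an interval\<close>

primrec lay :: "('p \<Rightarrow> real) \<Rightarrow> real \<Rightarrow> 'p list \<Rightarrow> ('p \<times> real) list" where
  "lay w x [] = []"
| "lay w x (p # ps) = (p, x) # lay w (x + w p) ps"

lemma lay_append: "lay w x (ps @ qs) = lay w x ps @ lay w (x + sum_list (map w ps)) qs"
  by (induction ps arbitrary: x) (auto simp: add.assoc)

lemma map_fst_lay [simp]: "map fst (lay w x ps) = ps"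
  by (induction ps arbitrary: x) auto

lemma lay_concat:
  assumes "\<And>p. p \<in> set ps \<Longrightarrow> w p = sum_list (map w' (ch p))"
  shows "lay w' x (concat (map ch ps)) = concat (map (\<lambda>(p, a). lay w' a (ch p)) (lay w x ps))"
  using assms by (induction ps arbitrary: x) (auto simp: lay_append)

lemma lay_mem: "(p, a) \<in> set (lay w x ps) \<Longrightarrow> p \<in> set ps"
proof -
  assume "(p, a) \<in> set (lay w x ps)"
  then have "fst (p, a) \<in> set (map fst (lay w x ps))" unfolding set_map by (rule imageI)
  then show ?thesis by (simp only: map_fst_lay fst_conv)
qed

lemma lay_within:
  assumes "\<And>p. p \<in> set ps \<Longrightarrow> 0 \<le> w p" "(p, a) \<in> set (lay w x ps)"
  shows "x \<le> a" "a + w p \<le> x + sum_list (map w ps)"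
proof -
  have "x \<le> a \<and> a + w p \<le> x + sum_list (map w ps)"
    using assms
  proof (induction ps arbitrary: x)
    case (Cons p' ps)
    have nn: "0 \<le> sum_list (map w ps)" using Cons.prems(1) by (intro sum_list_nonneg) auto
    show ?case
    proof (cases "(p, a) = (p', x)")
      case False
      then have "(p, a) \<in> set (lay w (x + w p') ps)" using Cons.prems(2) by auto
      then show ?thesis using Cons.IH[of "x + w p'"] Cons.prems(1)[of p'] Cons.prems(1) by (force simp: algebra_simps)
    qed (use nn in auto)
  qed auto
  then show "x \<le> a" "a + w p \<le> x + sum_list (map w ps)" by auto
qed

lemma lay_cover:
  assumes "ps \<noteq> []" "x \<le> t" "t \<le> x + sum_list (map w ps)"
  shows "\<exists>p a. (p, a) \<in> set (lay w x ps) \<and> a \<le> t \<and> t \<le> a + w p"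
  using assms
proof (induction ps arbitrary: x)
  case (Cons p ps)
  show ?case
  proof (cases "t \<le> x + w p")
    case False
    then have "ps \<noteq> []" using Cons.prems by auto
    then show ?thesis using Cons.IH[of "x + w p"] Cons.prems False by (force simp: algebra_simps)
  qed (use Cons.prems in auto)
qed auto

lemma lay_first: "ps \<noteq> [] \<Longrightarrow> \<exists>p. (p, x) \<in> set (lay w x ps)"
  by (cases ps) auto

lemma lay_last: "ps \<noteq> [] \<Longrightarrow> \<exists>p a. (p, a) \<in> set (lay w x ps) \<and> a + w p = x + sum_list (map w ps)"
proof (cases ps rule: rev_cases)
  case (snoc ys y)
  then show ?thesis by (intro exI[of _ y] exI[of _ "x + sum_list (map w ys)"]) (auto simp: lay_append)
qed simp

lemma lay_next:
  "(p, a) \<in> set (lay w x ps) \<Longrightarrow>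
     a + w p = x + sum_list (map w ps) \<or> (\<exists>p'. (p', a + w p) \<in> set (lay w x ps))"
proof (induction ps arbitrary: x)
  case (Cons p' ps)
  show ?case
  proof (cases "(p, a) = (p', x)")
    case True
    then show ?thesis by (cases ps) auto
  next
    case False
    then have "(p, a) \<in> set (lay w (x + w p') ps)" using Cons.prems by auto
    from Cons.IH[OF this] show ?thesis by (auto simp: add.assoc)
  qed
qed auto

lemma lay_touch:
  assumes "successively R ps" "\<And>p. p \<in> set ps \<Longrightarrow> 0 < w p"
    "(p, a) \<in> set (lay w x ps)" "(p', a') \<in> set (lay w x ps)"
    "a \<le> t" "t \<le> a + w p" "a' \<le> t" "t \<le> a' + w p'"
  shows "p = p' \<or> R p p' \<or> R p' p"
  using assms
proof (induction ps arbitrary: x)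
  case (Cons p0 ps)
  have IH: "p = p' \<or> R p p' \<or> R p' p"
    if "(p, a) \<in> set (lay w (x + w p0) ps)" "(p', a') \<in> set (lay w (x + w p0) ps)"
    by (rule Cons.IH[OF _ _ that]) (use Cons.prems in \<open>auto simp: successively_Cons\<close>)
  have head: "R p0 p''" if c: "(p'', c) \<in> set (lay w (x + w p0) ps)" "c \<le> t" "t \<le> x + w p0" for p'' c
  proof (cases ps)
    case (Cons p1 ps')
    have "x + w p0 < c" if "(p'', c) \<in> set (lay w (x + w p0 + w p1) ps')"
    proof -
      have "x + w p0 + w p1 \<le> c"
        by (rule lay_within(1)[OF _ that]) (use Cons.prems(2) \<open>ps = p1 # ps'\<close> in \<open>auto intro: less_imp_le\<close>)
      then show ?thesis using Cons.prems(2)[of p1] \<open>ps = p1 # ps'\<close> by simp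
    qed
    then have "p'' = p1" using c \<open>ps = p1 # ps'\<close> by auto
    then show ?thesis using Cons.prems(1) \<open>ps = p1 # ps'\<close> by simp
  qed (use c in auto)
  show ?case using Cons.prems IH head by auto
qed auto

section \<open>The curve of a piece system\<close>

context piece_system
begin

definition PL where "PL n = lay (om n) 0 (lv n)"

lemma PL_level: "(p, a) \<in> set (PL n) \<Longrightarrow> p \<in> set (lv n)"
  unfolding PL_def by (rule lay_mem)

lemma level_PL: "p \<in> set (lv n) \<Longrightarrow> \<exists>a. (p, a) \<in> set (PL n)"
proof -
  assume "p \<in> set (lv n)"
  then have "p \<in> set (map fst (PL n))" by (simp only: PL_def map_fst_lay)
  then show ?thesis by force
qed

lemma PL_unique: "(p, a) \<in> set (PL n) \<Longrightarrow> (p, a') \<in> set (PL n) \<Longrightarrow> a = a'"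
  by (rule eq_key_imp_eq_value[of "PL n"]) (auto simp: PL_def level_distinct)

lemma sum_list_om: "sum_list (map (om n) (lv n)) = 1"
  using sum_om[of n] level_distinct by (simp add: sum_list_distinct_conv_sum_set)

lemma ch_distinct: "p \<in> set (lv n) \<Longrightarrow> distinct (ch p)"
  using level_distinct[of "Suc n"] by (auto simp: distinct_concat_iff)

lemma sum_list_om_children: "p \<in> set (lv n) \<Longrightarrow> sum_list (map (om (Suc n)) (ch p)) = om n p"
  using om_children[of p n] ch_distinct[of p n] by (simp add: sum_list_distinct_conv_sum_set)

lemma ch_ne: "p \<in> set (lv n) \<Longrightarrow> ch p \<noteq> []"
  using sum_list_om_children[of p n] om_pos[of p n] by auto

lemma PL_Suc: "PL (Suc n) = concat (map (\<lambda>(p, a). lay (om (Suc n)) a (ch p)) (PL n))"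
  unfolding PL_def chain_level.simps by (rule lay_concat) (simp add: sum_list_om_children)

lemma PL_children: "(p, a) \<in> set (PL n) \<Longrightarrow> set (lay (om (Suc n)) a (ch p)) \<subseteq> set (PL (Suc n))"
  unfolding PL_Suc by auto

lemma PL_parent:
  assumes "(p', a') \<in> set (PL (Suc n))"
  obtains p a where "(p, a) \<in> set (PL n)" "(p', a') \<in> set (lay (om (Suc n)) a (ch p))"
  using assms unfolding PL_Suc by auto

lemma PL_child_within:
  assumes "(p, a) \<in> set (PL n)" "(p', a') \<in> set (lay (om (Suc n)) a (ch p))"
  shows "a \<le> a'" "a' + om (Suc n) p' \<le> a + om n p"
proof -
  have p: "p \<in> set (lv n)" by (rule PL_level[OF assms(1)])
  have "0 \<le> om (Suc n) x" if "x \<in> set (ch p)" for x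
    using om_pos[of x "Suc n"] that p by (auto intro: less_imp_le)
  note lay_within[OF this assms(2)]
  then show "a \<le> a'" "a' + om (Suc n) p' \<le> a + om n p"
    using sum_list_om_children[OF p] by auto
qed

lemma PL_within:
  assumes "(p, a) \<in> set (PL n)"
  shows "0 \<le> a" "a + om n p \<le> 1"
proof -
  have "0 \<le> om n x" if "x \<in> set (lv n)" for x
    using om_pos[OF that] by simp
  note lay_within[OF this assms[unfolded PL_def]]
  then show "0 \<le> a" "a + om n p \<le> 1" using sum_list_om[of n] by auto
qed

definition during where "during n p t \<longleftrightarrow> (\<exists>a. (p, a) \<in> set (PL n) \<and> a \<le> t \<and> t \<le> a + om n p)"

lemma during_level: "during n p t \<Longrightarrow> p \<in> set (lv n)"
  by (auto simp: during_def PL_level)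

lemma during_unit: "during n p t \<Longrightarrow> t \<in> {0..1}"
proof -
  assume "during n p t"
  then obtain a where "(p, a) \<in> set (PL n)" "a \<le> t" "t \<le> a + om n p" by (auto simp: during_def)
  then show ?thesis using PL_within[of p a n] by simp
qed

lemma lv_ne: "lv n \<noteq> []"
  using sum_list_om[of n] by auto

lemma during_ex: "t \<in> {0..1} \<Longrightarrow> \<exists>p. during n p t"
  using lay_cover[OF lv_ne, of 0 t "om n" n] sum_list_om[of n] by (auto simp: during_def PL_def)

lemma during_child:
  assumes "during n p t"
  shows "\<exists>p'\<in>set (ch p). during (Suc n) p' t"
proof -
  obtain a where a: "(p, a) \<in> set (PL n)" "a \<le> t" "t \<le> a + om n p" using assms by (auto simp: during_def)
  have p: "p \<in> set (lv n)" by (rule PL_level[OF a(1)])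
  obtain p' a' where "(p', a') \<in> set (lay (om (Suc n)) a (ch p))" "a' \<le> t" "t \<le> a' + om (Suc n) p'"
    using lay_cover[OF ch_ne[OF p], of a t "om (Suc n)"] a sum_list_om_children[OF p] by auto
  then show ?thesis using PL_children[OF a(1)] unfolding during_def by (intro bexI[of _ p']) (auto intro: lay_mem)
qed

lemma during_parent:
  assumes "during (Suc n) p' t"
  shows "\<exists>p. p' \<in> set (ch p) \<and> during n p t"
proof -
  obtain a' where a': "(p', a') \<in> set (PL (Suc n))" "a' \<le> t" "t \<le> a' + om (Suc n) p'"
    using assms by (auto simp: during_def)
  obtain p a where p: "(p, a) \<in> set (PL n)" "(p', a') \<in> set (lay (om (Suc n)) a (ch p))"
    using a'(1) by (rule PL_parent)
  have "a \<le> t" "t \<le> a + om n p" using PL_child_within[OF p] a' by auto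
  then show ?thesis using p(1) lay_mem[OF p(2)] unfolding during_def by blast
qed

lemma during_desc: "during n p t \<Longrightarrow> \<exists>p'\<in>desc j p. during (n + j) p' t"
proof (induction j)
  case (Suc j)
  then obtain p' where "p' \<in> desc j p" "during (n + j) p' t" by auto
  then show ?case using during_child[of "n + j" p' t] by auto
qed simp

lemma during_ancestor:
  assumes "p \<in> set (lv n)" "p' \<in> desc j p" "during (n + j) p' t"
  shows "during n p t"
  using assms(2,3)
proof (induction j arbitrary: p')
  case (Suc j)
  then obtain p1 where p1: "p' \<in> set (ch p1)" "during (n + j) p1 t"
    using during_parent[of "n + j" p' t] by auto
  obtain p2 where p2: "p2 \<in> desc j p" "p' \<in> set (ch p2)" using Suc.prems by auto
  have "p1 = p2"
    by (rule desc_unique[of _ "n + j" _ p' 1])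
       (use p1 p2 during_level[OF p1(2)] desc_level[OF assms(1) p2(1)] in auto)
  then show ?case using Suc.IH p1 p2 by simp
qed simp

definition at_time where "at_time n t = (\<Union>p\<in>{p. during n p t}. cell (wd p))"

lemma at_time_antimono: "at_time (Suc n) t \<subseteq> at_time n t"
proof
  fix x assume "x \<in> at_time (Suc n) t"
  then obtain p' where p': "during (Suc n) p' t" "x \<in> cell (wd p')" by (auto simp: at_time_def)
  then obtain p where p: "p' \<in> set (ch p)" "during n p t" using during_parent by blast
  obtain b where "b \<in> words N q" "wd p' = wd p @ b"
    using wd_child[OF during_level[OF p(2)] p(1)] by blast
  then have "x \<in> cell (wd p)" using p'(2) cell_append_subset by auto
  then show "x \<in> at_time n t" using p(2) by (auto simp: at_time_def)
qed

lemma at_time_compact: "compact (at_time n t)"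
  unfolding at_time_def
proof (rule compact_UN)
  show "finite {p. during n p t}" by (rule finite_subset[of _ "set (lv n)"]) (auto dest: during_level)
qed (auto dest!: during_level wd_level cell_compact)

lemma at_time_ne: "t \<in> {0..1} \<Longrightarrow> at_time n t \<noteq> {}"
  using during_ex[of t n] cell_ne by (auto simp: at_time_def)

text \<open>
  Pieces that share a time are equal or consecutive, and consecutive pieces touch; this is what
  makes the curve continuous.
\<close>

lemma at_time_dist:
  assumes "x \<in> at_time n t" "y \<in> at_time n t"
  shows "dist x y \<le> 2 * (rmax ^ (n * q) * diamK)"
proof -
  obtain p p' where p: "during n p t" "x \<in> cell (wd p)" and p': "during n p' t" "y \<in> cell (wd p')"
    using assms by (auto simp: at_time_def)
  have W: "wd p \<in> words N (n * q)" "wd p' \<in> words N (n * q)"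
    using p(1) p'(1) by (auto dest: during_level wd_level)
  have "p = p' \<or> cell (wd p) \<inter> cell (wd p') \<noteq> {} \<or> cell (wd p') \<inter> cell (wd p) \<noteq> {}"
  proof -
    obtain a a' where "(p, a) \<in> set (PL n)" "(p', a') \<in> set (PL n)"
       "a \<le> t" "t \<le> a + om n p" "a' \<le> t" "t \<le> a' + om n p'"
      using p(1) p'(1) by (auto simp: during_def)
    then show ?thesis using lay_touch[OF touch[of n], of "om n" p a 0 p' a' t] om_pos unfolding PL_def by blast
  qed
  then obtain z where z: "z \<in> cell (wd p)" "z \<in> cell (wd p')" using cell_ne by blast
  have "dist x y \<le> dist x z + dist z y" by (rule dist_triangle)
  also have "\<dots> \<le> 2 * (rmax ^ (n * q) * diamK)"
    using dist_cell_le_level[OF W(1) p(2) z(1)] dist_cell_le_level[OF W(2) z(2) p'(2)] by simp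
  finally show ?thesis .
qed

text \<open>
  The sets of cells visited at a time are nested and compact, and shrink to a single point.
\<close>

definition psi where "psi t = (SOME y. \<forall>n. y \<in> at_time n t)"

lemma psi_at_time: "t \<in> {0..1} \<Longrightarrow> psi t \<in> at_time n t"
proof -
  assume t: "t \<in> {0..1}"
  have "(\<Inter>n. at_time n t) \<noteq> {}"
    by (rule compact_nest)
       (use t at_time_compact at_time_ne lift_Suc_antimono_le[of "\<lambda>n. at_time n t", OF at_time_antimono] in auto)
  then have "\<exists>y. \<forall>n. y \<in> at_time n t" by blast
  then have "\<forall>n. psi t \<in> at_time n t" unfolding psi_def by (rule someI_ex)
  then show ?thesis by simp
qed

lemma level_diam_tendsto_0: "(\<lambda>n. c * (rmax ^ (n * q) * diamK)) \<longlonglongrightarrow> 0"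
proof -
  have "(\<lambda>n. rmax ^ (n * q)) \<longlonglongrightarrow> 0"
    using LIMSEQ_subseq_LIMSEQ[OF rmax_power_tendsto_0, of "\<lambda>n. n * q"] q_pos
    by (auto simp: strict_mono_def o_def)
  then show ?thesis by (intro tendsto_mult_right_zero tendsto_mult_left_zero)
qed

lemma psi_in_cell:
  assumes "during n p t"
  shows "psi t \<in> cell (wd p)"
proof -
  have t: "t \<in> {0..1}" using assms by (rule during_unit)
  have W: "wd p \<in> words N (n * q)" using assms by (auto dest: during_level wd_level)
  have "closed (cell (wd p))" using cell_compact[OF W] by (rule compact_imp_closed)
  moreover have "\<exists>y\<in>cell (wd p). dist y (psi t) < e" if "e > 0" for e
  proof -
    have "eventually (\<lambda>n. 2 * (rmax ^ (n * q) * diamK) < e) sequentially"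
      using level_diam_tendsto_0[of 2] \<open>e > 0\<close> by (rule order_tendstoD)
    then obtain m where m: "\<And>k. k \<ge> m \<Longrightarrow> 2 * (rmax ^ (k * q) * diamK) < e"
      by (auto simp: eventually_sequentially)
    obtain p' where p': "p' \<in> desc m p" "during (n + m) p' t" using during_desc[OF assms] by blast
    obtain y where y: "y \<in> cell (wd p')" using cell_ne by blast
    then have "y \<in> at_time (n + m) t" using p'(2) by (auto simp: at_time_def)
    then have "dist y (psi t) < e" using at_time_dist[OF _ psi_at_time[OF t], of y "n + m"] m[of "n + m"] by simp
    moreover obtain b where "b \<in> words N (m * q)" "wd p' = wd p @ b"
      using wd_desc[OF during_level[OF assms] p'(1)] by blast
    then have "y \<in> cell (wd p)" using y cell_append_subset[of b "m * q" "wd p"] by auto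
    ultimately show ?thesis by blast
  qed
  ultimately show ?thesis by (metis closed_approachable)
qed

lemma psi_in_K: "t \<in> {0..1} \<Longrightarrow> psi t \<in> K"
proof -
  assume "t \<in> {0..1}"
  then obtain p where p: "during 0 p t" using during_ex by blast
  then have "wd p = []" using during_level[OF p] wd_root by simp
  then show ?thesis using psi_in_cell[OF p] by simp
qed

definition gap_frac where "gap_frac = own_frac * (rmin powr s) ^ q"

lemma gap_frac: "0 < gap_frac"
  using own_frac rmin_powr by (simp add: gap_frac_def)

lemma om_child_ge:
  assumes "p \<in> set (lv n)" "p' \<in> set (ch p)"
  shows "gap_frac * wt (wd p) \<le> om (Suc n) p'"
proof -
  obtain b where b: "b \<in> words N q" "wd p' = wd p @ b" using wd_child[OF assms] by blast
  have "p' \<in> set (lv (Suc n))" using assms by auto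
  then have "own_frac * wt (wd p') \<le> om (Suc n) p'" by (rule om_ge)
  moreover have "(rmin powr s) ^ q * wt (wd p) \<le> wt (wd p')"
    using b wt_append[OF wd_level[OF assms(1)] b(1)] wt_ge[OF b(1)] wt_pos[OF wd_level[OF assms(1)]] by simp
  then have "own_frac * ((rmin powr s) ^ q * wt (wd p)) \<le> own_frac * wt (wd p')"
    using own_frac by (intro mult_left_mono) auto
  ultimately show ?thesis by (simp add: gap_frac_def mult.assoc)
qed

definition hoelder_const where "hoelder_const = diamK * (1 / gap_frac) powr (1/s)"

lemma hoelder_const_nonneg: "0 \<le> hoelder_const"
  using diamK_nonneg by (simp add: hoelder_const_def)

lemma dist_le_of_gap:
  assumes "0 \<le> W" "dist x y \<le> W powr (1/s) * diamK" "gap_frac * W \<le> h"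
  shows "dist x y \<le> hoelder_const * h powr (1/s)"
proof -
  have "W \<le> 1 / gap_frac * h" using assms(3) gap_frac by (simp add: field_simps)
  then have "W powr (1/s) \<le> (1 / gap_frac * h) powr (1/s)"
    using assms(1) s_pos by (intro powr_mono2) auto
  also have "\<dots> = (1 / gap_frac) powr (1/s) * h powr (1/s)"
    by (rule powr_mult)
  finally have "W powr (1/s) * diamK \<le> (1 / gap_frac) powr (1/s) * h powr (1/s) * diamK"
    using diamK_nonneg by (rule mult_right_mono)
  then show ?thesis using assms(2) by (simp add: hoelder_const_def mult_ac)
qed

lemma dist_psi_piece:
  assumes "during n p t" "during n p u"
  shows "dist (psi t) (psi u) \<le> wt (wd p) powr (1/s) * diamK"
proof -
  have "wd p \<in> words N (n * q)" using assms(1) by (auto dest: during_level wd_level)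
  then show ?thesis
    using dist_cell_le[OF _ psi_in_cell[OF assms(1)] psi_in_cell[OF assms(2)]] ratio_eq_wt[of "wd p"] by simp
qed

lemma om_le_level: "p \<in> set (lv n) \<Longrightarrow> om n p \<le> (rmax powr s) ^ (n * q)"
  using om_le[of p n] wt_le[OF wd_level, of p n] by linarith

lemma level_weight_tendsto_0: "(\<lambda>n. (rmax powr s) ^ (n * q)) \<longlonglongrightarrow> 0"
proof -
  have "(\<lambda>n. (rmax powr s) ^ n) \<longlonglongrightarrow> 0" using rmax_powr by (intro LIMSEQ_power_zero) auto
  from LIMSEQ_subseq_LIMSEQ[OF this, of "\<lambda>n. n * q"] q_pos show ?thesis
    by (auto simp: strict_mono_def o_def)
qed

lemma level_weight_eventually_less: "0 < h \<Longrightarrow> \<exists>j. (rmax powr s) ^ ((n + j) * q) < h"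
proof -
  assume "0 < h"
  then have "eventually (\<lambda>n. (rmax powr s) ^ (n * q) < h) sequentially"
    using level_weight_tendsto_0 by (intro order_tendstoD) auto
  then obtain m where "\<And>k. k \<ge> m \<Longrightarrow> (rmax powr s) ^ (k * q) < h" by (auto simp: eventually_sequentially)
  then show ?thesis by (intro exI[of _ m]) auto
qed

text \<open>
  Descend along the first (or last) children until the time \<open>t\<close> is left behind: the child that
  separates it from the endpoint \<open>z\<close> has a length comparable to that of its parent.
\<close>

lemma psi_hoelder_endpoint:
  assumes "(p, a) \<in> set (PL n)" "a \<le> t" "t \<le> a + om n p" "z \<in> {a, a + om n p}"
  shows "dist (psi t) (psi z) \<le> hoelder_const * \<bar>t - z\<bar> powr (1/s)"
proof (cases "t = z")
  case False
  have main: "dist (psi t) (psi z) \<le> hoelder_const * \<bar>t - z\<bar> powr (1/s)"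
    if "(rmax powr s) ^ ((n + j) * q) < \<bar>t - z\<bar>"
       "(p, a) \<in> set (PL n)" "a \<le> t" "t \<le> a + om n p" "z \<in> {a, a + om n p}" for j n p a
    using that
  proof (induction j arbitrary: n p a)
    case 0
    then show ?case using om_le_level[OF PL_level[OF 0(2)]] by auto
  next
    case (Suc j)
    have p: "p \<in> set (lv n)" by (rule PL_level[OF Suc.prems(2)])
    obtain p' a' where p': "(p', a') \<in> set (lay (om (Suc n)) a (ch p))" "z \<in> {a', a' + om (Suc n) p'}"
      "z = a \<longrightarrow> a' = a" "z \<noteq> a \<longrightarrow> z = a' + om (Suc n) p'"
    proof (cases "z = a")
      case True
      then show ?thesis using that lay_first[OF ch_ne[OF p], of a "om (Suc n)"] by blast
    next
      case False
      then show ?thesis using that lay_last[OF ch_ne[OF p], of "om (Suc n)" a] Suc.prems(5)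
          sum_list_om_children[OF p] by auto
    qed
    have PL': "(p', a') \<in> set (PL (Suc n))" using PL_children[OF Suc.prems(2)] p'(1) by blast
    show ?case
    proof (cases "a' \<le> t \<and> t \<le> a' + om (Suc n) p'")
      case True
      then show ?thesis using Suc.IH[of "Suc n" p' a'] Suc.prems(1) PL' p'(2) by simp
    next
      case False
      have "om (Suc n) p' \<le> \<bar>t - z\<bar>" using False p' Suc.prems by auto
      moreover have "gap_frac * wt (wd p) \<le> om (Suc n) p'"
        by (rule om_child_ge[OF p lay_mem[OF p'(1)]])
      moreover have "0 \<le> om n p" using om_pos[OF p] by simp
      then have "during n p t" "during n p z"
        using Suc.prems by (auto simp: during_def)
      ultimately show ?thesis
        using wt_pos[OF wd_level[OF p]] by (intro dist_le_of_gap[OF _ dist_psi_piece[of n p]]) auto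
    qed
  qed
  obtain j where "(rmax powr s) ^ ((n + j) * q) < \<bar>t - z\<bar>"
    using level_weight_eventually_less[of "\<bar>t - z\<bar>" n] False by auto
  then show ?thesis using main assms by blast
qed (simp add: hoelder_const_nonneg)

lemma psi_hoelder_siblings:
  assumes ps: "set (lay (om n) x ps) \<subseteq> set (PL n)" "ps \<noteq> []"
    and gap: "\<And>p. p \<in> set ps \<Longrightarrow> gap_frac * W \<le> om n p" "0 \<le> W"
    and t: "x \<le> t" "t < u" "u \<le> x + sum_list (map (om n) ps)"
    and d: "\<And>v v'. v \<in> {t..u} \<Longrightarrow> v' \<in> {t..u} \<Longrightarrow> dist (psi v) (psi v') \<le> W powr (1/s) * diamK"
    and apart: "\<And>p a. (p, a) \<in> set (lay (om n) x ps) \<Longrightarrow> \<not> (a \<le> t \<and> u \<le> a + om n p)"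
  shows "dist (psi t) (psi u) \<le> 2 * hoelder_const * \<bar>t - u\<bar> powr (1/s)"
proof -
  have mono: "hoelder_const * h powr (1/s) \<le> hoelder_const * \<bar>t - u\<bar> powr (1/s)"
    if "0 \<le> h" "h \<le> \<bar>t - u\<bar>" for h
    using that hoelder_const_nonneg s_pos by (intro mult_left_mono powr_mono2) auto
  obtain p a where p: "(p, a) \<in> set (lay (om n) x ps)" "a \<le> t" "t \<le> a + om n p"
    using lay_cover[OF ps(2), of x t "om n"] t by auto
  define z where "z = a + om n p"
  have zu: "t \<le> z" "z < u" using apart[OF p(1)] p by (auto simp: z_def)
  have "dist (psi t) (psi z) \<le> hoelder_const * \<bar>t - z\<bar> powr (1/s)"
    by (rule psi_hoelder_endpoint[of p a n]) (use p ps in \<open>auto simp: z_def\<close>)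
  then have 1: "dist (psi t) (psi z) \<le> hoelder_const * \<bar>t - u\<bar> powr (1/s)"
    using mono[of "\<bar>t - z\<bar>"] zu by simp
  obtain p' where p': "(p', z) \<in> set (lay (om n) x ps)"
    using lay_next[OF p(1)] zu t by (auto simp: z_def)
  have 2: "dist (psi z) (psi u) \<le> hoelder_const * \<bar>t - u\<bar> powr (1/s)"
  proof (cases "u \<le> z + om n p'")
    case True
    have "dist (psi u) (psi z) \<le> hoelder_const * \<bar>u - z\<bar> powr (1/s)"
      by (rule psi_hoelder_endpoint[of p' z n]) (use p' ps zu True in auto)
    then show ?thesis using mono[of "\<bar>u - z\<bar>"] zu by (simp add: dist_commute)
  next
    case False
    then have "gap_frac * W \<le> \<bar>t - u\<bar>" using gap(1)[OF lay_mem[OF p']] zu by simp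
    then show ?thesis using d[of z u] zu gap(2) by (intro dist_le_of_gap) auto
  qed
  show ?thesis using dist_triangle[of "psi t" "psi u" "psi z"] 1 2 by simp
qed

lemma psi_hoelder_piece:
  assumes "(p, a) \<in> set (PL n)" "a \<le> t" "t < u" "u \<le> a + om n p"
  shows "dist (psi t) (psi u) \<le> 2 * hoelder_const * \<bar>t - u\<bar> powr (1/s)"
proof -
  have main: "dist (psi t) (psi u) \<le> 2 * hoelder_const * \<bar>t - u\<bar> powr (1/s)"
    if "(rmax powr s) ^ ((n + j) * q) < u - t"
       "(p, a) \<in> set (PL n)" "a \<le> t" "u \<le> a + om n p" for j n p a
    using that
  proof (induction j arbitrary: n p a)
    case 0
    then show ?case using om_le_level[OF PL_level[OF 0(2)]] by auto
  next
    case (Suc j)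
    have p: "p \<in> set (lv n)" by (rule PL_level[OF Suc.prems(2)])
    show ?case
    proof (cases "\<exists>p' a'. (p', a') \<in> set (lay (om (Suc n)) a (ch p)) \<and> a' \<le> t \<and> u \<le> a' + om (Suc n) p'")
      case True
      then show ?thesis using Suc.IH[of "Suc n"] Suc.prems(1) PL_children[OF Suc.prems(2)] by (metis add_Suc_shift subsetD)
    next
      case False
      show ?thesis
      proof (rule psi_hoelder_siblings[where n = "Suc n" and x = a and ps = "ch p" and W = "wt (wd p)"])
        show "dist (psi v) (psi v') \<le> wt (wd p) powr (1/s) * diamK" if "v \<in> {t..u}" "v' \<in> {t..u}" for v v'
          by (rule dist_psi_piece[of n]) (use that Suc.prems in \<open>auto simp: during_def\<close>)
      qed (use False Suc.prems assms(3) PL_children[OF Suc.prems(2)] ch_ne[OF p] om_child_ge[OF p]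
            wt_pos[OF wd_level[OF p]] sum_list_om_children[OF p] in auto)
    qed
  qed
  obtain j where "(rmax powr s) ^ ((n + j) * q) < u - t"
    using level_weight_eventually_less[of "u - t" n] assms(3) by auto
  then show ?thesis using main assms by blast
qed

lemma psi_hoelder:
  assumes "t \<in> {0..1}" "u \<in> {0..1}"
  shows "dist (psi t) (psi u) \<le> 2 * hoelder_const * \<bar>t - u\<bar> powr (1/s)"
proof -
  have main: "dist (psi t) (psi u) \<le> 2 * hoelder_const * \<bar>t - u\<bar> powr (1/s)"
    if tu: "0 \<le> t" "t < u" "u \<le> 1" for t u
  proof (cases "\<exists>p a. (p, a) \<in> set (PL 0) \<and> a \<le> t \<and> u \<le> a + om 0 p")
    case True
    then show ?thesis using psi_hoelder_piece tu by blast
  next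
    case False
    show ?thesis
    proof (rule psi_hoelder_siblings[where n = 0 and x = 0 and ps = "lv 0" and W = 1])
      show "gap_frac * 1 \<le> om 0 p" if p: "p \<in> set (lv 0)" for p
      proof -
        have "gap_frac \<le> own_frac * 1"
          unfolding gap_frac_def using own_frac rmin_powr by (intro mult_left_mono power_le_one) auto
        also have "\<dots> \<le> om 0 p" using om_ge[OF p] wd_root[of p] p by simp
        finally show ?thesis by simp
      qed
      show "dist (psi v) (psi v') \<le> 1 powr (1/s) * diamK" if "v \<in> {t..u}" "v' \<in> {t..u}" for v v'
        using that tu dist_K_le[OF psi_in_K psi_in_K] by auto
    qed (use False tu lv_ne[of 0] sum_list_om[of 0] in \<open>auto simp: PL_def\<close>)
  qed
  show ?thesis
  proof (cases "t = u")
    case False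
    then show ?thesis using main[of t u] main[of u t] assms by (cases "t < u") (auto simp: dist_commute abs_minus_commute)
  qed (simp add: hoelder_const_nonneg)
qed

lemma continuous_on_psi: "continuous_on {0..1} psi"
proof -
  have "((\<lambda>u. psi u) \<longlongrightarrow> psi t) (at t within {0..1})" if t: "t \<in> {0..1}" for t
  proof (rule Lim_transform_bound[of "\<lambda>u. psi u - psi t" "\<lambda>u. 2 * hoelder_const * \<bar>u - t\<bar> powr (1/s)", THEN Lim_null[THEN iffD2]])
    show "\<forall>\<^sub>F u in at t within {0..1}. norm (psi u - psi t) \<le> norm (2 * hoelder_const * \<bar>u - t\<bar> powr (1/s))"
      using psi_hoelder[OF _ t] hoelder_const_nonneg
      by (auto simp: eventually_at_filter dist_norm abs_mult intro!: eventuallyI always_eventually)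
    have "((\<lambda>u. 2 * hoelder_const * \<bar>u - t\<bar> powr (1/s)) \<longlongrightarrow> 2 * hoelder_const * 0) (at t within {0..1})"
    proof (intro tendsto_mult tendsto_const)
      have "((\<lambda>u. \<bar>u - t\<bar>) \<longlongrightarrow> \<bar>t - t\<bar>) (at t within {0..1})" by (intro tendsto_intros)
      then show "((\<lambda>u. \<bar>u - t\<bar> powr (1/s)) \<longlongrightarrow> 0) (at t within {0..1})"
        using s_pos by (intro tendsto_zero_powrI[OF _ tendsto_const]) auto
    qed
    then show "((\<lambda>u. 2 * hoelder_const * \<bar>u - t\<bar> powr (1/s)) \<longlongrightarrow> 0) (at t within {0..1})" by simp
  qed
  then show ?thesis by (simp add: continuous_on_def)
qed

lemma psi_onto: "psi ` {0..1} = K"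
proof
  show "psi ` {0..1} \<subseteq> K" using psi_in_K by blast
  have cl: "closed (psi ` {0..1})"
    by (intro compact_imp_closed compact_continuous_image continuous_on_psi) simp
  show "K \<subseteq> psi ` {0..1}"
  proof
    fix x assume x: "x \<in> K"
    have "\<exists>y\<in>psi ` {0..1}. dist y x < e" if "e > 0" for e
    proof -
      have "eventually (\<lambda>n. 1 * (rmax ^ (n * q) * diamK) < e) sequentially"
        using level_diam_tendsto_0[of 1] \<open>e > 0\<close> by (rule order_tendstoD)
      then obtain n where n: "rmax ^ (n * q) * diamK < e" by (auto simp: eventually_sequentially)
      obtain I where I: "I \<in> words N (n * q)" "x \<in> cell I" using K_cells[of "n * q"] x by blast
      obtain p where p: "p \<in> set (lv n)" "wd p = I" using wd_onto[OF I(1)] by auto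
      obtain a where a: "(p, a) \<in> set (PL n)" using level_PL[OF p(1)] by auto
      then have "during n p a" using om_pos[OF p(1)] by (auto simp: during_def less_imp_le)
      then have "psi a \<in> cell I" "a \<in> {0..1}" using psi_in_cell p(2) during_unit by auto
      then have "dist (psi a) x < e" using dist_cell_le_level[OF I(1) _ I(2), of "psi a"] n by simp
      then show ?thesis using \<open>a \<in> {0..1}\<close> by blast
    qed
    then show "x \<in> psi ` {0..1}" using cl by (metis closed_approachable)
  qed
qed

end

section \<open>Separation of cells under the open set condition\<close>

lemma similitude_surj:
  fixes f :: "'a::euclidean_space \<Rightarrow> 'a"
  assumes f: "similitude \<rho> f" and \<rho>: "0 < \<rho>"
  shows "surj f"
proof -
  define g where "g x = f x - f 0" for x
  have d: "dist (g x) (g y) = \<rho> * dist x y" for x y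
    using f by (simp add: g_def similitude_def dist_norm)
  have "linear g" by (rule scaling_linear[where c = \<rho>]) (use d in \<open>auto simp: g_def\<close>)
  moreover have "inj g" by (rule injI) (metis d dist_eq_0_iff \<rho> less_irrefl mult_eq_0_iff)
  ultimately have "surj g" by (rule linear_inj_imp_surj)
  then have "\<exists>x. y = f x" for y
    by (metis surjD g_def diff_add_cancel add_diff_cancel)
  then show ?thesis by blast
qed

context similitude_system
begin

lemma word_map_surj: "I \<in> words N n \<Longrightarrow> surj (word_map S I)"
  using similitude_surj[OF word_map_similitude word_ratio_pos] .

lemma open_set_words_disjoint:
  assumes U: "(\<Union>i\<in>{1..N}. S i ` U) \<subseteq> U" "disjoint_family_on (\<lambda>i. S i ` U) {1..N}"
    and "I \<in> words N m" "J \<in> words N n" "\<not> prefix I J" "\<not> prefix J I"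
  shows "word_map S I ` U \<inter> word_map S J ` U = {}"
  using assms(3-)
proof (induction I arbitrary: J m n)
  case (Cons i I)
  then obtain j J' where J: "J = j # J'" by (cases J) auto
  have sub: "word_map S w ` U \<subseteq> U" if "w \<in> words N k" for w k
    using that
  proof (induction w arbitrary: k)
    case (Cons a w)
    then have "a \<in> {1..N}" "w \<in> words N (length w)" by (auto simp: words_def)
    then have "word_map S w ` U \<subseteq> U" "S a ` U \<subseteq> U" using Cons.IH U(1) by blast+
    then show ?case by (force simp: image_comp[symmetric])
  qed simp
  have W: "i \<in> {1..N}" "I \<in> words N (length I)" "j \<in> {1..N}" "J' \<in> words N (length J')"
    using Cons.prems J by (auto simp: words_def)
  show ?case
  proof (cases "i = j")
    case True
    have "inj (S i)" using word_map_inj[of "[i]" 1] W by (simp add: words_def)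
    moreover have "word_map S I ` U \<inter> word_map S J' ` U = {}"
      using Cons.IH[OF W(2,4)] Cons.prems J True by simp
    ultimately show ?thesis
      using J True by (auto dest: injD[of "S j"])
  next
    case False
    then have "S i ` U \<inter> S j ` U = {}" using U(2) W by (auto simp: disjoint_family_on_def)
    moreover have "word_map S (i # I) ` U \<subseteq> S i ` U" "word_map S J ` U \<subseteq> S j ` U"
      using sub[OF W(2)] sub[OF W(4)] by (auto simp: J image_subset_iff)
    ultimately show ?thesis by blast
  qed
qed simp

text \<open>
  A cell of diameter comparable to \<open>\<delta>\<close> carries a ball of radius comparable to \<open>\<delta>\<close> from the open
  set, and these balls are disjoint for incomparable words. Comparing volumes bounds the number of
  such cells near a point.
\<close>

lemma bounded_overlap:
  assumes osc: "open_set_condition N S"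
  obtains Q :: real where "0 < Q"
    "\<And>\<delta> u J. \<lbrakk>0 < \<delta>; finite J; \<And>w. w \<in> J \<Longrightarrow> w \<in> words N (length w);
        \<And>w. w \<in> J \<Longrightarrow> \<delta> * rmin \<le> word_ratio r w \<and> word_ratio r w \<le> \<delta>;
        \<And>w w'. \<lbrakk>w \<in> J; w' \<in> J; prefix w w'\<rbrakk> \<Longrightarrow> w = w';
        \<And>w. w \<in> J \<Longrightarrow> cell w \<inter> cball u \<delta> \<noteq> {}\<rbrakk> \<Longrightarrow> real (card J) \<le> Q"
proof -
  obtain U where U: "open U" "U \<noteq> {}" "(\<Union>i\<in>{1..N}. S i ` U) \<subseteq> U"
    "disjoint_family_on (\<lambda>i. S i ` U) {1..N}"
    using osc by (auto simp: open_set_condition_def)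
  obtain x \<rho> where x: "0 < \<rho>" "ball x \<rho> \<subseteq> U" using U(1,2) open_contains_ball by blast
  obtain z where z: "z \<in> K" using K_ne by blast
  define M where "M = 1 + diamK + dist z x + \<rho>"
  have M: "0 < M" using x diamK_nonneg by (simp add: M_def add_pos_nonneg add.commute)
  let ?V = "unit_ball_vol (real DIM('a))"
  have V: "0 < ?V" by simp
  show ?thesis
  proof (rule that[of "(M / (rmin * \<rho>)) ^ DIM('a)"])
    show "0 < (M / (rmin * \<rho>)) ^ DIM('a)" using M x rmin_pos by simp
    fix \<delta> :: real and u :: 'a and J
    assume \<delta>: "0 < \<delta>" and fin: "finite J" and W: "\<And>w. w \<in> J \<Longrightarrow> w \<in> words N (length w)"
      and rat: "\<And>w. w \<in> J \<Longrightarrow> \<delta> * rmin \<le> word_ratio r w \<and> word_ratio r w \<le> \<delta>"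
      and inc: "\<And>w w'. \<lbrakk>w \<in> J; w' \<in> J; prefix w w'\<rbrakk> \<Longrightarrow> w = w'"
      and meet: "\<And>w. w \<in> J \<Longrightarrow> cell w \<inter> cball u \<delta> \<noteq> {}"
    define \<epsilon> where "\<epsilon> = \<delta> * rmin * \<rho>"
    have \<epsilon>: "0 < \<epsilon>" using \<delta> rmin_pos x by (simp add: \<epsilon>_def)
    define B where "B w = ball (word_map S w x) \<epsilon>" for w
    have Bsub: "B w \<subseteq> ball u (\<delta> * M)" if w: "w \<in> J" for w
    proof
      fix y assume "y \<in> B w"
      then have y: "dist (word_map S w x) y < \<epsilon>" by (simp add: B_def)
      obtain k where k: "k \<in> K" "dist u (word_map S w k) \<le> \<delta>"
        using meet[OF w] by (auto simp: cell_def)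
      have "dist (word_map S w k) (word_map S w x) = word_ratio r w * dist k x"
        by (rule word_map_dist[OF W[OF w]])
      also have "\<dots> \<le> \<delta> * (diamK + dist z x)"
        using rat[OF w] word_ratio_pos[OF W[OF w]] dist_K_le[OF k(1) z] dist_triangle[of k x z] \<delta>
        by (intro mult_mono) auto
      finally have 1: "dist (word_map S w k) (word_map S w x) \<le> \<delta> * (diamK + dist z x)" .
      have "\<epsilon> \<le> \<delta> * \<rho>" using \<delta> x rmin_less_1 rmin_pos by (simp add: \<epsilon>_def mult_left_le)
      then have "dist u y < \<delta> * M"
        using dist_triangle[of u y "word_map S w k"] dist_triangle[of "word_map S w k" y "word_map S w x"]
          k(2) 1 y by (simp add: M_def algebra_simps)
      then show "y \<in> ball u (\<delta> * M)" by simp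
    qed
    have Bdisj: "B w \<inter> B w' = {}" if w: "w \<in> J" "w' \<in> J" "w \<noteq> w'" for w w'
    proof -
      have sub: "B v \<subseteq> word_map S v ` U" if v: "v \<in> J" for v
      proof
        fix y assume y: "y \<in> B v"
        have "surj (word_map S v)" by (rule word_map_surj[OF W[OF v]])
        then obtain y0 where y0: "y = word_map S v y0" by blast
        have "word_ratio r v * dist x y0 < \<epsilon>"
          using y word_map_dist[OF W[OF v]] by (simp add: B_def y0)
        also have "\<epsilon> \<le> word_ratio r v * \<rho>" using rat[OF v] x by (simp add: \<epsilon>_def)
        finally have "dist x y0 < \<rho>" using word_ratio_pos[OF W[OF v]] by simp
        then show "y \<in> word_map S v ` U" using x y0 by auto
      qed
      have "word_map S w ` U \<inter> word_map S w' ` U = {}"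
        by (rule open_set_words_disjoint[OF U(3,4) W W]) (use w inc in auto)
      then show ?thesis using sub[OF w(1)] sub[OF w(2)] by blast
    qed
    have Bfin: "emeasure lborel (B w) \<noteq> \<infinity>" for w
      using emeasure_lborel_ball_finite[of "word_map S w x" \<epsilon>] by (auto simp: B_def)
    have big: "ball u (\<delta> * M) \<in> fmeasurable lborel"
      using emeasure_lborel_ball_finite[of u "\<delta> * M"] by (intro fmeasurableI) auto
    have "(\<Sum>w\<in>J. measure lborel (B w)) = measure lborel (\<Union>w\<in>J. B w)"
      by (rule measure_finite_Union[symmetric])
         (use fin Bdisj Bfin in \<open>auto simp: disjoint_family_on_def\<close>, simp add: B_def)
    also have "\<dots> \<le> measure lborel (ball u (\<delta> * M))"
    proof (rule measure_mono_fmeasurable[OF _ _ big])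
      show "(\<Union>w\<in>J. B w) \<in> sets lborel" using fin by (auto simp: B_def)
    qed (use Bsub in blast)
    finally have "real (card J) * (?V * \<epsilon> ^ DIM('a)) \<le> ?V * (\<delta> * M) ^ DIM('a)"
      using \<epsilon> \<delta> M by (simp add: B_def content_ball)
    then have "real (card J) * \<epsilon> ^ DIM('a) \<le> (\<delta> * M) ^ DIM('a)"
      using V by (simp add: mult.left_commute)
    then have "real (card J) \<le> (\<delta> * M) ^ DIM('a) / \<epsilon> ^ DIM('a)"
      using \<epsilon> by (simp add: pos_le_divide_eq)
    also have "\<dots> = (M / (rmin * \<rho>)) ^ DIM('a)"
      using \<delta> by (simp add: \<epsilon>_def power_divide[symmetric] mult.assoc)
    finally show "real (card J) \<le> (M / (rmin * \<rho>)) ^ DIM('a)" .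
  qed
qed

end

context moran_system
begin

text \<open>
  Group the words by the prefix at which the ratio drops to \<open>\<delta>\<close>: the weights in one group add up to
  at most \<open>\<delta> powr s\<close>, and by the separation of the cells the number of groups near a point is bounded.
\<close>

lemma weight_near_point:
  assumes osc: "open_set_condition N S"
  shows "\<exists>Q>0. \<forall>\<delta> u m. 0 < \<delta> \<longrightarrow> \<delta> < 1 \<longrightarrow> rmax ^ m \<le> \<delta> \<longrightarrow>
        (\<Sum>I\<in>{I \<in> words N m. cell I \<inter> cball u \<delta> \<noteq> {}}. wt I) \<le> Q * \<delta> powr s"
proof -
  obtain Q where Q: "0 < Q"
    "\<And>\<delta> u J. \<lbrakk>0 < \<delta>; finite J; \<And>w. w \<in> J \<Longrightarrow> w \<in> words N (length w);
        \<And>w. w \<in> J \<Longrightarrow> \<delta> * rmin \<le> word_ratio r w \<and> word_ratio r w \<le> \<delta>;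
        \<And>w w'. \<lbrakk>w \<in> J; w' \<in> J; prefix w w'\<rbrakk> \<Longrightarrow> w = w';
        \<And>w. w \<in> J \<Longrightarrow> cell w \<inter> cball u \<delta> \<noteq> {}\<rbrakk> \<Longrightarrow> real (card J) \<le> Q"
    using bounded_overlap[OF osc] by metis
  show ?thesis
  proof (intro exI[of _ Q] conjI Q(1) allI impI)
    fix \<delta> :: real and u :: 'a and m
    assume \<delta>: "0 < \<delta>" "\<delta> < 1" "rmax ^ m \<le> \<delta>"
    let ?X = "{I \<in> words N m. cell I \<inter> cball u \<delta> \<noteq> {}}"
    \<comment> \<open>Cut every word at the first place where the ratio has dropped to \<open>\<delta>\<close>.\<close>
    define k where "k I = (LEAST k. word_ratio r (take k I) \<le> \<delta>)" for I
    have tk: "take i I \<in> words N (length (take i I))" "drop i I \<in> words N (length (drop i I))"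
      if "I \<in> words N m" for i I
      using that by (auto simp: words_def dest: in_set_takeD in_set_dropD)
    have k: "word_ratio r (take (k I) I) \<le> \<delta>" "k I \<le> m" if I: "I \<in> words N m" for I
    proof -
      have 1: "word_ratio r (take m I) \<le> \<delta>" using word_ratio_le[OF I] \<delta> I by (simp add: words_length)
      show "word_ratio r (take (k I) I) \<le> \<delta>" unfolding k_def by (rule LeastI[of _ m]) (rule 1)
      show "k I \<le> m" unfolding k_def by (rule Least_le) (rule 1)
    qed
    have kmin: "\<delta> < word_ratio r (take i I)" if "i < k I" for i I
      using not_less_Least[of i "\<lambda>k. word_ratio r (take k I) \<le> \<delta>"] that by (simp add: k_def)
    define c where "c I = take (k I) I" for I
    have rat: "\<delta> * rmin \<le> word_ratio r (c I)" if I: "I \<in> words N m" for I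
    proof -
      have "k I \<noteq> 0" using k(1)[OF I] \<delta> by (cases "k I = 0") auto
      then obtain i where i: "k I = Suc i" by (cases "k I") auto
      then have il: "i < length I" using k(2)[OF I] I by (simp add: words_length)
      then have "c I = take i I @ [I ! i]" by (simp add: c_def i take_Suc_conv_app_nth)
      then have "word_ratio r (c I) = word_ratio r (take i I) * r (I ! i)" by simp
      moreover have "I ! i \<in> {1..N}" using I il nth_mem by (fastforce simp: words_def)
      then have "rmin \<le> r (I ! i)" by (rule rmin_le)
      ultimately show ?thesis using kmin[of i I] i \<delta> rmin_pos by (auto intro!: mult_mono)
    qed
    have "real (card (c ` ?X)) \<le> Q"
    proof (rule Q(2)[of \<delta> _ u])
      show "w = w'" if ww: "w \<in> c ` ?X" "w' \<in> c ` ?X" "prefix w w'" for w w'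
      proof -
        obtain I I' where I: "w = c I" "w' = c I'" "I \<in> words N m" "I' \<in> words N m" using ww by auto
        have l: "length w = k I" "length w' = k I'" using I k(2) by (auto simp: c_def words_length)
        have "k I \<le> k I'" using ww(3) l prefix_length_le by metis
        moreover have "\<not> k I < k I'"
        proof
          assume less: "k I < k I'"
          have "w = take (k I) w'" using ww(3) l by (auto elim!: prefixE)
          then have "w = take (k I) I'" using less I(2) by (simp add: c_def min_def)
          then show False using kmin[OF less] k(1)[OF I(3)] I(1) by (simp add: c_def)
        qed
        ultimately have "length w = length w'" using l by simp
        then show ?thesis using ww(3) by (metis prefix_order.eq_iff prefix_length_prefix order_refl)
      qed
      show "cell w \<inter> cball u \<delta> \<noteq> {}" if w: "w \<in> c ` ?X" for w
      proof -
        obtain I where I: "w = c I" "I \<in> words N m" "cell I \<inter> cball u \<delta> \<noteq> {}" using w by blast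
        have "cell I \<subseteq> cell w"
          using cell_append_subset[OF tk(2)[OF I(2), of "k I"], of w] by (simp add: I(1) c_def)
        then show ?thesis using I(3) by blast
      qed
    qed (use \<delta> tk rat k in \<open>auto simp: c_def\<close>)
    have "(\<Sum>I\<in>?X. wt I) = (\<Sum>w\<in>c ` ?X. \<Sum>I\<in>{I \<in> ?X. c I = w}. wt I)"
      by (rule sum.image_gen) simp
    also have "\<dots> \<le> (\<Sum>w\<in>c ` ?X. \<delta> powr s)"
    proof (rule sum_mono)
      fix w assume "w \<in> c ` ?X"
      then obtain I where I: "I \<in> words N m" "w = c I" by auto
      have w: "w \<in> words N (length w)" using tk(1)[OF I(1)] I(2) by (simp add: c_def)
      have "(\<Sum>I\<in>{I \<in> ?X. c I = w}. wt I) \<le> (\<Sum>I\<in>(\<lambda>v. w @ v) ` words N (m - length w). wt I)"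
      proof (rule sum_mono2)
        show "{I \<in> ?X. c I = w} \<subseteq> (\<lambda>v. w @ v) ` words N (m - length w)"
        proof
          fix I' assume I': "I' \<in> {I \<in> ?X. c I = w}"
          then have "I' = w @ drop (k I') I'" by (auto simp: c_def)
          moreover have "length w = k I'" using I' k(2)[of I'] by (auto simp: c_def words_length)
          then have "drop (k I') I' \<in> words N (m - length w)"
            using tk(2)[of I' "k I'"] I' by (auto simp: words_length)
          ultimately show "I' \<in> (\<lambda>v. w @ v) ` words N (m - length w)" by blast
        qed
        show "0 \<le> wt v" if "v \<in> (\<lambda>v. w @ v) ` words N (m - length w) - {I \<in> ?X. c I = w}" for v
          using that wt_pos[OF words_append[OF w]] by (auto intro: less_imp_le)
      qed auto
      also have "\<dots> = wt w" using sum_wt_append[OF w] by (subst sum.reindex) (auto simp: inj_on_def)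
      also have "\<dots> \<le> \<delta> powr s"
        unfolding wt_def using k(1)[OF I(1)] I(2) word_ratio_pos[OF w] s_pos
        by (intro powr_mono2) (auto simp: c_def)
      finally show "(\<Sum>I\<in>{I \<in> ?X. c I = w}. wt I) \<le> \<delta> powr s" .
    qed
    also have "\<dots> = real (card (c ` ?X)) * \<delta> powr s" by simp
    also have "\<dots> \<le> Q * \<delta> powr s" using \<open>real (card (c ` ?X)) \<le> Q\<close> by (intro mult_right_mono) auto
    finally show "(\<Sum>I\<in>?X. wt I) \<le> Q * \<delta> powr s" .
  qed
qed

lemma hausdorff_cell_le:
  assumes "I \<in> words N n"
  shows "hausdorff_measure s (cell I) \<le> ennreal (wt I) * hausdorff_measure s K"
  unfolding cell_def wt_def
  using word_map_similitude[OF assms] word_ratio_pos[OF assms] s_pos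
  by (rule hausdorff_measure_similitude_le)

lemma hausdorff_K_finite: "hausdorff_measure s K < \<infinity>"
proof -
  have "hausdorff_measure s K \<le> ennreal (diamK powr s)"
  proof (rule hausdorff_measure_leI)
    fix \<delta> :: real assume "\<delta> > 0"
    have "(\<lambda>n. rmax ^ n * diamK) \<longlonglongrightarrow> 0" using rmax_power_tendsto_0 by (rule tendsto_mult_left_zero)
    then have "eventually (\<lambda>n. rmax ^ n * diamK < \<delta>) sequentially"
      using \<open>\<delta> > 0\<close> by (intro order_tendstoD) auto
    then obtain n where n: "rmax ^ n * diamK < \<delta>" by (auto simp: eventually_sequentially)
    have cellb: "bounded (cell I)" "diameter (cell I) \<le> word_ratio r I * diamK" if I: "I \<in> words N n" for I
      using diameter_le_of_dist_le[OF dist_cell_le[OF I]] word_ratio_pos[OF I] diamK_nonneg by auto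
    obtain e where e: "bij_betw e {0..<card (words N n)} (words N n)"
      using ex_bij_betw_nat_finite[OF finite_words] by blast
    let ?m = "card (words N n)"
    define U where "U i = (if i < ?m then cell (e i) else {})" for i
    have ew: "e i \<in> words N n" if "i < ?m" for i using e that by (auto simp: bij_betw_def)
    have "hausdorff_delta s \<delta> K \<le> (\<Sum>i. hausdorff_weight s (U i))"
    proof (rule hausdorff_delta_cover_le)
      show "K \<subseteq> (\<Union>i. U i)"
      proof
        fix x assume "x \<in> K"
        then obtain I where "I \<in> words N n" "x \<in> cell I" using K_cells[of n] by blast
        then obtain i where "i < ?m" "e i = I" using e by (force simp: bij_betw_def)
        then have "x \<in> U i" using \<open>x \<in> cell I\<close> by (simp add: U_def)
        then show "x \<in> (\<Union>i. U i)" by blast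
      qed
      show "bounded (U i)" for i using cellb ew by (simp add: U_def)
      show "diameter (U i) \<le> \<delta>" for i
      proof (cases "i < ?m")
        case True
        have "diameter (cell (e i)) \<le> word_ratio r (e i) * diamK" by (rule cellb(2)[OF ew[OF True]])
        also have "\<dots> \<le> rmax ^ n * diamK" using word_ratio_le[OF ew[OF True]] diamK_nonneg by (rule mult_right_mono)
        finally show ?thesis using n True by (simp add: U_def)
      qed (use \<open>\<delta> > 0\<close> in \<open>simp add: U_def\<close>)
    qed
    also have "\<dots> = (\<Sum>i<?m. hausdorff_weight s (U i))" by (rule suminf_finite) (auto simp: U_def)
    also have "\<dots> = (\<Sum>I\<in>words N n. hausdorff_weight s (cell I))"
      using sum.reindex_bij_betw[OF e, of "\<lambda>I. hausdorff_weight s (cell I)"]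
      by (simp add: U_def atLeast0LessThan)
    also have "\<dots> \<le> (\<Sum>I\<in>words N n. ennreal (wt I * diamK powr s))"
    proof (rule sum_mono)
      fix I assume I: "I \<in> words N n"
      have "diameter (cell I) powr s \<le> (word_ratio r I * diamK) powr s"
        using cellb[OF I] s_pos by (intro powr_mono2) (auto simp: diameter_ge_0)
      also have "\<dots> = wt I * diamK powr s" by (simp add: wt_def powr_mult)
      finally show "hausdorff_weight s (cell I) \<le> ennreal (wt I * diamK powr s)"
        using s_pos by (auto simp: hausdorff_weight_def intro: ennreal_leI)
    qed
    also have "\<dots> = ennreal (\<Sum>I\<in>words N n. wt I * diamK powr s)"
      by (rule sum_ennreal) (auto intro!: mult_nonneg_nonneg intro: wt_pos less_imp_le)
    also have "(\<Sum>I\<in>words N n. wt I * diamK powr s) = diamK powr s"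
      by (simp add: sum_distrib_right[symmetric] sum_wt)
    finally show "hausdorff_delta s \<delta> K \<le> ennreal (diamK powr s)" .
  qed
  then show ?thesis by (simp add: le_less_trans)
qed

end

context piece_system
begin

section \<open>The image of Lebesgue measure\<close>

definition at_words where "at_words n W = {t. \<exists>p. during n p t \<and> wd p \<in> W}"

lemma during_interval:
  assumes "p \<in> set (lv n)"
  shows "\<exists>a. {t. during n p t} = {a..a + om n p}"
proof -
  obtain a where a: "(p, a) \<in> set (PL n)" using level_PL[OF assms] by auto
  then have "{t. during n p t} = {a..a + om n p}" by (auto simp: during_def dest: PL_unique[OF a])
  then show ?thesis by blast
qed

lemma during_measurable: "p \<in> set (lv n) \<Longrightarrow> {t. during n p t} \<in> lmeasurable"
  "p \<in> set (lv n) \<Longrightarrow> {t. during n p t} \<in> sets borel"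
  "p \<in> set (lv n) \<Longrightarrow> measure lebesgue {t. during n p t} = om n p"
proof -
  assume p: "p \<in> set (lv n)"
  obtain a where "{t. during n p t} = {a..a + om n p}" using during_interval[OF p] by auto
  then show "{t. during n p t} \<in> lmeasurable" "{t. during n p t} \<in> sets borel"
    "measure lebesgue {t. during n p t} = om n p"
    using om_pos[OF p] by auto
qed

lemma at_words_UN: "at_words n W = (\<Union>p\<in>{p \<in> set (lv n). wd p \<in> W}. {t. during n p t})"
  by (auto simp: at_words_def dest: during_level)

lemma at_words_borel: "at_words n W \<in> sets borel"
  unfolding at_words_UN by (intro sets.finite_UN during_measurable(2)) auto

lemma at_words_lmeasurable: "at_words n W \<in> lmeasurable"
  unfolding at_words_UN by (intro fmeasurable.finite_UN during_measurable(1)) auto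

lemma at_words_cover: "at_words n W \<union> at_words n (- W) = {0..1}"
  using during_unit during_ex by (auto simp: at_words_def) blast+

lemma sum_om_words:
  assumes "W \<subseteq> words N (n * q)"
  shows "(\<Sum>p\<in>{p \<in> set (lv n). wd p \<in> W}. om n p) = (\<Sum>I\<in>W. wt I)"
proof -
  have "(\<Sum>I\<in>W. \<Sum>p\<in>{p \<in> {p \<in> set (lv n). wd p \<in> W}. wd p = I}. om n p)
      = (\<Sum>p\<in>{p \<in> set (lv n). wd p \<in> W}. om n p)"
    by (rule sum.group) (use assms finite_subset[OF assms finite_words] in auto)
  moreover have "(\<Sum>p\<in>{p \<in> {p \<in> set (lv n). wd p \<in> W}. wd p = I}. om n p) = wt I" if "I \<in> W" for I
  proof -
    have "{p \<in> {p \<in> set (lv n). wd p \<in> W}. wd p = I} = {p \<in> set (lv n). wd p = I}" using that by auto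
    then show ?thesis using sum_om_word[of I n] that assms by auto
  qed
  ultimately show ?thesis by simp
qed

text \<open>
  The time spent in a set of cells of one level is the sum of their weights. Subadditivity gives
  one inequality, and its application to the remaining cells gives the other.
\<close>

lemma measure_at_words:
  assumes W: "W \<subseteq> words N (n * q)"
  shows "measure lebesgue (at_words n W) = (\<Sum>I\<in>W. wt I)"
proof -
  have le: "measure lebesgue (at_words n W) \<le> (\<Sum>p\<in>{p \<in> set (lv n). wd p \<in> W}. om n p)" for W
  proof -
    have "measure lebesgue (at_words n W) \<le> (\<Sum>p\<in>{p \<in> set (lv n). wd p \<in> W}. measure lebesgue {t. during n p t})"
      unfolding at_words_UN by (rule measure_UNION_le) (use during_measurable(1) in auto)
    then show ?thesis using during_measurable(3) by simp
  qed
  have "1 = measure lebesgue (at_words n W \<union> at_words n (- W))" by (simp add: at_words_cover)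
  also have "\<dots> \<le> measure lebesgue (at_words n W) + measure lebesgue (at_words n (- W))"
    by (rule measure_Un_le) (use at_words_lmeasurable in auto)
  also have "\<dots> \<le> measure lebesgue (at_words n W) + (\<Sum>p\<in>{p \<in> set (lv n). wd p \<in> - W}. om n p)"
    using le[of "- W"] by simp
  also have "(\<Sum>p\<in>{p \<in> set (lv n). wd p \<in> - W}. om n p) = 1 - (\<Sum>p\<in>{p \<in> set (lv n). wd p \<in> W}. om n p)"
  proof -
    have "set (lv n) = {p \<in> set (lv n). wd p \<in> W} \<union> {p \<in> set (lv n). wd p \<in> - W}" by auto
    then have "(\<Sum>p\<in>set (lv n). om n p)
        = (\<Sum>p\<in>{p \<in> set (lv n). wd p \<in> W}. om n p) + (\<Sum>p\<in>{p \<in> set (lv n). wd p \<in> - W}. om n p)"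
      by (subst sum.union_disjoint[symmetric]) auto
    then show ?thesis by (simp add: sum_om)
  qed
  finally show ?thesis using le[of W] sum_om_words[OF W] by simp
qed

lemma emeasure_at_words:
  assumes W: "W \<subseteq> words N (n * q)"
  shows "emeasure lborel (at_words n W) = ennreal (\<Sum>I\<in>W. wt I)"
proof -
  have "emeasure lborel (at_words n W) = emeasure lebesgue (at_words n W)"
    using at_words_borel by simp
  also have "\<dots> = ennreal (measure lebesgue (at_words n W))"
    by (rule emeasure_eq_measure2[symmetric, THEN sym]) (use at_words_lmeasurable in auto)
  finally show ?thesis by (simp add: measure_at_words[OF W])
qed

definition preim where "preim B = {0..1} \<inter> psi -` B"

lemma preim_measurable: "B \<in> sets borel \<Longrightarrow> preim B \<in> sets borel"
proof -
  assume B: "B \<in> sets borel"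
  have "psi \<in> borel_measurable (restrict_space borel {0..1})"
    by (rule borel_measurable_continuous_on_restrict[OF continuous_on_psi])
  from measurable_sets[OF this B] show ?thesis
    by (auto simp: preim_def sets_restrict_space_iff space_restrict_space Int_commute)
qed

definition occ where "occ = distr (restrict_space lborel {0..1}) borel psi"

lemma occ: "sets occ = sets borel" "B \<in> sets borel \<Longrightarrow> emeasure occ B = emeasure lborel (preim B)"
proof -
  show "sets occ = sets borel" by (simp add: occ_def)
  assume B: "B \<in> sets borel"
  have m: "psi \<in> measurable (restrict_space lborel {0..1}) borel"
    using borel_measurable_continuous_on_restrict[OF continuous_on_psi]
    by (simp cong: measurable_cong_sets add: sets_restrict_space)
  show "emeasure occ B = emeasure lborel (preim B)"
    unfolding occ_def by (subst emeasure_distr[OF m B])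
      (simp add: emeasure_restrict_space preim_def space_restrict_space Int_commute)
qed

lemma preim_UNIV: "preim UNIV = {0..1}" "preim K = {0..1}"
  using psi_in_K by (auto simp: preim_def)

lemma occ_finite: "emeasure occ (space occ) \<noteq> \<infinity>"
proof -
  have "space occ = UNIV" by (simp add: occ_def)
  then show ?thesis using occ(2)[of UNIV] by (simp add: preim_UNIV)
qed

end

context piece_system
begin

text \<open>
  The mass distribution principle: the time spent near a point is at most a multiple of
  \<open>\<delta> powr s\<close>, hence a cover of \<open>K\<close> by sets of small total weight cannot exist.
\<close>

lemma hausdorff_K_positive:
  assumes osc: "open_set_condition N S"
  shows "0 < hausdorff_measure s K"
proof -
  obtain Q :: real where Q: "0 < Q"
    "\<And>\<delta> u m. \<lbrakk>0 < \<delta>; \<delta> < 1; rmax ^ m \<le> \<delta>\<rbrakk> \<Longrightarrow>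
        (\<Sum>I\<in>{I \<in> words N m. cell I \<inter> cball u \<delta> \<noteq> {}}. wt I) \<le> Q * \<delta> powr s"
    using weight_near_point[OF osc] by blast
  have room: "0 < 1 - (1/4) powr s" using powr_less_mono2[of s "1/4" 1] s_pos by simp
  have near: "\<exists>E\<in>sets borel. preim U \<subseteq> E \<and> emeasure lborel E \<le> ennreal Q * (hausdorff_weight s U + ennreal \<eta>)"
    if U: "bounded U" "diameter U \<le> 1/4" and \<eta>: "0 < \<eta>" "\<eta> < 1 - (1/4) powr s" for U \<eta>
  proof (cases "U = {}")
    case False
    then obtain u where u: "u \<in> U" by blast
    define \<delta> where "\<delta> = (diameter U powr s + \<eta>) powr (1/s)"
    have d0: "0 \<le> diameter U" using U(1) by (simp add: diameter_ge_0)
    have \<delta>s: "\<delta> powr s = diameter U powr s + \<eta>" using s_pos \<eta> by (simp add: \<delta>_def powr_powr)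
    have "diameter U powr s \<le> (1/4) powr s" using U(2) d0 s_pos by (intro powr_mono2) auto
    then have "diameter U powr s + \<eta> < 1" using \<eta> by simp
    then have \<delta>1: "\<delta> < 1" using powr_less_mono2[of "1/s" "diameter U powr s + \<eta>" 1] s_pos \<eta>(1)
      by (simp add: \<delta>_def)
    have \<delta>0: "0 < \<delta>" 
      using \<eta>(1) powr_ge_zero[of "diameter U" s] unfolding \<delta>_def powr_gt_zero by linarith
    have "diameter U \<le> \<delta>"
    proof (rule ccontr)
      assume "\<not> diameter U \<le> \<delta>"
      then have "\<delta> powr s \<le> diameter U powr s" using s_pos \<delta>0 by (intro powr_mono2) auto
      then show False using \<delta>s \<eta>(1) by simp
    qed
    then have sub: "U \<subseteq> cball u \<delta>" using diameter_bounded_bound[OF U(1) u] by fastforce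
    have "eventually (\<lambda>n. rmax ^ n < \<delta>) sequentially"
      using rmax_power_tendsto_0 \<delta>0 by (rule order_tendstoD)
    then obtain m where "\<And>k. k \<ge> m \<Longrightarrow> rmax ^ k < \<delta>" by (auto simp: eventually_sequentially)
    then have m: "rmax ^ (m * q) \<le> \<delta>" using q_pos by (simp add: less_imp_le)
    let ?W = "{I \<in> words N (m * q). cell I \<inter> cball u \<delta> \<noteq> {}}"
    have "preim U \<subseteq> at_words m ?W"
    proof
      fix t assume t: "t \<in> preim U"
      then obtain p where p: "during m p t" using during_ex by (auto simp: preim_def)
      then have "psi t \<in> cell (wd p)" "wd p \<in> words N (m * q)"
        by (auto intro: psi_in_cell dest: during_level wd_level)
      then show "t \<in> at_words m ?W" using p t sub by (auto simp: at_words_def preim_def)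
    qed
    moreover have "emeasure lborel (at_words m ?W) \<le> ennreal Q * (hausdorff_weight s U + ennreal \<eta>)"
    proof -
      have "emeasure lborel (at_words m ?W) = ennreal (\<Sum>I\<in>?W. wt I)" by (rule emeasure_at_words) auto
      also have "\<dots> \<le> ennreal (Q * \<delta> powr s)" by (intro ennreal_leI Q(2) \<delta>0 \<delta>1 m)
      also have "\<dots> = ennreal Q * (ennreal (diameter U powr s) + ennreal \<eta>)"
        using Q(1) \<eta>(1) by (simp add: \<delta>s ennreal_mult ennreal_plus[symmetric] del: ennreal_plus)
      finally show ?thesis using False s_pos by (simp add: hausdorff_weight_def)
    qed
    ultimately show ?thesis using at_words_borel by blast
  qed (auto simp: preim_def intro!: bexI[of _ "{}"])
  have "1 \<le> ennreal Q * (\<Sum>i. hausdorff_weight s (U i))"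
    if U: "K \<subseteq> (\<Union>i::nat. U i)" "\<And>i. bounded (U i)" "\<And>i. diameter (U i) \<le> 1/4" for U
  proof -
    have eps: "1 \<le> ennreal Q * (\<Sum>i. hausdorff_weight s (U i)) + ennreal (Q * \<eta>)"
      if \<eta>: "0 < \<eta>" "\<eta> < 1 - (1/4) powr s" for \<eta>
    proof -
      have "\<exists>E\<in>sets borel. preim (U i) \<subseteq> E \<and>
          emeasure lborel E \<le> ennreal Q * (hausdorff_weight s (U i) + ennreal (\<eta> * (1/2) ^ Suc i))" for i
      proof (rule near[OF U(2,3)])
        show "0 < \<eta> * (1/2) ^ Suc i" using \<eta> by simp
        have "(1/2::real) ^ Suc i \<le> 1" by (rule power_le_one) auto
        then show "\<eta> * (1/2) ^ Suc i < 1 - (1/4) powr s" using \<eta> mult_left_le[of "(1/2) ^ Suc i" \<eta>] by linarith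
      qed
      then have "\<exists>E. \<forall>i. E i \<in> sets borel \<and> preim (U i) \<subseteq> E i \<and>
          emeasure lborel (E i) \<le> ennreal Q * (hausdorff_weight s (U i) + ennreal (\<eta> * (1/2) ^ Suc i))"
        by (intro choice) blast
      then obtain E where E: "\<And>i. E i \<in> sets borel" "\<And>i. preim (U i) \<subseteq> E i"
        "\<And>i. emeasure lborel (E i) \<le> ennreal Q * (hausdorff_weight s (U i) + ennreal (\<eta> * (1/2) ^ Suc i))"
        by blast
      have "{0..1} \<subseteq> (\<Union>i. E i)"
      proof
        fix t :: real assume t: "t \<in> {0..1}"
        then obtain i where "psi t \<in> U i" using U(1) psi_in_K by blast
        then have "t \<in> E i" using E(2)[of i] t by (auto simp: preim_def)
        then show "t \<in> (\<Union>i. E i)" by blast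
      qed
      then have "emeasure lborel {0..1::real} \<le> emeasure lborel (\<Union>i. E i)"
        by (rule emeasure_mono) (use E(1) in auto)
      also have "\<dots> \<le> (\<Sum>i. emeasure lborel (E i))"
        by (rule emeasure_subadditive_countably) (use E(1) in auto)
      also have "\<dots> \<le> (\<Sum>i. ennreal Q * (hausdorff_weight s (U i) + ennreal (\<eta> * (1/2) ^ Suc i)))"
        using E(3) by (intro suminf_le) auto
      also have "\<dots> = ennreal Q * ((\<Sum>i. hausdorff_weight s (U i)) + (\<Sum>i. ennreal (\<eta> * (1/2) ^ Suc i)))"
        by (simp add: suminf_add[symmetric])
      also have "(\<Sum>i. ennreal (\<eta> * (1/2) ^ Suc i)) = ennreal \<eta>"
        using sums_mult[OF power_half_series, of \<eta>] \<eta> by (intro suminf_ennreal_eq) auto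
      finally show ?thesis using Q(1) \<eta> by (simp add: distrib_left ennreal_mult)
    qed
    show ?thesis
    proof (rule ennreal_le_epsilon)
      fix e :: real assume "0 < e"
      define \<eta> where "\<eta> = min (e / Q) ((1 - (1/4) powr s) / 2)"
      have \<eta>: "0 < \<eta>" "\<eta> < 1 - (1/4) powr s" "\<eta> \<le> e / Q"
        using \<open>0 < e\<close> Q(1) room by (auto simp: \<eta>_def min_less_iff_disj)
      then have "Q * \<eta> \<le> e" using Q(1) by (simp add: field_simps)
      then show "1 \<le> ennreal Q * (\<Sum>i. hausdorff_weight s (U i)) + ennreal e"
        using eps[OF \<eta>(1,2)] by (meson add_left_mono ennreal_leI order_trans)
    qed
  qed
  then have "1 / ennreal Q \<le> hausdorff_delta s (1/4) K"
    unfolding hausdorff_delta_def using Q(1)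
    by (intro INF_greatest, intro divide_le_posI_ennreal) auto
  moreover have "0 < 1 / ennreal Q" using Q(1) by (simp add: ennreal_zero_less_divide)
  ultimately show ?thesis using hausdorff_delta_le_measure[of "1/4" s K] by (simp add: less_le_trans)
qed

text \<open>
  The maximal cells inside an open set cover its part of \<open>K\<close>. Their Hausdorff measure is at most
  proportional to their weight, and the time spent in them is equal to their weight.
\<close>

lemma hausdorff_open_le:
  assumes G: "open G"
  shows "hausdorff_measure s (G \<inter> K) \<le> hausdorff_measure s K * emeasure lborel (preim G)"
proof -
  define T where "T n = {I \<in> words N (n * q). cell I \<subseteq> G \<and> (\<forall>k<n. \<not> cell (take (k * q) I) \<subseteq> G)}" for n
  have cover: "G \<inter> K \<subseteq> (\<Union>n. \<Union>I\<in>T n. cell I)"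
  proof
    fix x assume x: "x \<in> G \<inter> K"
    then obtain e where e: "0 < e" "ball x e \<subseteq> G" using G open_contains_ball by blast
    have "eventually (\<lambda>n. 1 * (rmax ^ (n * q) * diamK) < e) sequentially"
      using level_diam_tendsto_0[of 1] e(1) by (rule order_tendstoD)
    then obtain n where n: "rmax ^ (n * q) * diamK < e" by (auto simp: eventually_sequentially)
    obtain I where I: "I \<in> words N (n * q)" "x \<in> cell I" using K_cells[of "n * q"] x by blast
    have "cell I \<subseteq> G" using dist_cell_le_level[OF I] n e(2) by fastforce
    then have P: "cell (take (n * q) I) \<subseteq> G" using I(1) by (simp add: words_length)
    define k where "k = (LEAST k. cell (take (k * q) I) \<subseteq> G)"
    have k: "cell (take (k * q) I) \<subseteq> G" "k \<le> n"
      unfolding k_def by (rule LeastI[of _ n], rule P) (rule Least_le, rule P)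
    have kmin: "\<not> cell (take (i * q) I) \<subseteq> G" if "i < k" for i
      using not_less_Least[of i "\<lambda>k. cell (take (k * q) I) \<subseteq> G"] that by (simp add: k_def)
    have W: "take (k * q) I \<in> words N (k * q)" "drop (k * q) I \<in> words N (length (drop (k * q) I))"
      using I(1) k(2) by (auto simp: words_def dest: in_set_takeD in_set_dropD)
    have "x \<in> cell (take (k * q) I)" using I(2) cell_append_subset[OF W(2), of "take (k * q) I"] by auto
    moreover have "take (k * q) I \<in> T k"
      using W(1) k(1) kmin by (auto simp: T_def min_def mult_le_mono1 less_imp_le)
    ultimately show "x \<in> (\<Union>n. \<Union>I\<in>T n. cell I)" by blast
  qed
  have finT: "finite (T n)" for n by (simp add: T_def)
  have nested: "(\<Sum>n<Suc M. \<Sum>I\<in>T n. wt I) = (\<Sum>I\<in>{I \<in> words N (M * q). cell I \<subseteq> G}. wt I)" for M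
  proof (induction M)
    case 0
    then show ?case by (simp add: T_def)
  next
    case (Suc M)
    let ?A = "\<lambda>M. {I \<in> words N (M * q). cell I \<subseteq> G}"
    let ?B = "(\<lambda>(u, v). u @ v) ` (?A M \<times> words N q)"
    have mono: "cell (take (k * q) I) \<subseteq> G" if "I \<in> words N (M * q)" "cell (take (i * q) I) \<subseteq> G" "i \<le> k" for i k I
    proof -
      have "take (k * q) I = take (i * q) I @ drop (i * q) (take (k * q) I)"
        using \<open>i \<le> k\<close> by (metis append_take_drop_id min.absorb1 mult_le_mono1 take_take)
      moreover have "drop (i * q) (take (k * q) I) \<in> words N (length (drop (i * q) (take (k * q) I)))"
        using that(1) by (auto simp: words_def dest!: in_set_takeD in_set_dropD)
      ultimately show ?thesis using cell_append_subset that(2) by (metis order_trans)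
    qed
    have eq: "?A (Suc M) = T (Suc M) \<union> ?B" and disj: "T (Suc M) \<inter> ?B = {}"
    proof -
      have split: "\<exists>u v. I = u @ v \<and> u \<in> words N (M * q) \<and> v \<in> words N q" if "I \<in> words N (Suc M * q)" for I
        using words_append_split[of I N "M * q" q] that by (metis mult_Suc add.commute)
      have B: "u @ v \<in> ?A (Suc M)" if "u \<in> ?A M" "v \<in> words N q" for u v
        using words_append[of u N "M * q" v q] cell_append_subset[OF that(2), of u] that
        by (auto simp: add.commute)
      show "T (Suc M) \<inter> ?B = {}"
      proof (intro equals0I)
        fix x assume x: "x \<in> T (Suc M) \<inter> ?B"
        then obtain a b where ab: "x = a @ b" "a \<in> words N (M * q)" "cell a \<subseteq> G" by auto
        have "\<not> cell (take (M * q) x) \<subseteq> G" using x unfolding T_def by blast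
        then show False using ab by (simp add: words_length)
      qed
      show "?A (Suc M) = T (Suc M) \<union> ?B"
      proof (intro equalityI subsetI)
        fix I assume I: "I \<in> ?A (Suc M)"
        then obtain u v where uv: "I = u @ v" "u \<in> words N (M * q)" "v \<in> words N q" using split by blast
        show "I \<in> T (Suc M) \<union> ?B"
        proof (cases "cell u \<subseteq> G")
          case True
          then have "I \<in> ?B" using uv by force
          then show ?thesis by blast
        next
          case False
          have "\<not> cell (take (k * q) I) \<subseteq> G" if "k < Suc M" for k
          proof
            assume "cell (take (k * q) I) \<subseteq> G"
            moreover have "take (k * q) I = take (k * q) u"
              using uv that by (simp add: words_length)
            ultimately have "cell (take (M * q) u) \<subseteq> G" using mono[OF uv(2), of k M] that by auto
            then show False using False uv(2) by (simp add: words_length)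
          qed
          then show ?thesis using I by (simp add: T_def)
        qed
      next
        fix I assume "I \<in> T (Suc M) \<union> ?B"
        then show "I \<in> ?A (Suc M)" using B by (auto simp: T_def)
      qed
    qed
    have "(\<Sum>I\<in>?A (Suc M). wt I) = (\<Sum>I\<in>T (Suc M). wt I) + (\<Sum>I\<in>?B. wt I)"
      unfolding eq using disj finT by (subst sum.union_disjoint) auto
    also have "(\<Sum>I\<in>?B. wt I) = (\<Sum>u\<in>?A M. \<Sum>v\<in>words N q. wt (u @ v))"
    proof -
      have inj: "inj_on (\<lambda>(u, v). u @ v) (?A M \<times> words N q)"
        by (rule inj_on_subset[OF inj_on_append_words[of N "M * q" q]]) auto
      show ?thesis unfolding sum.reindex[OF inj] by (simp add: sum.cartesian_product case_prod_unfold)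
    qed
    also have "\<dots> = (\<Sum>u\<in>?A M. wt u)" using sum_wt_append by (intro sum.cong) auto
    finally show ?case using Suc by simp
  qed
  have part: "(\<Sum>I\<in>{I \<in> words N (M * q). cell I \<subseteq> G}. ennreal (wt I)) \<le> emeasure lborel (preim G)" for M
  proof -
    let ?W = "{I \<in> words N (M * q). cell I \<subseteq> G}"
    have "(\<Sum>I\<in>?W. ennreal (wt I)) = ennreal (\<Sum>I\<in>?W. wt I)"
      by (rule sum_ennreal) (auto intro: wt_pos less_imp_le)
    also have "\<dots> = emeasure lborel (at_words M ?W)" by (rule emeasure_at_words[symmetric]) auto
    also have "\<dots> \<le> emeasure lborel (preim G)"
    proof (rule emeasure_mono)
      show "at_words M ?W \<subseteq> preim G"
        using psi_in_cell during_unit by (fastforce simp: at_words_def preim_def)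
      show "preim G \<in> sets lborel" using preim_measurable G by simp
    qed
    finally show ?thesis .
  qed
  have "hausdorff_measure s (G \<inter> K) \<le> hausdorff_measure s (\<Union>n. \<Union>I\<in>T n. cell I)"
    by (rule hausdorff_measure_mono[OF cover])
  also have "\<dots> \<le> (\<Sum>n. hausdorff_measure s (\<Union>I\<in>T n. cell I))"
    by (rule hausdorff_measure_countably_subadditive)
  also have "\<dots> \<le> (\<Sum>n. \<Sum>I\<in>T n. hausdorff_measure s K * ennreal (wt I))"
  proof (intro suminf_le)
    fix n
    have "hausdorff_measure s (\<Union>I\<in>T n. cell I) \<le> (\<Sum>I\<in>T n. hausdorff_measure s (cell I))"
      by (rule hausdorff_measure_UN_finite_le[OF finT])
    also have "\<dots> \<le> (\<Sum>I\<in>T n. hausdorff_measure s K * ennreal (wt I))"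
      using hausdorff_cell_le by (intro sum_mono) (auto simp: T_def mult.commute)
    finally show "hausdorff_measure s (\<Union>I\<in>T n. cell I) \<le> (\<Sum>I\<in>T n. hausdorff_measure s K * ennreal (wt I))" .
  qed auto
  also have "\<dots> \<le> hausdorff_measure s K * emeasure lborel (preim G)"
  proof (rule suminf_le_const)
    show "(\<Sum>n<M. \<Sum>I\<in>T n. hausdorff_measure s K * ennreal (wt I)) \<le> hausdorff_measure s K * emeasure lborel (preim G)" for M
    proof -
      have "(\<Sum>n<M. \<Sum>I\<in>T n. ennreal (wt I)) \<le> (\<Sum>n<Suc M. \<Sum>I\<in>T n. ennreal (wt I))"
        by (rule sum_mono2) auto
      also have "\<dots> = ennreal (\<Sum>n<Suc M. \<Sum>I\<in>T n. wt I)"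
      proof -
        have 1: "(\<Sum>I\<in>T n. ennreal (wt I)) = ennreal (\<Sum>I\<in>T n. wt I)" for n
          by (rule sum_ennreal) (auto simp: T_def intro: wt_pos less_imp_le)
        show ?thesis unfolding 1
          by (rule sum_ennreal) (auto simp: T_def intro!: sum_nonneg intro: wt_pos less_imp_le)
      qed
      also have "\<dots> = (\<Sum>I\<in>{I \<in> words N (M * q). cell I \<subseteq> G}. ennreal (wt I))"
        unfolding nested by (rule sum_ennreal[symmetric]) (auto intro: wt_pos less_imp_le)
      also have "\<dots> \<le> emeasure lborel (preim G)" by (rule part)
      finally show ?thesis by (simp add: sum_distrib_left[symmetric] mult_left_mono)
    qed
  qed simp
  finally show ?thesis .
qed

text \<open>
  Outer regularity extends the upper bound from open sets to Borel sets; since both sides agree on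
  \<open>K\<close>, passing to complements turns the bound into an equality.
\<close>

lemma hausdorff_borel_eq:
  assumes B: "B \<in> sets borel" "B \<subseteq> K"
  shows "hausdorff_measure s B = hausdorff_measure s K * emeasure lborel (preim B)"
proof -
  obtain c where c: "hausdorff_measure s K = ennreal c" "0 \<le> c"
    using hausdorff_K_finite by (cases "hausdorff_measure s K") auto
  have le: "hausdorff_measure s C \<le> ennreal c * emeasure lborel (preim C)"
    if C: "C \<in> sets borel" "C \<subseteq> K" for C
  proof (cases "c = 0")
    case True
    then show ?thesis using hausdorff_measure_mono[OF C(2), of s] c by simp
  next
    case False
    then have c0: "0 < ennreal c" using c(2) by simp
    have "hausdorff_measure s C / ennreal c \<le> emeasure occ C"
      unfolding outer_regular[OF occ(1) occ_finite C(1)]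
    proof (rule INF_greatest, rule divide_le_posI_ennreal[OF c0])
      fix G assume G: "G \<in> {G. C \<subseteq> G \<and> open G}"
      then have "hausdorff_measure s C \<le> hausdorff_measure s (G \<inter> K)"
        using C(2) by (intro hausdorff_measure_mono) auto
      also have "\<dots> \<le> ennreal c * emeasure occ G"
        using hausdorff_open_le[of G] G occ(2)[of G] c by simp
      finally show "hausdorff_measure s C \<le> ennreal c * emeasure occ G" .
    qed
    then have "ennreal c * (hausdorff_measure s C / ennreal c) \<le> ennreal c * emeasure occ C"
      by (rule mult_left_mono) auto
    then show ?thesis
      using c0 by (simp add: ennreal_times_divide mult.commute[of "ennreal _"] mult_divide_eq_ennreal occ(2)[OF C(1)])
  qed
  have Kb: "K \<in> sets borel" using K_compact by (simp add: borel_compact)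
  have "emeasure lborel (preim B) \<le> emeasure lborel {0..1::real}"
    by (rule emeasure_mono) (auto simp: preim_def)
  then obtain x where x: "emeasure lborel (preim B) = ennreal x" "0 \<le> x" "x \<le> 1"
    by (cases "emeasure lborel (preim B)") (auto simp: top_unique)
  have "preim (K - B) = {0..1} - preim B" using psi_in_K by (auto simp: preim_def)
  then have "emeasure lborel (preim (K - B)) = emeasure lborel {0..1::real} - emeasure lborel (preim B)"
    using preim_measurable[OF B(1)] x emeasure_Diff[of lborel "preim B" "{0..1}"]
    by (simp add: preim_def)
  also have "\<dots> = ennreal (1 - x)" using x by (simp add: ennreal_minus[symmetric] ennreal_1[symmetric] del: ennreal_1)
  finally have y: "emeasure lborel (preim (K - B)) = ennreal (1 - x)" .
  have HB: "hausdorff_measure s B \<le> ennreal (c * x)" using le[OF B] x c by (simp add: ennreal_mult)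
  then obtain h where h: "hausdorff_measure s B = ennreal h" "0 \<le> h"
    by (cases "hausdorff_measure s B") (auto simp: top_unique)
  have "ennreal c \<le> hausdorff_measure s B + hausdorff_measure s (K - B)"
    using hausdorff_measure_Un_le[of s B "K - B"] B(2) c by (simp add: Un_absorb1)
  also have "\<dots> \<le> ennreal h + ennreal c * ennreal (1 - x)"
    using le[of "K - B"] B Kb h y by (intro add_mono) auto
  also have "\<dots> = ennreal (h + c * (1 - x))" using c h x by (simp add: ennreal_mult)
  finally have "c \<le> h + c * (1 - x)" using h c x by (subst (asm) ennreal_le_iff) auto
  moreover have "h \<le> c * x" using HB h c x by (subst (asm) h(1), subst (asm) ennreal_le_iff) auto
  ultimately have "h = c * x" by (simp add: algebra_simps)
  then show ?thesis using h x c by (simp add: ennreal_mult)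
qed

section \<open>Almost injectivity\<close>

text \<open>
  The visits of the pieces of a cell last as long as the weight of the cell, and the Hausdorff
  measure of the cell leaves no room for more time.
\<close>

lemma time_outside_null:
  assumes osc: "open_set_condition N S" and I: "I \<in> words N (n * q)"
  shows "preim (cell I) - at_words n {I} \<in> null_sets lborel"
proof -
  obtain c where c: "hausdorff_measure s K = ennreal c" "0 < c"
    using hausdorff_K_finite hausdorff_K_positive[OF osc] by (cases "hausdorff_measure s K") auto
  have cb: "cell I \<in> sets borel" using cell_compact[OF I] by (simp add: borel_compact)
  have sub: "at_words n {I} \<subseteq> preim (cell I)"
    using psi_in_cell during_unit by (auto simp: at_words_def preim_def)
  have aw: "emeasure lborel (at_words n {I}) = ennreal (wt I)" using emeasure_at_words[of "{I}" n] I by simp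
  have "ennreal c * emeasure lborel (preim (cell I)) \<le> ennreal c * ennreal (wt I)"
    using hausdorff_borel_eq[OF cb cell_subset_K[OF I]] hausdorff_cell_le[OF I] c by (simp add: mult.commute)
  then have "emeasure lborel (preim (cell I)) \<le> ennreal (wt I)"
    using c by (simp add: ennreal_mult_le_mult_iff)
  moreover have "ennreal (wt I) \<le> emeasure lborel (preim (cell I))"
    using emeasure_mono[OF sub, of lborel] preim_measurable[OF cb] aw by simp
  ultimately have "emeasure lborel (preim (cell I) - at_words n {I}) = 0"
    using emeasure_Diff[of lborel "at_words n {I}" "preim (cell I)"] sub aw at_words_borel preim_measurable[OF cb]
    by simp
  then show ?thesis using at_words_borel preim_measurable[OF cb] by (intro null_setsI) auto
qed

text \<open>
  At almost every time, the curve is infinitely often in a cell owned by a single piece, and every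
  cell of each level that contains the current point is being visited. At such times the point
  determines the piece of every level, and hence the time.
\<close>

definition regular where
  "regular = {0..1} - (\<Union>n. \<Union>I\<in>words N (n * q). preim (cell I) - at_words n {I})
                   - (\<Union>n. \<Inter>i. at_words (n + 2 * i) (unowned n (2 * i)))"

lemma regular_full:
  assumes osc: "open_set_condition N S"
  shows "{0..1} - regular \<in> null_sets lborel"
proof -
  have 1: "(\<Union>n. \<Union>I\<in>words N (n * q). preim (cell I) - at_words n {I}) \<in> null_sets lborel"
  proof (rule null_sets_UN)
    show "(\<Union>I\<in>words N (n * q). preim (cell I) - at_words n {I}) \<in> null_sets lborel" for n
      by (rule null_sets_UN'[OF countable_finite[OF finite_words]]) (rule time_outside_null[OF osc])
  qed
  have 2: "(\<Inter>i. at_words (n + 2 * i) (unowned n (2 * i))) \<in> null_sets lborel" for n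
  proof (rule null_setsI)
    show "(\<Inter>i. at_words (n + 2 * i) (unowned n (2 * i))) \<in> sets lborel"
      using at_words_borel by (simp add: sets.countable_INT)
    have "emeasure lborel (\<Inter>i. at_words (n + 2 * i) (unowned n (2 * i))) \<le> ennreal ((1 - own_frac) ^ i)" for i
    proof -
      have "emeasure lborel (\<Inter>i. at_words (n + 2 * i) (unowned n (2 * i)))
          \<le> emeasure lborel (at_words (n + 2 * i) (unowned n (2 * i)))"
        by (rule emeasure_mono) (use at_words_borel in auto)
      also have "\<dots> = ennreal (\<Sum>w\<in>unowned n (2 * i). wt w)"
        by (rule emeasure_at_words) (auto simp: unowned_def)
      finally show ?thesis using unowned_le[of n i] by (meson ennreal_leI order_trans)
    qed
    moreover have "(\<lambda>i. ennreal ((1 - own_frac) ^ i)) \<longlonglongrightarrow> ennreal 0"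
      using own_frac by (intro tendsto_ennrealI LIMSEQ_power_zero) auto
    ultimately have "emeasure lborel (\<Inter>i. at_words (n + 2 * i) (unowned n (2 * i))) \<le> ennreal 0"
      by (intro LIMSEQ_le_const) auto
    then show "emeasure lborel (\<Inter>i. at_words (n + 2 * i) (unowned n (2 * i))) = 0" by simp
  qed
  have 3: "(\<Union>n. \<Inter>i. at_words (n + 2 * i) (unowned n (2 * i))) \<in> null_sets lborel"
    by (rule null_sets_UN) (rule 2)
  have "{0..1} - regular = {0..1} \<inter> ((\<Union>n. \<Union>I\<in>words N (n * q). preim (cell I) - at_words n {I})
            \<union> (\<Union>n. \<Inter>i. at_words (n + 2 * i) (unowned n (2 * i))))"
    unfolding regular_def by blast
  moreover have "\<dots> \<in> null_sets lborel"
    using 1 3 by (intro null_set_Int1 null_sets.Un) auto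
  ultimately show ?thesis by simp
qed

lemma regular_injective:
  assumes t: "t \<in> regular" and u: "u \<in> {0..1}" and eq: "psi t = psi u"
  shows "t = u"
proof -
  have t01: "t \<in> {0..1}" using t by (simp add: regular_def)
  have "\<bar>t - u\<bar> \<le> (rmax powr s) ^ (n * q)" for n
  proof -
    obtain i where i: "t \<notin> at_words (n + 2 * i) (unowned n (2 * i))"
      using t unfolding regular_def by blast
    let ?m = "n + 2 * i"
    obtain p' where p': "during ?m p' u" using during_ex[OF u] by blast
    have W: "wd p' \<in> words N (?m * q)" using p' by (auto dest: during_level wd_level)
    have "t \<in> preim (cell (wd p'))" using psi_in_cell[OF p'] eq t01 by (simp add: preim_def)
    moreover have "t \<notin> preim (cell (wd p')) - at_words ?m {wd p'}"
      using t W unfolding regular_def by blast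
    ultimately obtain p where p: "during ?m p t" "wd p = wd p'" by (auto simp: at_words_def)
    have "wd p' \<notin> unowned n (2 * i)" using i p by (auto simp: at_words_def)
    then obtain p0 where p0: "p0 \<in> set (lv n)" "wd p' \<in> owned n (2 * i) p0"
      using W by (auto simp: unowned_def)
    then have "p \<in> desc (2 * i) p0" "p' \<in> desc (2 * i) p0"
      using during_level[OF p(1)] during_level[OF p'] p(2) by (auto simp: owned_def)
    then have "during n p0 t" "during n p0 u" using during_ancestor[OF p0(1)] p(1) p' by auto
    moreover obtain a where "{t. during n p0 t} = {a..a + om n p0}" using during_interval[OF p0(1)] by auto
    ultimately have "\<bar>t - u\<bar> \<le> om n p0" by (auto simp: set_eq_iff abs_le_iff) 
    then show ?thesis using om_le_level[OF p0(1)] by simp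
  qed
  then have "\<bar>t - u\<bar> \<le> 0" by (intro LIMSEQ_le_const[OF level_weight_tendsto_0]) auto
  then show ?thesis by simp
qed

section \<open>The curve is an optimal parametrization\<close>

text \<open>
  The exponent \<open>s\<close> is the dimension because \<open>K\<close> has positive finite measure. For the images of Borel
  sets, injectivity at regular times identifies a set with the preimage of its image up to a null
  set, so that the statement about preimages applies.
\<close>

theorem space_filling_psi:
  assumes osc: "open_set_condition N S"
  shows "space_filling_curve K psi"
proof -
  obtain c where c: "hausdorff_measure s K = ennreal c" "0 < c"
    using hausdorff_K_finite hausdorff_K_positive[OF osc] by (cases "hausdorff_measure s K") auto
  have dim: "hausdorff_dim K = s"
    by (rule hausdorff_dim_eqI) (use s_pos c in auto)
  define C where "C = 2 * hoelder_const + 1"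
  have C: "0 < C" using hoelder_const_nonneg by (simp add: C_def)
  have hoelder: "dist (psi x) (psi y) \<le> C * \<bar>x - y\<bar> powr (1/s)" if "x \<in> {0..1}" "y \<in> {0..1}" for x y
  proof -
    have "2 * hoelder_const * \<bar>x - y\<bar> powr (1/s) \<le> C * \<bar>x - y\<bar> powr (1/s)"
      by (intro mult_right_mono) (auto simp: C_def)
    then show ?thesis using psi_hoelder[OF that] by linarith
  qed
  have null: "hausdorff_measure s (psi ` Z) = 0" if "Z \<in> null_sets lebesgue" "Z \<subseteq> {0..1}" for Z
    using s_pos C hoelder that by (rule hausdorff_null_Hoelder_image)
  have reg: "{0..1} - regular \<in> null_sets lebesgue"
    using regular_full[OF osc] by (rule null_sets_completionI)
  have reg01: "regular \<subseteq> {0..1}" by (auto simp: regular_def)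
  have inj: "bij_betw psi regular (psi ` regular)"
    unfolding bij_betw_def inj_on_def using regular_injective reg01 by blast
  have "K - psi ` regular \<subseteq> psi ` ({0..1} - regular)" using psi_onto by blast
  then have "hausdorff_measure s (K - psi ` regular) \<le> hausdorff_measure s (psi ` ({0..1} - regular))"
    by (rule hausdorff_measure_mono)
  then have K': "hausdorff_measure s (K - psi ` regular) = 0" using null[OF reg] by simp
  have pre: "emeasure lborel ({0..1} \<inter> psi -` B) = inverse (ennreal c) * hausdorff_measure s B"
    if B: "B \<in> sets borel" "B \<subseteq> K" for B
  proof -
    have "inverse (ennreal c) * (ennreal c * emeasure lborel (preim B)) = emeasure lborel (preim B)"
      using c by (simp add: mult.commute[of "inverse _"] divide_ennreal_def[symmetric] mult.commute[of "ennreal c"]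
          mult_divide_eq_ennreal)
    then show ?thesis using hausdorff_borel_eq[OF B] c by (simp add: preim_def)
  qed
  have img: "hausdorff_measure s (psi ` X) = ennreal c * emeasure lborel X"
    if X: "X \<in> sets borel" "X \<subseteq> {0..1}" for X
  proof -
    have cl: "hausdorff_measure s (psi ` Y) = ennreal c * emeasure lborel Y"
      if Y: "Y \<subseteq> {0..1}" "Y \<in> sets borel" "psi ` Y \<in> sets borel" for Y
    proof -
      have eq: "Y \<union> (preim (psi ` Y) - Y) = preim (psi ` Y)" using Y(1) by (auto simp: preim_def)
      have sub: "preim (psi ` Y) - Y \<subseteq> {0..1} - regular"
      proof
        fix t assume t: "t \<in> preim (psi ` Y) - Y"
        then obtain y where y: "y \<in> Y" "psi t = psi y" by (auto simp: preim_def)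
        have "t \<notin> regular" using regular_injective[of t y] y t Y(1) by blast
        then show "t \<in> {0..1} - regular" using t by (simp add: preim_def)
      qed
      have "preim (psi ` Y) - Y \<in> sets lborel"
        using preim_measurable[OF Y(3)] Y(2) by simp
      then have "preim (psi ` Y) - Y \<in> null_sets lborel"
        using sub by (rule null_sets_subset[OF regular_full[OF osc]])
      then have "emeasure lborel (Y \<union> (preim (psi ` Y) - Y)) = emeasure lborel Y"
        using Y(2) by (intro emeasure_Un_null_set) simp_all
      then have "emeasure lborel (preim (psi ` Y)) = emeasure lborel Y" by (simp only: eq)
      moreover have "psi ` Y \<subseteq> K" using Y(1) psi_onto by blast
      ultimately show ?thesis using hausdorff_borel_eq[OF Y(3)] c by simp
    qed
    \<comment> \<open>Up to a null set, \<open>X\<close> is a countable union of compact sets, whose image is Borel.\<close>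
    have "\<exists>F. closed F \<and> F \<subseteq> X \<and> emeasure lebesgue (X - F) < ennreal (1 / Suc n)" for n
    proof -
      have "X \<in> sets lebesgue" using X(1) by simp
      then obtain F where "closed F" "F \<subseteq> X" "X - F \<in> lmeasurable" "emeasure lebesgue (X - F) < ennreal (1 / Suc n)"
        by (rule sets_lebesgue_inner_closed[of X "1 / Suc n"]) auto
      then show ?thesis by blast
    qed
    then obtain F where F: "\<And>n. closed (F n)" "\<And>n. F n \<subseteq> X" "\<And>n. emeasure lebesgue (X - F n) < ennreal (1 / Suc n)"
      by metis
    define Y where "Y = (\<Union>n. F n)"
    have Yb: "Y \<in> sets borel" "Y \<subseteq> X" using F(1,2) by (auto simp: Y_def)
    have "compact (F n)" for n
    proof -
      have "compact ({0..1} \<inter> F n)" by (intro compact_Int_closed F(1)) simp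
      moreover have "{0..1} \<inter> F n = F n" using F(2) X(2) by blast
      ultimately show ?thesis by simp
    qed
    then have "compact (psi ` F n)" for n
      using F(2) X(2) by (intro compact_continuous_image continuous_on_subset[OF continuous_on_psi]) auto
    then have psiY: "psi ` Y \<in> sets borel"
      unfolding Y_def image_UN by (intro sets.countable_UN) (auto simp: borel_compact)
    have "emeasure lborel (X - Y) \<le> ennreal (1 / Suc n)" for n
    proof -
      have "emeasure lborel (X - Y) \<le> emeasure lborel (X - F n)"
        by (rule emeasure_mono) (use X(1) F(1) in \<open>auto simp: Y_def\<close>)
      also have "\<dots> = emeasure lebesgue (X - F n)" using X(1) F(1) by simp
      finally show ?thesis using F(3)[of n] by simp
    qed
    moreover have "(\<lambda>n. ennreal (1 / Suc n)) \<longlonglongrightarrow> ennreal 0"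
      by (intro tendsto_ennrealI) (use LIMSEQ_inverse_real_of_nat in \<open>simp add: inverse_eq_divide\<close>)
    ultimately have "emeasure lborel (X - Y) \<le> ennreal 0" by (intro LIMSEQ_le_const) auto
    then have Z: "X - Y \<in> null_sets lborel" using X(1) Yb(1) by (intro null_setsI) auto
    have XY: "Y \<union> (X - Y) = X" using Yb(2) by blast
    have "emeasure lborel (Y \<union> (X - Y)) = emeasure lborel Y"
      using Z Yb(1) by (intro emeasure_Un_null_set) auto
    then have LX: "emeasure lborel X = emeasure lborel Y" by (simp only: XY)
    have "hausdorff_measure s (psi ` X) \<le> hausdorff_measure s (psi ` Y) + hausdorff_measure s (psi ` (X - Y))"
      using hausdorff_measure_Un_le[of s "psi ` Y" "psi ` (X - Y)"] by (simp only: image_Un[symmetric] XY)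
    also have "hausdorff_measure s (psi ` (X - Y)) = 0"
      using null[OF null_sets_completionI[OF Z]] X(2) by auto
    finally have "hausdorff_measure s (psi ` X) \<le> hausdorff_measure s (psi ` Y)" by simp
    moreover have "hausdorff_measure s (psi ` Y) \<le> hausdorff_measure s (psi ` X)"
      using Yb(2) by (intro hausdorff_measure_mono) auto
    ultimately have "hausdorff_measure s (psi ` X) = hausdorff_measure s (psi ` Y)" by simp
    then show ?thesis using cl[of Y] Yb psiY X(2) LX by auto
  qed
  show ?thesis
    unfolding space_filling_curve_def Let_def dim c(1)
  proof (intro conjI)
    show "psi ` {0..1} = K" by (rule psi_onto)
    show "\<exists>K' I'. K' \<subseteq> K \<and> hausdorff_measure s (K - K') = 0 \<and> I' \<subseteq> {0..1} \<and>
        {0..1} - I' \<in> null_sets lebesgue \<and> bij_betw psi I' K'"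
      using K' reg01 reg inj psi_onto by (intro exI[of _ "psi ` regular"] exI[of _ regular]) blast
    show "\<forall>X\<in>sets borel. X \<subseteq> {0..1} \<longrightarrow> hausdorff_measure s (psi ` X) = ennreal c * emeasure lborel X"
      using img by blast
    show "\<forall>B\<in>sets borel. B \<subseteq> K \<longrightarrow>
        emeasure lborel ({0..1} \<inter> psi -` B) = inverse (ennreal c) * hausdorff_measure s B"
      using pre by blast
    show "\<exists>c'>0. \<forall>x\<in>{0..1}. \<forall>y\<in>{0..1}. dist (psi x) (psi y) \<le> c' * \<bar>x - y\<bar> powr (1/s)"
      using C hoelder by blast
  qed
qed

end

section \<open>Finite skeletons\<close>

text \<open>
  Connectedness of a graph in its cut form: every nonempty proper set of vertices is joined to its
  complement.
\<close>

definition conn :: "('v \<Rightarrow> 'v \<Rightarrow> bool) \<Rightarrow> 'v set \<Rightarrow> bool" where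
  "conn R X \<longleftrightarrow> (\<forall>P. P \<subseteq> X \<and> P \<noteq> {} \<and> P \<noteq> X \<longrightarrow> (\<exists>x\<in>P. \<exists>y\<in>X - P. R x y))"

lemma connD: "\<lbrakk>conn R X; P \<subseteq> X; P \<noteq> {}; P \<noteq> X\<rbrakk> \<Longrightarrow> \<exists>x\<in>P. \<exists>y\<in>X - P. R x y"
  unfolding conn_def by blast

context similitude_system
begin

definition adj where "adj A I J \<longleftrightarrow> word_map S I ` A \<inter> word_map S J ` A \<noteq> {}"

lemma adj_sym: "adj A I J \<longleftrightarrow> adj A J I"
  by (auto simp: adj_def)

lemma adj_append: "adj A I J \<Longrightarrow> adj A (w @ I) (w @ J)"
  unfolding adj_def word_map_append image_comp[symmetric] by blast

text \<open>
  Two cells may touch in a complicated set. A skeleton is a finite set of marked points that witness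
  enough of these contacts, and whose images under the words do so on all levels.
\<close>

definition skeleton where
  "skeleton A \<longleftrightarrow> finite A \<and> A \<noteq> {} \<and> A \<subseteq> K \<and> A \<subseteq> (\<Union>j\<in>{1..N}. S j ` A) \<and> conn (adj A) (words N 1)"

lemma skeleton_cover:
  assumes "skeleton A"
  shows "A \<subseteq> (\<Union>I\<in>words N n. word_map S I ` A)"
proof (induction n)
  case (Suc n)
  show ?case
  proof
    fix a assume a: "a \<in> A"
    then obtain I b where I: "I \<in> words N n" "b \<in> A" "a = word_map S I b" using Suc by blast
    obtain j c where j: "j \<in> {1..N}" "c \<in> A" "b = S j c" using I(2) assms unfolding skeleton_def by blast
    have "I @ [j] \<in> words N (Suc n)" using I j by (auto simp: words_def)
    moreover have "a = word_map S (I @ [j]) c" using I j by (simp add: word_map_append)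
    ultimately show "a \<in> (\<Union>I\<in>words N (Suc n). word_map S I ` A)" using j(2) by blast
  qed
qed simp

text \<open>
  A common point of two cells is refined to a common point of two subcells, because every point of
  the skeleton lies in the image of the skeleton under some word.
\<close>

lemma adj_refine:
  assumes "skeleton A" "adj A I J"
  shows "\<exists>u\<in>words N n. \<exists>v\<in>words N n. adj A (I @ u) (J @ v)"
proof -
  obtain a b where ab: "a \<in> A" "b \<in> A" "word_map S I a = word_map S J b"
    using assms(2) by (auto simp: adj_def)
  obtain u a' where u: "u \<in> words N n" "a' \<in> A" "a = word_map S u a'" using skeleton_cover[OF assms(1), of n] ab(1) by blast
  obtain v b' where v: "v \<in> words N n" "b' \<in> A" "b = word_map S v b'" using skeleton_cover[OF assms(1), of n] ab(2) by blast
  have "word_map S (I @ u) a' = word_map S (J @ v) b'" using ab u v by (simp add: word_map_append)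
  then have "adj A (I @ u) (J @ v)" unfolding adj_def using u(2) v(2) by blast
  then show ?thesis using u(1) v(1) by blast
qed

text \<open>
  A cut either splits some cell, and is then crossed inside this cell, or it consists of whole cells,
  and is then crossed by a refinement of an edge between two of them.
\<close>

lemma conn_words_add:
  assumes A: "skeleton A" and m: "conn (adj A) (words N m)" and n: "conn (adj A) (words N n)"
  shows "conn (adj A) (words N (m + n))"
  unfolding conn_def
proof (intro allI impI)
  fix P assume P: "P \<subseteq> words N (m + n) \<and> P \<noteq> {} \<and> P \<noteq> words N (m + n)"
  show "\<exists>x\<in>P. \<exists>y\<in>words N (m + n) - P. adj A x y"
  proof (cases "\<exists>u\<in>words N m. {v \<in> words N n. u @ v \<in> P} \<noteq> {} \<and> {v \<in> words N n. u @ v \<in> P} \<noteq> words N n")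
    case True
    then obtain u where u: "u \<in> words N m" "{v \<in> words N n. u @ v \<in> P} \<noteq> {}"
      "{v \<in> words N n. u @ v \<in> P} \<noteq> words N n" by blast
    obtain v v' where v: "v \<in> words N n" "u @ v \<in> P" "v' \<in> words N n" "u @ v' \<notin> P" "adj A v v'"
      using connD[OF n _ u(2,3)] by blast
    have "u @ v' \<in> words N (m + n) - P" using words_append[OF u(1) v(3)] v(4) by blast
    then show ?thesis using adj_append[OF v(5), of u] v(2) by blast
  next
    case False
    then have all: "u @ v \<in> P \<Longrightarrow> u @ v' \<in> P" if "u \<in> words N m" "v \<in> words N n" "v' \<in> words N n" for u v v'
      using that by blast
    define Q where "Q = {u \<in> words N m. \<exists>v\<in>words N n. u @ v \<in> P}"
    have ne: "Q \<noteq> {}"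
    proof -
      obtain w where w: "w \<in> P" "w \<in> words N (m + n)" using P by blast
      obtain u v where "w = u @ v" "u \<in> words N m" "v \<in> words N n" using w(2) by (rule words_append_split)
      then show ?thesis using w(1) unfolding Q_def by blast
    qed
    have "Q \<noteq> words N m"
    proof
      assume Q: "Q = words N m"
      have "words N (m + n) \<subseteq> P"
      proof
        fix w assume "w \<in> words N (m + n)"
        then obtain u v where uv: "w = u @ v" "u \<in> words N m" "v \<in> words N n" by (rule words_append_split)
        then have "u \<in> Q" using Q by simp
        then obtain v' where "v' \<in> words N n" "u @ v' \<in> P" by (auto simp: Q_def)
        then show "w \<in> P" using all[OF uv(2) _ uv(3)] uv(1) by blast
      qed
      then show False using P by blast
    qed
    then obtain u u' where u: "u \<in> Q" "u' \<in> words N m" "u' \<notin> Q" "adj A u u'"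
      using connD[OF m _ ne] unfolding Q_def by blast
    obtain v v' where v: "v \<in> words N n" "v' \<in> words N n" "adj A (u @ v) (u' @ v')"
      using adj_refine[OF A u(4)] by blast
    have "u @ v \<in> P" using u(1) all v(1) by (auto simp: Q_def)
    moreover have "u' @ v' \<in> words N (m + n) - P"
      using u(2,3) v(2) words_append[OF u(2) v(2)] by (auto simp: Q_def)
    ultimately show ?thesis using v(3) by blast
  qed
qed

lemma conn_words: "skeleton A \<Longrightarrow> conn (adj A) (words N n)"
proof (induction n)
  case 0
  then show ?case by (auto simp: conn_def)
next
  case (Suc n)
  then show ?case using conn_words_add[of A 1 n] by (simp add: skeleton_def)
qed

section \<open>Finite type yields a skeleton\<close>

abbreviation "NM \<equiv> neighbour_maps N S r K"

definition unit_vec :: 'a where "unit_vec = (SOME b. b \<in> Basis)"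

lemma unit_vec: "dist 0 unit_vec = 1"
  using some_in_eq[of Basis] by (simp add: unit_vec_def dist_norm)

lemma norm_unit_vec [simp]: "norm unit_vec = 1"
  using unit_vec by simp

definition lam :: "('a \<Rightarrow> 'a) \<Rightarrow> real" where "lam f = dist (f 0) (f unit_vec)"

lemma neighbour_map_dist:
  assumes "f \<in> NM"
  shows "dist (f x) (f y) = lam f * dist x y" "0 < lam f"
proof -
  obtain I J where IJ: "f = inv (word_map S I) \<circ> word_map S J" "set I \<subseteq> {1..N}" "set J \<subseteq> {1..N}"
    using assms by (auto simp: neighbour_maps_def)
  have W: "I \<in> words N (length I)" "J \<in> words N (length J)" using IJ by (auto simp: words_def)
  have f: "word_map S I (f x) = word_map S J x" for x
    using word_map_surj[OF W(1)] by (simp add: IJ(1) surj_f_inv_f)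
  have d: "dist (f x) (f y) = word_ratio r J / word_ratio r I * dist x y" for x y
    using word_map_dist[OF W(1), of "f x" "f y"] word_map_dist[OF W(2), of x y] f word_ratio_pos[OF W(1)]
    by (simp add: field_simps)
  have "lam f = word_ratio r J / word_ratio r I" by (simp add: lam_def d unit_vec)
  then show "dist (f x) (f y) = lam f * dist x y" "0 < lam f"
    using d word_ratio_pos[OF W(1)] word_ratio_pos[OF W(2)] by auto
qed

lemma neighbour_map_inj: "f \<in> NM \<Longrightarrow> inj f"
proof (rule injI)
  fix x y assume "f \<in> NM" "f x = f y"
  then have "lam f * dist x y = 0" "0 < lam f" using neighbour_map_dist(1)[of f x y] neighbour_map_dist(2)[of f] by auto
  then show "x = y" by simp
qed

lemma neighbour_map_continuous: "f \<in> NM \<Longrightarrow> continuous_on X f"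
proof (rule continuous_on_subset[of UNIV])
  assume f: "f \<in> NM"
  have "(lam f)-lipschitz_on UNIV f"
    by (rule lipschitz_onI) (use neighbour_map_dist[OF f] in \<open>auto intro: less_imp_le\<close>)
  then show "continuous_on UNIV f" by (rule lipschitz_on_continuous_on)
qed auto

lemma neighbour_map_meets: "f \<in> NM \<Longrightarrow> K \<inter> f ` K \<noteq> {}"
proof -
  assume "f \<in> NM"
  then obtain I J where IJ: "f = inv (word_map S I) \<circ> word_map S J" "set I \<subseteq> {1..N}"
    "word_map S I ` K \<inter> word_map S J ` K \<noteq> {}"
    by (auto simp: neighbour_maps_def)
  have W: "I \<in> words N (length I)" using IJ by (auto simp: words_def)
  obtain k k' where k: "k \<in> K" "k' \<in> K" "word_map S I k = word_map S J k'" using IJ(3) by blast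
  then have "k = f k'" using word_map_inj[OF W] by (simp add: IJ(1)) (metis inv_f_f)
  then show ?thesis using k by blast
qed

lemma K_cases: "x \<in> K \<Longrightarrow> \<exists>i\<in>{1..N}. \<exists>y\<in>K. x = S i y"
  by (subst (asm) K_eq) blast

lemma K_step: "i \<in> {1..N} \<Longrightarrow> y \<in> K \<Longrightarrow> S i y \<in> K"
  by (subst K_eq) blast

text \<open>
  Two neighbouring cells contain two neighbouring subcells. Subdividing only the larger of the two
  cells keeps the ratio of their sizes within the bounds of the definition.
\<close>

lemma neighbour_map_child:
  assumes "f \<in> NM"
  shows "\<exists>g\<in>NM. (\<exists>i\<in>{1..N}. f = S i \<circ> g \<and> lam f \<le> 1) \<or> (\<exists>j\<in>{1..N}. g = f \<circ> S j \<and> 1 < lam f)"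
proof -
  obtain I J where IJ: "f = inv (word_map S I) \<circ> word_map S J" "I \<noteq> []" "J \<noteq> []"
      "set I \<subseteq> {1..N}" "set J \<subseteq> {1..N}" "\<not> prefix I J" "\<not> prefix J I"
      "rmin \<le> word_ratio r I / word_ratio r J" "word_ratio r I / word_ratio r J \<le> inverse rmin"
      "word_map S I ` K \<inter> word_map S J ` K \<noteq> {}"
    using assms by (auto simp: neighbour_maps_def rmin_def)
  have W: "I \<in> words N (length I)" "J \<in> words N (length J)" using IJ by (auto simp: words_def)
  have f: "word_map S I (f x) = word_map S J x" for x
    using word_map_surj[OF W(1)] by (simp add: IJ(1) surj_f_inv_f)
  have lam: "lam f = word_ratio r J / word_ratio r I"
    using word_map_dist[OF W(1), of "f 0" "f unit_vec"] word_map_dist[OF W(2), of 0 unit_vec] f word_ratio_pos[OF W(1)]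
    by (simp add: lam_def unit_vec field_simps)
  define \<rho> where "\<rho> = word_ratio r I / word_ratio r J"
  have \<rho>: "0 < \<rho>" "lam f = 1 / \<rho>"
    using word_ratio_pos[OF W(1)] word_ratio_pos[OF W(2)] by (auto simp: \<rho>_def lam)
  obtain x k where x: "x \<in> K" "k \<in> K" "word_map S I x = word_map S J k" using IJ(10) by blast
  show ?thesis
  proof (cases "lam f \<le> 1")
    case True
    then have \<rho>1: "1 \<le> \<rho>" using \<rho> by (simp add: field_simps)
    obtain i x' where i: "i \<in> {1..N}" "x' \<in> K" "x = S i x'" using K_cases[OF x(1)] by blast
    define g where "g = inv (word_map S (I @ [i])) \<circ> word_map S J"
    have Wi: "I @ [i] \<in> words N (length I + 1)" using IJ(4) i(1) by (auto simp: words_def)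
    have "word_map S I (S i (g y)) = word_map S J y" for y
    proof -
      have "word_map S (I @ [i]) (g y) = word_map S J y"
        using word_map_surj[OF Wi] by (simp add: g_def surj_f_inv_f)
      then show ?thesis by (simp add: word_map_append)
    qed
    then have "word_map S I (S i (g y)) = word_map S I (f y)" for y using f by simp
    then have fg': "S i (g y) = f y" for y by (rule injD[OF word_map_inj[OF W(1)]])
    have fg: "f = S i \<circ> g" by (rule ext) (simp add: fg')
    have "g \<in> NM"
      unfolding neighbour_maps_def mem_Collect_eq
    proof (intro exI conjI)
      show "g = inv (word_map S (I @ [i])) \<circ> word_map S J" by (simp add: g_def)
      show "\<not> prefix (I @ [i]) J" using IJ(6) by (meson append_prefixD)
      show "\<not> prefix J (I @ [i])" using IJ(6,7) by (auto simp: prefix_snoc)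
      have r: "word_ratio r (I @ [i]) / word_ratio r J = \<rho> * r i" by (simp add: \<rho>_def)
      have "1 * r i \<le> \<rho> * r i" using \<rho>1 ratio_bounds(1)[OF i(1)] by (intro mult_right_mono) auto
      then show "ratio_min N r \<le> word_ratio r (I @ [i]) / word_ratio r J"
        unfolding r using rmin_le[OF i(1)] by (simp add: rmin_def)
      have "\<rho> * r i \<le> \<rho> * 1" using ratio_bounds(2)[OF i(1)] \<rho>(1) by (intro mult_left_mono) auto
      then show "word_ratio r (I @ [i]) / word_ratio r J \<le> inverse (ratio_min N r)"
        unfolding r using IJ(9) by (simp add: \<rho>_def rmin_def)
      have "word_map S (I @ [i]) x' = word_map S J k" using x i by (simp add: word_map_append)
      then show "word_map S (I @ [i]) ` K \<inter> word_map S J ` K \<noteq> {}" using i(2) x(2) by blast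
    qed (use IJ i in auto)
    then show ?thesis using fg i(1) True by blast
  next
    case False
    then have \<rho>1: "\<rho> < 1" using \<rho> by (simp add: field_simps)
    obtain j k' where j: "j \<in> {1..N}" "k' \<in> K" "k = S j k'" using K_cases[OF x(2)] by blast
    define g where "g = f \<circ> S j"
    have "g \<in> NM"
      unfolding neighbour_maps_def mem_Collect_eq
    proof (intro exI conjI)
      show "g = inv (word_map S I) \<circ> word_map S (J @ [j])" by (simp add: g_def IJ(1) word_map_append o_assoc)
      show "\<not> prefix (J @ [j]) I" using IJ(7) by (meson append_prefixD)
      show "\<not> prefix I (J @ [j])" using IJ(6,7) by (auto simp: prefix_snoc)
      have r: "word_ratio r I / word_ratio r (J @ [j]) = \<rho> / r j" by (simp add: \<rho>_def)
      have "\<rho> * r j \<le> \<rho>" using ratio_bounds[OF j(1)] \<rho>(1) by (simp add: mult_left_le)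
      then have "\<rho> \<le> \<rho> / r j" using ratio_bounds(1)[OF j(1)] by (simp add: pos_le_divide_eq)
      then show "ratio_min N r \<le> word_ratio r I / word_ratio r (J @ [j])"
        unfolding r using IJ(8) by (simp add: \<rho>_def rmin_def)
      have "\<rho> / r j \<le> 1 / r j" using \<rho>1 ratio_bounds(1)[OF j(1)] by (intro divide_right_mono) auto
      also have "\<dots> \<le> inverse rmin" using rmin_le[OF j(1)] rmin_pos by (simp add: inverse_eq_divide frac_le)
      finally show "word_ratio r I / word_ratio r (J @ [j]) \<le> inverse (ratio_min N r)"
        unfolding r by (simp add: rmin_def)
      have "word_map S I x = word_map S (J @ [j]) k'" using x j by (simp add: word_map_append)
      then show "word_map S I ` K \<inter> word_map S (J @ [j]) ` K \<noteq> {}" using j(2) x(1) by blast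
    qed (use IJ j in auto)
    moreover have "\<exists>j\<in>{1..N}. g = f \<circ> S j \<and> 1 < lam f" using j(1) False by (auto simp: g_def)
    ultimately show ?thesis by blast
  qed
qed

lemma K_connected_cells:
  assumes "connected K" "P \<subseteq> {1..N}" "P \<noteq> {}" "P \<noteq> {1..N}"
  shows "\<exists>i\<in>P. \<exists>j\<in>{1..N} - P. S i ` K \<inter> S j ` K \<noteq> {}"
proof (rule ccontr)
  assume neg: "\<not> ?thesis"
  let ?A = "\<Union>i\<in>P. S i ` K" and ?B = "\<Union>j\<in>{1..N} - P. S j ` K"
  have cl: "closed (S i ` K)" if "i \<in> {1..N}" for i
    using cell_compact[of "[i]" 1] that by (auto simp: cell_def words_def intro: compact_imp_closed)
  have "closed ?A" "closed ?B"
    using assms(2) cl by (auto intro!: closed_UN finite_subset[OF assms(2)])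
  moreover have "?A \<inter> ?B \<inter> K = {}" using neg by blast
  moreover have "K \<subseteq> ?A \<union> ?B"
  proof
    fix x assume "x \<in> K"
    from K_cases[OF this] show "x \<in> ?A \<union> ?B" by fast
  qed
  ultimately have "?A \<inter> K = {} \<or> ?B \<inter> K = {}" using assms(1) by (intro connected_closedD) simp_all
  moreover have "?A \<subseteq> K" "?B \<subseteq> K" using K_step assms(2) by fast+
  moreover have "?A \<noteq> {}" "?B \<noteq> {}"
  proof -
    have "\<exists>x. x \<in> {1..N} - P" using assms(2,4) by blast
    then show "?A \<noteq> {}" "?B \<noteq> {}" using assms(3) K_ne by auto
  qed
  ultimately show False by (metis Int_absorb2)
qed

text \<open>
  Following a fixed choice of subcells from each neighbour map \<open>f\<close> leads to a point \<open>z f\<close> common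
  to \<open>K\<close> and \<open>f ` K\<close>. Since there are finitely many neighbour maps, all these points together form
  a finite set, and by construction each of them is the image of another one under some \<open>S j\<close>.
\<close>

lemma finite_type_skeleton:
  assumes ft: "finite_type N S r K" and con: "connected K"
  shows "\<exists>A. skeleton A"
proof -
  define Q where "Q f g lt rt \<longleftrightarrow> g \<in> NM \<and> lt \<in> words N (length lt) \<and> rt \<in> words N (length rt) \<and>
      word_map S lt \<circ> g = f \<circ> word_map S rt \<and>
      (length lt = 1 \<and> rt = [] \<and> lam f \<le> 1 \<or> lt = [] \<and> length rt = 1 \<and> 1 < lam f)" for f g lt rt
  have "\<forall>f\<in>NM. \<exists>g lt rt. Q f g lt rt"
  proof
    fix f assume "f \<in> NM"
    then obtain g where g: "g \<in> NM"
      "(\<exists>i\<in>{1..N}. f = S i \<circ> g \<and> lam f \<le> 1) \<or> (\<exists>j\<in>{1..N}. g = f \<circ> S j \<and> 1 < lam f)"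
      using neighbour_map_child by blast
    from g(2) show "\<exists>g lt rt. Q f g lt rt"
    proof
      assume "\<exists>i\<in>{1..N}. f = S i \<circ> g \<and> lam f \<le> 1"
      then obtain i where "i \<in> {1..N}" "f = S i \<circ> g" "lam f \<le> 1" by blast
      then show ?thesis using g(1) by (intro exI[of _ g] exI[of _ "[i]"] exI[of _ "[]"]) (auto simp: words_def Q_def)
    next
      assume "\<exists>j\<in>{1..N}. g = f \<circ> S j \<and> 1 < lam f"
      then obtain j where "j \<in> {1..N}" "g = f \<circ> S j" "1 < lam f" by blast
      then show ?thesis using g(1) by (intro exI[of _ g] exI[of _ "[]"] exI[of _ "[j]"]) (auto simp: words_def Q_def)
    qed
  qed
  then obtain ch lt rt where chs: "\<And>f. f \<in> NM \<Longrightarrow> Q f (ch f) (lt f) (rt f)" by metis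
  have step: "ch f \<in> NM" "lt f \<in> words N (length (lt f))" "rt f \<in> words N (length (rt f))"
      "word_map S (lt f) (ch f x) = f (word_map S (rt f) x)"
      "length (lt f) = 1 \<and> rt f = [] \<and> lam f \<le> 1 \<or> lt f = [] \<and> length (rt f) = 1 \<and> 1 < lam f"
    if "f \<in> NM" for f x
    using chs[OF that] by (auto simp: fun_eq_iff Q_def)
  have chn: "(ch ^^ n) f \<in> NM" if "f \<in> NM" for f n
    using that step(1) by (induction n) auto
  define u where "u n f = concat (map (\<lambda>k. lt ((ch ^^ k) f)) [0..<n])" for n f
  define v where "v n f = concat (map (\<lambda>k. rt ((ch ^^ k) f)) [0..<n])" for n f
  have u_Suc: "u (Suc n) f = lt f @ u n (ch f)" and v_Suc: "v (Suc n) f = rt f @ v n (ch f)" for n f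
    unfolding u_def v_def by (simp_all only: upt_conv_Cons zero_less_Suc map_Suc_upt[symmetric] list.map map_map o_def concat.simps funpow_swap1 funpow_Suc_right funpow.simps id_apply comp_apply)
  have u_add: "u (m + n) f = u m f @ u n ((ch ^^ m) f)" and v_add: "v (m + n) f = v m f @ v n ((ch ^^ m) f)" for m n f
  proof -
    show "u (m + n) f = u m f @ u n ((ch ^^ m) f)"
      by (induction m arbitrary: f) (simp_all add: u_Suc funpow_swap1, simp add: u_def)
    show "v (m + n) f = v m f @ v n ((ch ^^ m) f)"
      by (induction m arbitrary: f) (simp_all add: v_Suc funpow_swap1, simp add: v_def)
  qed
  have uw: "u n f \<in> words N (length (u n f))" "v n f \<in> words N (length (v n f))" if "f \<in> NM" for n f
    using step(2)[OF chn[OF that]] step(3)[OF chn[OF that]] by (fastforce simp: u_def v_def words_def)+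
  have comm: "word_map S (u n f) ((ch ^^ n) f x) = f (word_map S (v n f) x)" if "f \<in> NM" for n f x
    using that
  proof (induction n arbitrary: f)
    case (Suc n)
    then show ?case using step(1,4)[OF Suc.prems] by (simp add: u_Suc v_Suc word_map_append funpow_swap1)
  qed (simp add: u_def v_def)
  have lam_rt: "lam (ch f) = lam f * word_ratio r (rt f) / word_ratio r (lt f)" if f: "f \<in> NM" for f
  proof -
    have "word_ratio r (lt f) * dist (ch f 0) (ch f unit_vec)
        = dist (f (word_map S (rt f) 0)) (f (word_map S (rt f) unit_vec))"
      using word_map_dist[OF step(2)[OF f]] step(4)[OF f] by metis
    also have "\<dots> = lam f * word_ratio r (rt f)"
      using neighbour_map_dist[OF f] word_map_dist[OF step(3)[OF f]] by (simp add: unit_vec)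
    finally show ?thesis using word_ratio_pos[OF step(2)[OF f]] by (simp add: lam_def[of "ch f"] field_simps)
  qed
  \<comment> \<open>Subdividing one and the same cell over and over would change the ratio without bound.\<close>
  have u_grows: "\<exists>n. u n f \<noteq> []" if f: "f \<in> NM" for f
  proof (rule ccontr)
    assume "\<nexists>n. u n f \<noteq> []"
    then have "u (Suc n) f = []" for n by blast
    then have L: "lt ((ch ^^ n) f) = []" for n by (simp add: u_def)
    have "lam ((ch ^^ n) f) \<le> lam f * rmax ^ n" for n
    proof (induction n)
      case (Suc n)
      let ?g = "(ch ^^ n) f"
      have g: "?g \<in> NM" by (rule chn[OF f])
      have "lam (ch ?g) = lam ?g * word_ratio r (rt ?g)" using lam_rt[OF g] L by simp
      also have "\<dots> \<le> (lam f * rmax ^ n) * rmax"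
        using word_ratio_le[OF step(3)[OF g]] step(5)[OF g] L[of n] Suc word_ratio_pos[OF step(3)[OF g]]
          neighbour_map_dist(2)[OF g] neighbour_map_dist(2)[OF f] rmax_pos
        by (intro mult_mono) (auto intro: less_imp_le)
      finally show ?case by (simp add: mult_ac)
    qed simp
    moreover have "1 < lam ((ch ^^ n) f)" for n using step(5)[OF chn[OF f, of n]] L[of n] by auto
    moreover have "(\<lambda>n. lam f * rmax ^ n) \<longlonglongrightarrow> 0" using rmax_power_tendsto_0 by (rule tendsto_mult_right_zero)
    then have "eventually (\<lambda>n. lam f * rmax ^ n < 1) sequentially" by (rule order_tendstoD) simp
    then obtain n where "lam f * rmax ^ n < 1" by (auto simp: eventually_sequentially)
    ultimately show False by (meson less_asym less_le_trans)
  qed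
  have v_grows: "\<exists>n. v n f \<noteq> []" if f: "f \<in> NM" for f
  proof (rule ccontr)
    assume "\<nexists>n. v n f \<noteq> []"
    then have "v (Suc n) f = []" for n by blast
    then have R: "rt ((ch ^^ n) f) = []" for n by (simp add: v_def)
    have lamn: "lam f \<le> lam ((ch ^^ n) f) * rmax ^ n" for n
    proof (induction n)
      case (Suc n)
      let ?g = "(ch ^^ n) f"
      have g: "?g \<in> NM" by (rule chn[OF f])
      have "lam ?g = lam (ch ?g) * word_ratio r (lt ?g)"
        using lam_rt[OF g] R word_ratio_pos[OF step(2)[OF g]] by simp
      also have "\<dots> \<le> lam (ch ?g) * rmax"
        using word_ratio_le[OF step(2)[OF g]] step(5)[OF g] R[of n] neighbour_map_dist(2)[OF step(1)[OF g]]
        by (intro mult_left_mono) (auto intro: less_imp_le)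
      finally have "lam ?g * rmax ^ n \<le> lam (ch ?g) * rmax * rmax ^ n"
        using rmax_pos by (intro mult_right_mono) auto
      then show ?case using Suc by (simp add: mult_ac)
    qed simp
    have lam1: "lam ((ch ^^ n) f) \<le> 1" for n using step(5)[OF chn[OF f, of n]] R[of n] by auto
    have le: "lam f \<le> rmax ^ n" for n
    proof -
      have "lam ((ch ^^ n) f) * rmax ^ n \<le> 1 * rmax ^ n"
        using lam1 rmax_pos by (intro mult_right_mono) auto
      then show ?thesis using lamn[of n] by linarith
    qed
    have "lam f \<le> 0" by (rule LIMSEQ_le_const[OF rmax_power_tendsto_0]) (use le in auto)
    then show False using neighbour_map_dist(2)[OF f] by simp
  qed
  have u_long: "\<exists>n. L \<le> length (u n f)" if "f \<in> NM" for f L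
    using that
  proof (induction L arbitrary: f)
    case (Suc L)
    obtain m where m: "u m f \<noteq> []" using u_grows[OF Suc.prems] by blast
    obtain n where "L \<le> length (u n ((ch ^^ m) f))" using Suc.IH[OF chn[OF Suc.prems]] by blast
    then have "Suc L \<le> length (u (m + n) f)" using m by (cases "u m f") (auto simp: u_add)
    then show ?case by blast
  qed auto
  define Z where "Z n f = cell (u n f) \<inter> f ` cell (v n f)" for n f
  have Z_compact: "compact (Z n f)" if f: "f \<in> NM" for n f
    unfolding Z_def
    by (intro compact_Int compact_continuous_image neighbour_map_continuous[OF f]
        cell_compact[OF uw(1)[OF f]] cell_compact[OF uw(2)[OF f]])
  have Z_ne: "Z n f \<noteq> {}" if f: "f \<in> NM" for n f
  proof -
    obtain x y where xy: "x \<in> K" "y \<in> K" "x = (ch ^^ n) f y" using neighbour_map_meets[OF chn[OF f]] by blast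
    then have "word_map S (u n f) x = f (word_map S (v n f) y)" using comm[OF f] by simp
    moreover have "word_map S (u n f) x \<in> cell (u n f)" "word_map S (v n f) y \<in> cell (v n f)"
      using xy by (auto simp: cell_def)
    ultimately show ?thesis unfolding Z_def by blast
  qed
  have Z_mono: "Z (m + n) f \<subseteq> Z m f" if f: "f \<in> NM" for m n f
    using cell_append_subset[OF uw(1)[OF chn[OF f]], of "u m f" n m] cell_append_subset[OF uw(2)[OF chn[OF f]], of "v m f" n m]
    unfolding Z_def u_add v_add by blast
  have Z_unique: "x = y" if f: "f \<in> NM" and x: "\<And>n. x \<in> Z n f" and y: "\<And>n. y \<in> Z n f" for f x y
  proof -
    have "dist x y \<le> rmax ^ L * diamK" for L
    proof -
      obtain n where n: "L \<le> length (u n f)" using u_long[OF f] by blast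
      have "dist x y \<le> rmax ^ length (u n f) * diamK"
        by (rule dist_cell_le_level[OF uw(1)[OF f]]) (use x[of n] y[of n] in \<open>auto simp: Z_def\<close>)
      also have "\<dots> \<le> rmax ^ L * diamK"
        using n rmax_pos rmax_less_1 diamK_nonneg by (intro mult_right_mono power_decreasing) auto
      finally show ?thesis .
    qed
    moreover have "(\<lambda>L. rmax ^ L * diamK) \<longlonglongrightarrow> 0" using rmax_power_tendsto_0 by (rule tendsto_mult_left_zero)
    ultimately have "dist x y \<le> 0" by (intro LIMSEQ_le_const) auto
    then show ?thesis by simp
  qed
  have "\<exists>x. \<forall>n. x \<in> Z n f" if f: "f \<in> NM" for f
  proof -
    have "(\<Inter>n. Z n f) \<noteq> {}"
    proof (rule compact_nest)
      show "Z n f \<subseteq> Z m f" if "m \<le> n" for m n using Z_mono[OF f, of m "n - m"] that by simp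
    qed (use Z_compact[OF f] Z_ne[OF f] in auto)
    then show ?thesis by blast
  qed
  then obtain z where z: "\<And>f n. f \<in> NM \<Longrightarrow> z f \<in> Z n f" by metis
  have z_step: "z f = word_map S (lt f) (z (ch f))" if f: "f \<in> NM" for f
  proof (rule Z_unique[OF f])
    show "z f \<in> Z n f" for n by (rule z[OF f])
    show "word_map S (lt f) (z (ch f)) \<in> Z n f" for n
    proof -
      have zg: "z (ch f) \<in> Z n (ch f)" by (rule z[OF step(1)[OF f]])
      then obtain y where y: "y \<in> cell (v n (ch f))" "z (ch f) = ch f y" by (auto simp: Z_def)
      have "word_map S (lt f) (z (ch f)) \<in> cell (u (Suc n) f)"
        using zg by (auto simp: Z_def u_Suc cell_append)
      moreover have "word_map S (lt f) (z (ch f)) = f (word_map S (rt f) y)"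
        using y(2) step(4)[OF f] by simp
      moreover have "word_map S (rt f) y \<in> cell (v (Suc n) f)"
        using y(1) by (auto simp: v_Suc cell_append)
      ultimately have "word_map S (lt f) (z (ch f)) \<in> Z (Suc n) f" unfolding Z_def by blast
      then show ?thesis using Z_mono[OF f, of n 1] by auto
    qed
  qed
  define w where "w f = inv f (z f)" for f
  have w: "w f \<in> K" "f (w f) = z f" if f: "f \<in> NM" for f
  proof -
    have "z f \<in> f ` K" using z[OF f, of 0] by (simp add: Z_def v_def)
    then show "w f \<in> K" "f (w f) = z f"
      using neighbour_map_inj[OF f] by (auto simp: w_def f_inv_into_f inv_f_f)
  qed
  have w_step: "w f = word_map S (rt f) (w (ch f))" if f: "f \<in> NM" for f
  proof (rule injD[OF neighbour_map_inj[OF f]])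
    have "f (word_map S (rt f) (w (ch f))) = word_map S (lt f) (ch f (w (ch f)))" using step(4)[OF f] by simp
    also have "\<dots> = z f" using w(2)[OF step(1)[OF f]] z_step[OF f] by simp
    finally show "f (w f) = f (word_map S (rt f) (w (ch f)))" using w(2)[OF f] by simp
  qed
  define A where "A = z ` NM \<union> w ` NM"
  have zA: "\<exists>j\<in>{1..N}. \<exists>a\<in>A. z f = S j a" if "u n f \<noteq> []" "f \<in> NM" for n f
    using that
  proof (induction n arbitrary: f)
    case (Suc n)
    show ?case
    proof (cases "lt f = []")
      case True
      then show ?thesis using Suc.IH[of "ch f"] Suc.prems step(1)[OF Suc.prems(2)] z_step[OF Suc.prems(2)]
        by (simp add: u_Suc)
    next
      case False
      then obtain j where j: "lt f = [j]" using step(5)[OF Suc.prems(2)] by (auto simp: length_Suc_conv)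
      then have "j \<in> {1..N}" using step(2)[OF Suc.prems(2)] by (simp add: words_def)
      moreover have "z (ch f) \<in> A" using step(1)[OF Suc.prems(2)] by (simp add: A_def)
      ultimately show ?thesis using z_step[OF Suc.prems(2)] j by auto
    qed
  qed (simp add: u_def)
  have wA: "\<exists>j\<in>{1..N}. \<exists>a\<in>A. w f = S j a" if "v n f \<noteq> []" "f \<in> NM" for n f
    using that
  proof (induction n arbitrary: f)
    case (Suc n)
    show ?case
    proof (cases "rt f = []")
      case True
      then show ?thesis using Suc.IH[of "ch f"] Suc.prems step(1)[OF Suc.prems(2)] w_step[OF Suc.prems(2)]
        by (simp add: v_Suc)
    next
      case False
      then obtain j where j: "rt f = [j]" using step(5)[OF Suc.prems(2)] by (auto simp: length_Suc_conv)
      then have "j \<in> {1..N}" using step(3)[OF Suc.prems(2)] by (simp add: words_def)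
      moreover have "w (ch f) \<in> A" using step(1)[OF Suc.prems(2)] by (simp add: A_def)
      ultimately show ?thesis using w_step[OF Suc.prems(2)] j by auto
    qed
  qed (simp add: v_def)
  have edge: "\<exists>i\<in>P. \<exists>j\<in>{1..N} - P. \<exists>f\<in>NM. S i (z f) = S j (w f)"
    if P: "P \<subseteq> {1..N}" "P \<noteq> {}" "P \<noteq> {1..N}" for P
  proof -
    obtain i j where ij: "i \<in> P" "j \<in> {1..N} - P" "S i ` K \<inter> S j ` K \<noteq> {}"
      using K_connected_cells[OF con P] by blast
    define f where "f = inv (word_map S [i]) \<circ> word_map S [j]"
    have I: "i \<in> {1..N}" "j \<in> {1..N}" "i \<noteq> j" using ij P by auto
    have "f \<in> NM"
      unfolding neighbour_maps_def mem_Collect_eq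
    proof (intro exI conjI)
      show "f = inv (word_map S [i]) \<circ> word_map S [j]" by (simp add: f_def)
      have "rmin * r j \<le> r i * 1"
        using rmin_le[OF I(1)] ratio_bounds[OF I(2)] ratio_bounds[OF I(1)] rmin_pos by (intro mult_mono) auto
      then show "ratio_min N r \<le> word_ratio r [i] / word_ratio r [j]"
        using ratio_bounds(1)[OF I(2)] by (simp add: rmin_def pos_le_divide_eq)
      have "rmin * r i \<le> r j * 1"
        using rmin_le[OF I(2)] ratio_bounds[OF I(2)] ratio_bounds[OF I(1)] rmin_pos by (intro mult_mono) auto
      then show "word_ratio r [i] / word_ratio r [j] \<le> inverse (ratio_min N r)"
        using ratio_bounds(1)[OF I(2)] rmin_pos by (simp add: rmin_def field_simps)
    qed (use I ij in auto)
    moreover have "S i (z f) = S j (w f)"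
    proof -
      have "surj (word_map S [i])" by (rule word_map_surj[of _ 1]) (use I in \<open>simp add: words_def\<close>)
      then have "word_map S [i] (f (w f)) = word_map S [j] (w f)" by (simp add: f_def surj_f_inv_f)
      then show ?thesis using w(2)[OF \<open>f \<in> NM\<close>] by simp
    qed
    ultimately show ?thesis using ij by blast
  qed
  have "skeleton A"
    unfolding skeleton_def
  proof (intro conjI)
    show "finite A" using ft by (simp add: A_def finite_type_def)
    have "{1} \<noteq> {1..N}" using N_ge_2 by (metis atLeastAtMost_singleton_iff eq_iff insertI1 one_le_numeral order_trans singletonD numeral_eq_one_iff semiring_norm(85) atLeastAtMost_iff)
    then obtain f where "f \<in> NM" using edge[of "{1}"] N_ge_2 by auto
    then show "A \<noteq> {}" by (auto simp: A_def)
    show "A \<subseteq> K" using z[of _ 0] w(1) by (auto simp: A_def Z_def u_def)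
    show "A \<subseteq> (\<Union>j\<in>{1..N}. S j ` A)"
    proof
      fix a assume "a \<in> A"
      then consider f where "f \<in> NM" "a = z f" | f where "f \<in> NM" "a = w f" by (auto simp: A_def)
      then have "\<exists>j\<in>{1..N}. \<exists>b\<in>A. a = S j b"
      proof cases
        case (1 f)
        then show ?thesis using u_grows[OF 1(1)] zA by blast
      next
        case (2 f)
        then show ?thesis using v_grows[OF 2(1)] wA by blast
      qed
      then show "a \<in> (\<Union>j\<in>{1..N}. S j ` A)" by blast
    qed
    show "conn (adj A) (words N 1)"
      unfolding conn_def
    proof (intro allI impI)
      fix P assume P: "P \<subseteq> words N 1 \<and> P \<noteq> {} \<and> P \<noteq> words N 1"
      define P' where "P' = {j \<in> {1..N}. [j] \<in> P}"
      have P_eq: "P = (\<lambda>j. [j]) ` P'" using P unfolding words_1 P'_def by auto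
      have "P' \<subseteq> {1..N}" unfolding P'_def by blast
      moreover have "P' \<noteq> {}" using P P_eq by blast
      moreover have "P' \<noteq> {1..N}" using P unfolding P_eq words_1 by blast
      ultimately obtain i j f where ij: "i \<in> P'" "j \<in> {1..N} - P'" "f \<in> NM" "S i (z f) = S j (w f)"
        using edge by blast
      have "adj A [i] [j]" unfolding adj_def
      proof -
        have "z f \<in> A" "w f \<in> A" using ij(3) by (auto simp: A_def)
        then show "word_map S [i] ` A \<inter> word_map S [j] ` A \<noteq> {}" using ij(4) by force
      qed
      moreover have "[i] \<in> P" "[j] \<in> words N 1 - P" using ij unfolding P'_def words_1 by blast+
      ultimately show "\<exists>x\<in>P. \<exists>y\<in>words N 1 - P. adj A x y" by blast
    qed
  qed
  then show ?thesis by blast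
qed

end

section \<open>Non-crossing label sequences\<close>

text \<open>
  The order in which a tree-like tour visits the cells: an excursion that starts between two visits
  to a cell is completed before the next visit.
\<close>

definition noncross :: "'c list \<Rightarrow> bool" where
  "noncross l \<longleftrightarrow> (\<forall>a b. a \<noteq> b \<longrightarrow> \<not> subseq [a, b, a, b] l)"

lemma noncross_subseq: "noncross l \<Longrightarrow> subseq l' l \<Longrightarrow> noncross l'"
  unfolding noncross_def by (meson subseq_order.trans)

lemma subseq_singletonI: "a \<in> set w \<Longrightarrow> subseq [a] w"
  by (simp add: subseq_singleton_left)

lemma noncrossD:
  assumes "noncross (w1 @ w2 @ w3 @ w4)" "a \<in> set w1" "b \<in> set w2" "a \<in> set w3" "b \<in> set w4"
  shows "a = b"
proof (rule ccontr)
  assume "a \<noteq> b"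
  have "subseq ([a] @ [b] @ [a] @ [b]) (w1 @ w2 @ w3 @ w4)"
    by (intro list_emb_append_mono subseq_singletonI assms)
  then show False using assms(1) \<open>a \<noteq> b\<close> by (simp add: noncross_def)
qed

lemma subseq_revI: "subseq p l \<Longrightarrow> subseq (rev p) (rev l)"
  by (induction rule: list_emb.induct) (auto intro: subseq_rev_drop_many)

lemma noncross_rev: "noncross l \<Longrightarrow> noncross (rev l)"
  unfolding noncross_def
proof (intro allI impI notI)
  fix a b assume l: "\<forall>a b. a \<noteq> b \<longrightarrow> \<not> subseq [a, b, a, b] l" "a \<noteq> b" "subseq [a, b, a, b] (rev l)"
  have "subseq [b, a, b, a] l" using subseq_revI[OF l(3)] by simp
  then show False using l(1,2) by metis
qed

lemma subseq_subset: "subseq p l \<Longrightarrow> set p \<subseteq> set l"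
  by (auto dest: list_emb_set)

lemma noncross_plug:
  assumes uv: "noncross (u @ v)" and Y: "noncross Y" and disj: "set Y \<inter> set (u @ v) = {}"
  shows "noncross (u @ Y @ v)"
  unfolding noncross_def
proof (intro allI impI notI)
  fix a b :: 'a assume ab: "a \<noteq> b" "subseq [a, b, a, b] (u @ Y @ v)"
  obtain p1 p' where p: "[a, b, a, b] = p1 @ p'" "subseq p1 u" "subseq p' (Y @ v)"
    using ab(2) by (rule subseq_appendE)
  obtain p2 p3 where p': "p' = p2 @ p3" "subseq p2 Y" "subseq p3 v"
    using p(3) by (rule subseq_appendE)
  have sub: "set p1 \<subseteq> set u" "set p2 \<subseteq> set Y" "set p3 \<subseteq> set v"
    using p p' by (auto dest: subseq_subset)
  have eq: "[a, b, a, b] = p1 @ p2 @ p3" using p p' by simp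
  have "p2 = [] \<or> p2 = [a, b, a, b]"
  proof (rule ccontr)
    assume "\<not> (p2 = [] \<or> p2 = [a, b, a, b])"
    then have "set p2 \<inter> set (p1 @ p3) \<noteq> {}"
      using eq ab(1) by (auto simp: Cons_eq_append_conv)
    then show False using sub disj by auto
  qed
  then show False
  proof
    assume "p2 = []"
    then have "subseq [a, b, a, b] (u @ v)" using eq p(2) p'(3) by (simp add: list_emb_append_mono)
    then show False using uv ab(1) by (simp add: noncross_def)
  next
    assume "p2 = [a, b, a, b]"
    then show False using Y p'(2) ab(1) by (simp add: noncross_def)
  qed
qed

lemma noncross_rotate:
  assumes "noncross (u @ v)"
  shows "noncross (v @ u)"
  unfolding noncross_def
proof (intro allI impI notI)
  fix a b :: 'a assume ab: "a \<noteq> b" "subseq [a, b, a, b] (v @ u)"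
  obtain p1 p2 where p: "[a, b, a, b] = p1 @ p2" "subseq p1 v" "subseq p2 u"
    using ab(2) by (rule subseq_appendE)
  have s: "subseq (p2 @ p1) (u @ v)" using p by (intro list_emb_append_mono)
  have "p2 @ p1 = [a, b, a, b] \<or> p2 @ p1 = [b, a, b, a]"
    using p(1) by (auto simp: Cons_eq_append_conv)
  then show False using s assms ab(1) unfolding noncross_def by metis
qed

lemma noncross_replicate: "noncross (replicate n a)"
  unfolding noncross_def by (auto dest!: subseq_subset)

lemma conn_induct:
  assumes fin: "finite X" and con: "conn R X" and x0: "x0 \<in> X" and base: "P {x0}"
    and step: "\<And>C x y. \<lbrakk>C \<subseteq> X; x0 \<in> C; P C; x \<in> C; y \<in> X - C; R x y\<rbrakk> \<Longrightarrow> P (insert y C)"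
  shows "P X"
proof -
  let ?F = "{C. C \<subseteq> X \<and> x0 \<in> C \<and> P C}"
  have "finite ?F" "?F \<noteq> {}" using fin x0 base by (auto intro: finite_subset[of _ "Pow X"])
  then obtain C where C: "C \<in> ?F" "\<And>D. D \<in> ?F \<Longrightarrow> C \<subseteq> D \<Longrightarrow> C = D"
    by (metis (no_types, lifting) finite_has_maximal)
  have "C = X"
  proof (rule ccontr)
    assume "C \<noteq> X"
    then obtain x y where "x \<in> C" "y \<in> X - C" "R x y"
      using connD[OF con, of C] C(1) by auto
    then have "insert y C \<in> ?F" using step[of C x y] C(1) by auto
    then show False using C(2)[of "insert y C"] \<open>y \<in> X - C\<close> by blast
  qed
  then show ?thesis using C(1) by simp
qed

section \<open>Trails of edges\<close>

text \<open>
  Every cell \<open>J\<close> carries a cycle with vertices \<open>pts J 0, \<dots>, pts J (m - 1)\<close>. The edge \<open>(J, k, b)\<close>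
  joins the vertices \<open>k\<close> and \<open>k + 1\<close> of this cycle, and \<open>b\<close> tells whether it is traversed forwards.
\<close>

locale cycle_system =
  fixes pts :: "'c \<Rightarrow> nat \<Rightarrow> 'pt" and m :: nat
  assumes m_pos: "0 < m"
begin

type_synonym 'b edge = "'b \<times> nat \<times> bool"

fun st where "st (J, k, b) = (if b then pts J k else pts J (Suc k mod m))"
fun en where "en (J, k, b) = (if b then pts J (Suc k mod m) else pts J k)"
fun flip :: "'c edge \<Rightarrow> 'c edge" where "flip (J, k, b) = (J, k, \<not> b)"
fun und :: "'c edge \<Rightarrow> 'c \<times> nat" where "und (J, k, b) = (J, k)"
abbreviation lab :: "'c edge \<Rightarrow> 'c" where "lab \<equiv> fst"

definition rv where "rv es = rev (map flip es)"

primrec path :: "'pt \<Rightarrow> 'c edge list \<Rightarrow> 'pt \<Rightarrow> bool" where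
  "path x [] y \<longleftrightarrow> x = y"
| "path x (e # es) y \<longleftrightarrow> st e = x \<and> path (en e) es y"

lemma flip_simps [simp]: "st (flip e) = en e" "en (flip e) = st e" "und (flip e) = und e" "lab (flip e) = lab e"
  by (cases e; simp)+

lemma lab_und: "lab e = fst (und e)"
  by (cases e) simp

lemma path_append: "path x (es @ fs) y \<longleftrightarrow> (\<exists>z. path x es z \<and> path z fs y)"
  by (induction es arbitrary: x) auto

lemma path_rv: "path x es y \<Longrightarrow> path y (rv es) x"
  by (induction es arbitrary: x) (auto simp: rv_def path_append)

lemma path_ends: "path x es y \<Longrightarrow> es \<noteq> [] \<Longrightarrow> x = st (hd es) \<and> y = en (last es)"
  by (induction es arbitrary: x) auto

lemma path_det: "path x es y \<Longrightarrow> path x es z \<Longrightarrow> y = z"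
  by (induction es arbitrary: x) auto

lemma rv_append: "rv (es @ fs) = rv fs @ rv es"
  by (simp add: rv_def)

lemma rv_rv [simp]: "rv (rv es) = es"
proof -
  have "flip \<circ> flip = id" by (auto simp: fun_eq_iff)
  then show ?thesis by (simp add: rv_def rev_map[symmetric])
qed

lemma rv_maps [simp]: "map und (rv es) = rev (map und es)" "map lab (rv es) = rev (map lab es)"
  by (simp_all add: rv_def rev_map)

lemma rv_filter: "filter (\<lambda>e. lab e = J) (rv es) = rv (filter (\<lambda>e. lab e = J) es)"
  by (simp add: rv_def filter_map rev_filter[symmetric] o_def)

lemma rv_lab_set [simp]: "lab ` set (rv es) = lab ` set es"
  by (auto simp: rv_def image_iff) force+

lemma path_cyc_segment: "i \<le> j \<Longrightarrow> j < m \<Longrightarrow> path (pts J i) (map (\<lambda>k. (J, k, True)) [i..<j]) (pts J j)"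
  by (induction "j - i" arbitrary: i) (auto simp: upt_conv_Cons)

lemma cyc_rotated:
  assumes "k < m"
  obtains B where "path (pts J k) B (pts J k)" "map und B = map (Pair J) ([k..<m] @ [0..<k])"
    "\<And>e. e \<in> set B \<Longrightarrow> snd (snd e)"
proof
  let ?f = "\<lambda>k. (J, k, True)"
  have "[k..<m] = [k..<m - 1] @ [m - 1]" using assms by (cases m) auto
  then have "path (pts J k) (map ?f [k..<m]) (pts J 0)"
    using path_cyc_segment[of k "m - 1" J] assms m_pos by (auto simp: path_append)
  moreover have "path (pts J 0) (map ?f [0..<k]) (pts J k)" using path_cyc_segment[of 0 k J] assms by simp
  ultimately show "path (pts J k) (map ?f [k..<m] @ map ?f [0..<k]) (pts J k)" by (auto simp: path_append)
qed auto

text \<open>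
  A tour of a set of cells uses every edge of their cycles once. The last two conditions say that
  the tour is tree-like: it returns to the cycle of \<open>J\<close> where it left it, and the excursions from
  different cycles are nested.
\<close>

definition tour where
  "tour C W \<longleftrightarrow> distinct (map und W) \<and> set (map und W) = C \<times> {..<m} \<and> noncross (map lab W) \<and>
     (\<forall>J. \<exists>x. path x (filter (\<lambda>e. lab e = J) W) x)"

lemma tour_lab: "tour C W \<Longrightarrow> lab ` set W = C"
proof -
  assume "tour C W"
  then have "fst ` set (map und W) = fst ` (C \<times> {..<m})" by (simp add: tour_def)
  then show ?thesis using m_pos by (auto simp: lab_und image_image)
qed

lemma tour_rotate: "tour C (u @ v) \<Longrightarrow> tour C (v @ u)"
  unfolding tour_def by (auto simp: path_append Un_commute dest: noncross_rotate) blast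

lemma tour_plug:
  assumes W: "tour C (u @ v)" and L: "L \<notin> C" and B: "path x B x" "map und B = map (Pair L) ks"
    "distinct ks" "set ks = {..<m}"
  shows "tour (insert L C) (u @ B @ v)"
proof -
  have labB: "map lab B = replicate (length B) L"
  proof -
    have "map lab B = map fst (map und B)" by (simp add: lab_und[abs_def] o_def)
    also have "\<dots> = replicate (length B) L" using B(2) by (simp add: o_def map_replicate_const) (metis length_map)
    finally show ?thesis .
  qed
  then have labB': "lab e = L" if "e \<in> set B" for e
    using that by (metis in_set_replicate list.set_map imageI)
  have labuv: "lab ` set (u @ v) = C" by (rule tour_lab[OF W])
  have 1: "distinct (map und (u @ B @ v))"
    using W B L unfolding tour_def by (auto simp: distinct_map inj_on_def)
  have 2: "set (map und (u @ B @ v)) = insert L C \<times> {..<m}"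
  proof -
    have "set (map und (u @ B @ v)) = set (map und (u @ v)) \<union> set (map und B)" by auto
    also have "\<dots> = C \<times> {..<m} \<union> {L} \<times> {..<m}" using W B(2,4) unfolding tour_def by auto
    finally show ?thesis by auto
  qed
  have 3: "noncross (map lab (u @ B @ v))"
  proof -
    have "noncross (map lab u @ map lab v)" using W by (simp add: tour_def)
    moreover have "set (replicate (length B) L) \<inter> set (map lab u @ map lab v) = {}"
      using labuv L by (auto simp: set_replicate_conv_if)
    ultimately have "noncross (map lab u @ replicate (length B) L @ map lab v)"
      by (intro noncross_plug noncross_replicate)
    then show ?thesis by (simp add: labB)
  qed
  have 4: "\<exists>x. path x (filter (\<lambda>e. lab e = J) (u @ B @ v)) x" for J
  proof (cases "J = L")
    case True
    have "filter (\<lambda>e. lab e = J) u = []" "filter (\<lambda>e. lab e = J) v = []"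
      using labuv L True by (auto simp: filter_empty_conv)
    moreover have "filter (\<lambda>e. lab e = J) B = B" unfolding filter_id_conv using labB' True by blast
    ultimately have "filter (\<lambda>e. lab e = J) (u @ B @ v) = B" by simp
    then show ?thesis using B(1) by auto
  next
    case False
    then have "filter (\<lambda>e. lab e = J) (u @ B @ v) = filter (\<lambda>e. lab e = J) (u @ v)"
      using labB' by (auto simp: filter_empty_conv)
    then show ?thesis using W by (simp add: tour_def)
  qed
  show ?thesis unfolding tour_def using 1 2 3 4 by blast
qed

definition meets where "meets J J' \<longleftrightarrow> (\<exists>k<m. \<exists>k'<m. pts J k = pts J' k')"

lemma path_visit:
  assumes "path x W y" "(J, k) \<in> set (map und W)"
  shows "\<exists>u v. W = u @ v \<and> path x u (pts J k) \<and> path (pts J k) v y"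
proof -
  obtain b where e: "(J, k, b) \<in> set W" using assms(2) by (auto elim!: und.elims)
  then obtain u v where W: "W = u @ (J, k, b) # v" by (meson split_list)
  show ?thesis
  proof (cases b)
    case True
    then show ?thesis using assms(1) unfolding W by (intro exI[of _ u] exI[of _ "(J, k, b) # v"]) (auto simp: path_append)
  next
    case False
    then show ?thesis using assms(1) unfolding W by (intro exI[of _ "u @ [(J, k, b)]"] exI[of _ v]) (auto simp: path_append)
  qed
qed

lemma tour_exists:
  assumes fin: "finite C" "C \<noteq> {}" and con: "conn meets C"
  shows "\<exists>W x. tour C W \<and> path x W x"
proof -
  obtain J0 where J0: "J0 \<in> C" using fin(2) by blast
  show ?thesis
  proof (rule conn_induct[OF fin(1) con J0, where P = "\<lambda>C. \<exists>W x. tour C W \<and> path x W x"])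
    obtain B where B: "path (pts J0 0) B (pts J0 0)" "map und B = map (Pair J0) ([0..<m] @ [0..<0])"
      using cyc_rotated[OF m_pos, of J0] by metis
    have "tour {} ([] @ [])" by (auto simp: tour_def noncross_def)
    then have "tour {J0} ([] @ B @ [])" by (rule tour_plug[OF _ _ B]) auto
    then show "\<exists>W x. tour {J0} W \<and> path x W x" using B(1) by auto
  next
    fix D J L assume D: "\<exists>W x. tour D W \<and> path x W x" "J \<in> D" "L \<in> C - D" "meets J L"
    then obtain W x where W: "tour D W" "path x W x" by blast
    obtain k k' where k: "k < m" "k' < m" "pts J k = pts L k'" using D(4) by (auto simp: meets_def)
    have "(J, k) \<in> set (map und W)" using W(1) D(2) k(1) by (simp add: tour_def)
    then obtain u v where uv: "W = u @ v" "path x u (pts J k)" "path (pts J k) v x"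
      using path_visit[OF W(2)] by blast
    obtain B where B: "path (pts L k') B (pts L k')" "map und B = map (Pair L) ([k'..<m] @ [0..<k'])"
      using cyc_rotated[OF k(2), of L] by metis
    have "tour (insert L D) (u @ B @ v)"
      by (rule tour_plug[OF _ _ B]) (use W(1) uv D(3) k(2) in auto)
    moreover have "path x (u @ B @ v) x" using uv B(1) k(3) by (auto simp: path_append)
    ultimately show "\<exists>W x. tour (insert L D) W \<and> path x W x" by blast
  qed
qed

section \<open>Cutting a tour into trails\<close>

fun closed_walk :: "('pt \<times> 'c edge list) list \<Rightarrow> 'pt \<Rightarrow> bool" where
  "closed_walk [] z \<longleftrightarrow> True"
| "closed_walk [(a, es)] z \<longleftrightarrow> path a es z"
| "closed_walk ((a, es) # (b, fs) # T) z \<longleftrightarrow> path a es b \<and> closed_walk ((b, fs) # T) z"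

lemma closed_walk_insert:
  "\<lbrakk>closed_walk (T1 @ (a, u @ v) # T2) z; path a u b; v \<noteq> []; st (hd v) = b\<rbrakk>
     \<Longrightarrow> closed_walk (T1 @ (a, u) # (b, v) # T2) z"
proof (induction T1 z rule: closed_walk.induct)
  case (1 z)
  then show ?case by (cases T2) (auto simp: path_append, (metis path_det)+)
next
  case (2 a' es z)
  then show ?case by (cases T2) (auto simp: path_append, (metis path_det)+)
qed auto

lemma closed_walk_nth:
  "\<lbrakk>closed_walk T z; i < length T\<rbrakk> \<Longrightarrow>
     path (fst (T ! i)) (snd (T ! i)) (if Suc i < length T then fst (T ! Suc i) else z)"
proof (induction T z arbitrary: i rule: closed_walk.induct)
  case (3 a es b fs T z)
  show ?case
  proof (cases i)
    case (Suc j)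
    then show ?thesis using 3(1)[of j] 3(2,3) by auto
  qed (use 3 in auto)
qed auto

text \<open>
  The cuts are inserted one at a time; the first one chooses the starting point of the closed walk.
\<close>

lemma cut_tour:
  assumes W: "path x W x" and A: "finite A" "A \<noteq> {}" "A \<subseteq> st ` set W"
  shows "\<exists>T u v. W = u @ v \<and> concat (map snd T) = v @ u \<and> distinct (map fst T) \<and> set (map fst T) = A \<and>
     T \<noteq> [] \<and> closed_walk T (fst (hd T))"
  using A
proof (induction A rule: finite_ne_induct)
  case (singleton a)
  then obtain e where e: "e \<in> set W" "st e = a" by auto
  then obtain u v where uv: "W = u @ e # v" by (meson split_list)
  have "path a ((e # v) @ u) a" using W e(2) unfolding uv by (auto simp: path_append)
  then show ?case using uv by (intro exI[of _ "[(a, (e # v) @ u)]"] exI[of _ u] exI[of _ "e # v"]) auto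
next
  case (insert b B)
  then obtain T u v where T: "W = u @ v" "concat (map snd T) = v @ u" "distinct (map fst T)" "set (map fst T) = B"
     "T \<noteq> []" "closed_walk T (fst (hd T))" by auto
  obtain e where e: "e \<in> set W" "st e = b" using insert.prems by auto
  have "e \<in> set (concat (map snd T))" using T(1,2) e(1) by auto
  then obtain p where p: "p \<in> set T" "e \<in> set (snd p)" by auto
  obtain T1 T2 where T12: "T = T1 @ p # T2" using p(1) by (meson split_list)
  obtain f g where fg: "snd p = f @ e # g" using p(2) by (meson split_list)
  obtain a where a: "p = (a, f @ e # g)" using fg by (cases p) auto
  let ?T = "T1 @ (a, f) # (b, e # g) # T2"
  have hd: "fst (hd ?T) = fst (hd T)" unfolding T12 a by (cases T1) auto
  have "path a (f @ e # g) (if Suc (length T1) < length T then fst (T ! Suc (length T1)) else fst (hd T))"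
    using closed_walk_nth[OF T(6), of "length T1"] unfolding T12 a by simp
  then have "path a f b" using e(2) by (auto simp: path_append)
  then have "closed_walk ?T (fst (hd T))"
    using closed_walk_insert[of T1 a f "e # g" T2 "fst (hd T)" b] T(6) e(2) unfolding T12 a by simp
  then have "closed_walk ?T (fst (hd ?T))" by (simp only: hd)
  moreover have "concat (map snd ?T) = v @ u" using T(2) unfolding T12 a by simp
  moreover have "distinct (map fst ?T)" "set (map fst ?T) = insert b B"
    using T(3,4) insert.hyps unfolding T12 a by auto
  ultimately show ?case using T(1) by blast
qed

definition trails where
  "trails as \<tau>s \<longleftrightarrow> length as = m \<and> length \<tau>s = m \<and>
     (\<forall>i<m. path (as ! i) (\<tau>s ! i) (as ! (Suc i mod m)))"

lemma trails_exist:
  assumes fin: "finite C" "C \<noteq> {}" and con: "conn meets C"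
    and A: "finite A" "card A = m" "\<And>a. a \<in> A \<Longrightarrow> \<exists>J\<in>C. \<exists>k<m. a = pts J k"
  shows "\<exists>as \<tau>s. trails as \<tau>s \<and> tour C (concat \<tau>s) \<and> distinct as \<and> set as = A"
proof -
  obtain W x where W: "tour C W" "path x W x" using tour_exists[OF fin con] by blast
  have "A \<noteq> {}" using A(2) m_pos by auto
  have "A \<subseteq> st ` set W"
  proof
    fix a assume "a \<in> A"
    then obtain J k where Jk: "J \<in> C" "k < m" "a = pts J k" using A(3) by blast
    have "(J, k) \<in> set (map und W)" using W(1) Jk by (simp add: tour_def)
    then obtain u v where uv: "W = u @ v" "path x u a" "path a v x" using path_visit[OF W(2)] Jk(3) by blast
    show "a \<in> st ` set W"
    proof (cases v)
      case Nil
      have "W \<noteq> []" using \<open>(J, k) \<in> set (map und W)\<close> by auto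
      then have "st (hd W) = x" "x = a" using path_ends[OF W(2)] uv(3) Nil by auto
      then show ?thesis using \<open>W \<noteq> []\<close> by (metis hd_in_set imageI)
    next
      case (Cons e v')
      then show ?thesis using uv by auto
    qed
  qed
  then obtain T u v where T: "W = u @ v" "concat (map snd T) = v @ u" "distinct (map fst T)" "set (map fst T) = A"
     "T \<noteq> []" "closed_walk T (fst (hd T))"
    using cut_tour[OF W(2) A(1) \<open>A \<noteq> {}\<close>] by blast
  have len: "length T = m" using T(3,4) A(2) by (metis distinct_card length_map)
  have "trails (map fst T) (map snd T)"
    unfolding trails_def
  proof (intro conjI allI impI)
    fix i assume i: "i < m"
    have "path (fst (T ! i)) (snd (T ! i)) (if Suc i < length T then fst (T ! Suc i) else fst (hd T))"
      using closed_walk_nth[OF T(6)] i len by simp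
    moreover have "(if Suc i < length T then fst (T ! Suc i) else fst (hd T)) = map fst T ! (Suc i mod m)"
    proof (cases "Suc i < m")
      case False
      then have "Suc i = m" using i by simp
      then show ?thesis using len T(5) by (simp add: hd_conv_nth)
    qed (use len in simp)
    ultimately show "path (map fst T ! i) (map snd T ! i) (map fst T ! (Suc i mod m))"
      using i len by simp
  qed (use len in auto)
  moreover have "tour C (concat (map snd T))" using T(1,2) W(1) tour_rotate by simp
  ultimately show ?thesis using T(3,4) by blast
qed

section \<open>Exchanging segments between trails\<close>

text \<open>
  A segment whose cells do not occur elsewhere contains the complete closed paths of these cells.
\<close>

lemma tour_reverse_segment:
  assumes W: "tour C (P @ G @ Q)" and disj: "lab ` set G \<inter> lab ` set (P @ Q) = {}"
  shows "tour C (P @ rv G @ Q)"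
proof -
  have 1: "distinct (map und (P @ rv G @ Q))" and 2: "set (map und (P @ rv G @ Q)) = C \<times> {..<m}"
  proof -
    have "mset (map und (P @ rv G @ Q)) = mset (map und (P @ G @ Q))" by (simp only: map_append rv_maps mset_append mset_rev)
    then show "distinct (map und (P @ rv G @ Q))" "set (map und (P @ rv G @ Q)) = C \<times> {..<m}"
      using W unfolding tour_def by (metis mset_eq_imp_distinct_iff, metis mset_eq_setD)
  qed
  have nc: "noncross (map lab P @ map lab G @ map lab Q)" using W by (simp add: tour_def)
  have "noncross (map lab P @ map lab Q)"
    by (rule noncross_subseq[OF nc]) (simp add: subseq_append' subseq_drop_many)
  moreover have "noncross (rev (map lab G))"
    by (rule noncross_rev, rule noncross_subseq[OF nc]) (simp add: list_emb_append2 list_emb_prefix)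
  ultimately have "noncross (map lab P @ rev (map lab G) @ map lab Q)"
    by (rule noncross_plug) (use disj in auto)
  then have 3: "noncross (map lab (P @ rv G @ Q))" by simp
  have 4: "\<exists>x. path x (filter (\<lambda>e. lab e = J) (P @ rv G @ Q)) x" for J
  proof -
    have "\<exists>x. path x (filter (\<lambda>e. lab e = J) (P @ G @ Q)) x" using W unfolding tour_def by blast
    then obtain x where x: "path x (filter (\<lambda>e. lab e = J) (P @ G @ Q)) x" by blast
    show ?thesis
    proof (cases "J \<in> lab ` set G")
      case True
      then have "filter (\<lambda>e. lab e = J) P = []" "filter (\<lambda>e. lab e = J) Q = []"
        using disj by (auto simp: filter_empty_conv)
      then show ?thesis using x path_rv by (auto simp: rv_filter)
    next
      case False
      then have "filter (\<lambda>e. lab e = J) G = []" "filter (\<lambda>e. lab e = J) (rv G) = []"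
        by (auto simp: filter_empty_conv rv_filter rv_def)
      then show ?thesis using x by auto
    qed
  qed
  show ?thesis unfolding tour_def using 1 2 3 4 by blast
qed

text \<open>
  The stretch of a trail from the first to the last edge of a cell is the unit that two trails exchange.
\<close>

lemma label_hull:
  assumes "J \<in> lab ` set es"
  obtains u s' v where "es = u @ s' @ v" "s' \<noteq> []" "lab (hd s') = J" "lab (last s') = J"
    "J \<notin> lab ` set u" "J \<notin> lab ` set v"
proof -
  have "\<exists>x\<in>set es. lab x = J" using assms by auto
  from split_list_first_prop[OF this]
  obtain u e w where 1: "es = u @ e # w" "lab e = J" "\<forall>x\<in>set u. lab x \<noteq> J" by blast
  have "\<exists>x\<in>set (e # w). lab x = J" using 1(2) by simp
  from split_list_last_prop[OF this]
  obtain u' e' v where 2: "e # w = u' @ e' # v" "lab e' = J" "\<forall>x\<in>set v. lab x \<noteq> J" by blast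
  show ?thesis
  proof (rule that[of u "u' @ [e']" v])
    show "es = u @ (u' @ [e']) @ v" using 1(1) 2(1) by simp
    show "lab (hd (u' @ [e'])) = J" using 2(1,2) 1(2) by (cases u') auto
  qed (use 1(3) 2 in auto)
qed

text \<open>
  Reverse the whole stretch from one hull of \<open>J\<close> to the other, and turn the part \<open>Y\<close> between the hulls
  back. By non-crossing, the cells that occur in a reversed part occur only there.
\<close>

lemma tour_swap:
  assumes W: "tour C (X @ sa @ Y @ sb @ Z)"
    and sa: "sa \<noteq> []" "lab (hd sa) = J" "lab (last sa) = J"
    and sb: "sb \<noteq> []" "lab (hd sb) = J" "lab (last sb) = J"
    and J: "J \<notin> lab ` set X" "J \<notin> lab ` set Y" "J \<notin> lab ` set Z"
  shows "tour C (X @ rv sb @ Y @ rv sa @ Z)"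
proof -
  have nc: "noncross (map lab X @ map lab sa @ map lab Y @ map lab sb @ map lab Z)" using W by (simp add: tour_def)
  have Ja: "J \<in> set (map lab sa)" "J \<in> set (map lab sb)" using sa sb by (auto intro: image_eqI[OF _ hd_in_set])
  have YX: "b \<notin> set (map lab X)" if b: "b \<in> set (map lab Y)" for b
  proof
    assume "b \<in> set (map lab X)"
    then have "b = J"
      using nc Ja b by (intro noncrossD[of "map lab X" "map lab sa" "map lab Y" "map lab sb @ map lab Z"]) simp_all
    then show False using b J(2) by simp
  qed
  have YZ: "b \<notin> set (map lab Z)" if b: "b \<in> set (map lab Y)" for b
  proof
    assume "b \<in> set (map lab Z)"
    then have "J = b"
      using nc Ja b by (intro noncrossD[of "map lab X @ map lab sa" "map lab Y" "map lab sb" "map lab Z"]) simp_all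
    then show False using b J(2) by simp
  qed
  \<comment> \<open>A label other than \<open>J\<close> occurs in a hull of \<open>J\<close> strictly between two edges of \<open>J\<close>.\<close>
  have inner: "\<exists>s'. map lab s = J # s' @ [J] \<and> b \<in> set s'"
    if s: "s \<noteq> []" "lab (hd s) = J" "lab (last s) = J" "b \<in> set (map lab s)" "b \<noteq> J" for s b
  proof -
    obtain e s1 where s1: "s = e # s1" using s(1) by (cases s) auto
    then have "s1 \<noteq> []" using s by auto
    then obtain s2 e' where s2: "s1 = s2 @ [e']" by (cases s1 rule: rev_cases) auto
    have "map lab s = J # map lab s2 @ [J]" using s s1 s2 by simp
    then show ?thesis using s(4,5) by auto
  qed
  have aY: "b \<notin> set (map lab Y)" and aX: "b \<notin> set (map lab X)" and aZ: "b \<notin> set (map lab Z)"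
    if b: "b \<in> set (map lab sa)" "b \<noteq> J" for b
  proof -
    obtain s' where s': "map lab sa = J # s' @ [J]" "b \<in> set s'" using inner[OF sa b] by metis
    show "b \<notin> set (map lab Y)"
    proof
      assume "b \<in> set (map lab Y)"
      then have "J = b"
        using nc s' by (intro noncrossD[of "map lab X @ [J]" s' "[J]" "map lab Y @ map lab sb @ map lab Z"]) simp_all
      then show False using b(2) by simp
    qed
    show "b \<notin> set (map lab X)"
    proof
      assume "b \<in> set (map lab X)"
      then have "b = J"
        using nc s' by (intro noncrossD[of "map lab X" "[J]" "s'" "[J] @ map lab Y @ map lab sb @ map lab Z"]) simp_all
      then show False using b(2) by simp
    qed
    show "b \<notin> set (map lab Z)"
    proof
      assume "b \<in> set (map lab Z)"
      then have "J = b"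
        using nc s' by (intro noncrossD[of "map lab X @ [J]" "s'" "[J] @ map lab Y @ map lab sb" "map lab Z"]) simp_all
      then show False using b(2) by simp
    qed
  qed
  have bY: "b \<notin> set (map lab Y)" and bX: "b \<notin> set (map lab X)" and bZ: "b \<notin> set (map lab Z)"
    if b: "b \<in> set (map lab sb)" "b \<noteq> J" for b
  proof -
    obtain s' where s': "map lab sb = J # s' @ [J]" "b \<in> set s'" using inner[OF sb b] by metis
    show "b \<notin> set (map lab Y)"
    proof
      assume "b \<in> set (map lab Y)"
      then have "b = J"
        using nc s' by (intro noncrossD[of "map lab X @ map lab sa @ map lab Y" "[J]" s' "[J] @ map lab Z"]) simp_all
      then show False using b(2) by simp
    qed
    show "b \<notin> set (map lab X)"
    proof
      assume "b \<in> set (map lab X)"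
      then have "b = J"
        using nc s' by (intro noncrossD[of "map lab X" "map lab sa @ map lab Y @ [J]" s' "[J] @ map lab Z"]) simp_all
      then show False using b(2) by simp
    qed
    show "b \<notin> set (map lab Z)"
    proof
      assume "b \<in> set (map lab Z)"
      then have "J = b"
        using nc s' by (intro noncrossD[of "map lab X @ map lab sa @ map lab Y @ [J]" s' "[J]" "map lab Z"]) simp_all
      then show False using b(2) by simp
    qed
  qed
  have "tour C (X @ (sa @ Y @ sb) @ Z)" using W by simp
  moreover have "lab ` set (sa @ Y @ sb) \<inter> lab ` set (X @ Z) = {}"
  proof -
    have "b \<notin> set (map lab X) \<and> b \<notin> set (map lab Z)" if "b \<in> set (map lab sa) \<union> set (map lab Y) \<union> set (map lab sb)" for b
    proof (cases "b = J")
      case True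
      then show ?thesis using J by simp
    next
      case False
      then show ?thesis using that aX aZ bX bZ YX YZ by blast
    qed
    then show ?thesis unfolding set_append image_Un set_map[symmetric] by blast
  qed
  ultimately have "tour C (X @ rv (sa @ Y @ sb) @ Z)" by (rule tour_reverse_segment)
  then have "tour C ((X @ rv sb) @ rv Y @ (rv sa @ Z))" by (simp add: rv_append)
  moreover have "lab ` set (rv Y) \<inter> lab ` set ((X @ rv sb) @ (rv sa @ Z)) = {}"
  proof -
    have "b \<notin> set (map lab X) \<and> b \<notin> set (map lab Z) \<and> b \<notin> set (map lab sa) \<and> b \<notin> set (map lab sb)" if "b \<in> set (map lab Y)" for b
    proof (cases "b = J")
      case True
      then show ?thesis using J that by simp
    next
      case False
      then show ?thesis using that YX YZ aY bY by blast
    qed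
    then show ?thesis unfolding set_append image_Un set_map[symmetric] rv_maps set_rev by blast
  qed
  ultimately have "tour C ((X @ rv sb) @ rv (rv Y) @ (rv sa @ Z))" by (rule tour_reverse_segment)
  then show ?thesis by simp
qed

end

section \<open>Distributing the edges over the trails\<close>

lemma drop_split_nth: "i \<le> j \<Longrightarrow> j < length xs \<Longrightarrow> drop i xs = take (j - i) (drop i xs) @ xs ! j # drop (Suc j) xs"
  using id_take_nth_drop[of "j - i" "drop i xs"] by simp

lemma concat_split1:
  assumes "i < length xs"
  shows "\<exists>X Z. \<forall>a. concat (xs[i := a]) = X @ a @ Z"
  by (intro exI[of _ "concat (take i xs)"] exI[of _ "concat (drop (Suc i) xs)"])
     (use assms in \<open>simp add: upd_conv_take_nth_drop\<close>)

lemma concat_split2: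
  assumes "i < j" "j < length xs"
  shows "\<exists>X Y Z. (\<forall>a b. concat (xs[i := a, j := b]) = X @ a @ Y @ b @ Z) \<and>
     set X \<union> set Y \<union> set Z \<subseteq> (\<Union>k\<in>{..<length xs} - {i, j}. set (xs ! k))"
proof -
  define M where "M = take (j - Suc i) (drop (Suc i) xs)"
  have xs: "xs = take i xs @ xs ! i # M @ xs ! j # drop (Suc j) xs"
    using drop_split_nth[of 0 i xs] drop_split_nth[of "Suc i" j xs] assms by (simp add: M_def)
  have len: "length (take i xs) = i" "length M = j - Suc i" using assms by (auto simp: M_def)
  have upd: "xs[i := a, j := b] = take i xs @ a # M @ b # drop (Suc j) xs" for a b
  proof -
    have "xs[i := a, j := b] = (take i xs @ xs ! i # M @ xs ! j # drop (Suc j) xs)[i := a, j := b]" using xs by simp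
    also have "\<dots> = take i xs @ a # M @ b # drop (Suc j) xs"
      using len assms by (simp add: list_update_append Suc_diff_Suc[symmetric])
    finally show ?thesis .
  qed
  have sub: "set (concat (take i xs)) \<union> set (concat M) \<union> set (concat (drop (Suc j) xs))
     \<subseteq> (\<Union>k\<in>{..<length xs} - {i, j}. set (xs ! k))"
  proof -
    have 1: "\<exists>k\<in>{..<length xs} - {i, j}. xs ! k = a" if "a \<in> set (take i xs)" for a
      using that assms by (force simp: in_set_conv_nth)
    have 2: "\<exists>k\<in>{..<length xs} - {i, j}. xs ! k = a" if a: "a \<in> set M" for a
    proof -
      obtain l where l: "l < j - Suc i" "a = M ! l" using a len by (auto simp: in_set_conv_nth)
      then have "xs ! (Suc i + l) = a" using assms by (simp add: M_def)
      then show ?thesis using l assms by (intro bexI[of _ "Suc i + l"]) auto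
    qed
    have 3: "\<exists>k\<in>{..<length xs} - {i, j}. xs ! k = a" if a: "a \<in> set (drop (Suc j) xs)" for a
    proof -
      obtain l where l: "l < length xs - Suc j" "a = drop (Suc j) xs ! l" using a by (auto simp: in_set_conv_nth)
      then show ?thesis using assms by (intro bexI[of _ "Suc j + l"]) auto
    qed
    show ?thesis using 1 2 3 by fastforce
  qed
  show ?thesis
    by (intro exI[of _ "concat (take i xs)"] exI[of _ "concat M"] exI[of _ "concat (drop (Suc j) xs)"] conjI sub)
       (simp add: upd)
qed

lemma concat_split3:
  assumes "i < j" "j < k" "k < length xs"
  shows "\<exists>X Y Z W. concat xs = X @ xs ! i @ Y @ xs ! j @ Z @ xs ! k @ W"
proof -
  have "xs = take i xs @ xs ! i # take (j - Suc i) (drop (Suc i) xs) @ xs ! j #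
      take (k - Suc j) (drop (Suc j) xs) @ xs ! k # drop (Suc k) xs"
    using drop_split_nth[of 0 i xs] drop_split_nth[of "Suc i" j xs] drop_split_nth[of "Suc j" k xs] assms by simp
  then have "concat xs = concat (take i xs) @ xs ! i @ concat (take (j - Suc i) (drop (Suc i) xs)) @ xs ! j @
      concat (take (k - Suc j) (drop (Suc j) xs)) @ xs ! k @ concat (drop (Suc k) xs)"
    by (metis concat.simps(2) concat_append)
  then show ?thesis by blast
qed

context cycle_system
begin

lemma und_mem: "(J, k) \<in> set (map und es) \<Longrightarrow> \<exists>b. (J, k, b) \<in> set es"
  by (auto elim!: und.elims)

definition good where "good g es \<longleftrightarrow> (\<exists>J b. (J, g, b) \<in> set es)"

lemma hull_inner:
  assumes s: "s \<noteq> []" "lab (hd s) = J" "lab (last s) = J" "b \<in> set (map lab s)" "b \<noteq> J"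
  shows "\<exists>s'. map lab s = J # s' @ [J] \<and> b \<in> set s'"
proof -
  obtain e s1 where s1: "s = e # s1" using s(1) by (cases s) auto
  then have "s1 \<noteq> []" using s by auto
  then obtain s2 e' where s2: "s1 = s2 @ [e']" by (cases s1 rule: rev_cases) auto
  have "map lab s = J # map lab s2 @ [J]" using s s1 s2 by simp
  then show ?thesis using s(4,5) by auto
qed

text \<open>
  In a non-crossing tour two different cells cannot both meet three different trails.
\<close>

lemma no_three_common_sorted:
  assumes t: "tour C (concat \<tau>s)" and ijk: "i < j" "j < k" "k < length \<tau>s"
    and J: "\<And>l. l \<in> {i, j, k} \<Longrightarrow> J \<in> lab ` set (\<tau>s ! l) \<and> J' \<in> lab ` set (\<tau>s ! l)"
  shows "J = J'"
proof (rule ccontr)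
  assume ne: "J \<noteq> J'"
  obtain X Y Z W where c: "concat \<tau>s = X @ \<tau>s ! i @ Y @ \<tau>s ! j @ Z @ \<tau>s ! k @ W"
    using concat_split3[OF ijk] by blast
  have nc: "noncross (map lab X @ map lab (\<tau>s ! i) @ map lab Y @ map lab (\<tau>s ! j) @ map lab Z @ map lab (\<tau>s ! k) @ map lab W)"
    using t unfolding tour_def c by simp
  have mem: "J \<in> set (map lab (\<tau>s ! l))" "J' \<in> set (map lab (\<tau>s ! l))" if "l \<in> {i, j, k}" for l
    using J[OF that] by auto
  obtain p q where pq: "map lab (\<tau>s ! i) = p @ J # q" using mem(1)[of i] by (meson insertI1 split_list)
  then consider "J' \<in> set p" | "J' \<in> set q" using mem(2)[of i] ne by auto
  then show False
  proof cases
    case 1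
    have "J' = J"
      by (rule noncrossD[of "map lab X @ p" "J # q @ map lab Y" "map lab (\<tau>s ! j) @ map lab Z" "map lab (\<tau>s ! k) @ map lab W"])
         (use nc pq 1 mem[of j] mem[of k] in simp_all)
    then show False using ne by simp
  next
    case 2
    have "J = J'"
      by (rule noncrossD[of "map lab X @ p @ [J]" "q @ map lab Y" "map lab (\<tau>s ! j) @ map lab Z" "map lab (\<tau>s ! k) @ map lab W"])
         (use nc pq 2 mem[of j] mem[of k] in simp_all)
    then show False using ne by simp
  qed
qed

lemma no_three_common:
  assumes t: "tour C (concat \<tau>s)" and ijk: "i \<noteq> j" "j \<noteq> k" "i \<noteq> k" "i < length \<tau>s" "j < length \<tau>s" "k < length \<tau>s"
    and J: "\<And>l. l \<in> {i, j, k} \<Longrightarrow> J \<in> lab ` set (\<tau>s ! l) \<and> J' \<in> lab ` set (\<tau>s ! l)"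
  shows "J = J'"
proof -
  have *: "J = J'" if "a < b" "b < c" "{a, b, c} = {i, j, k}" for a b c
  proof (rule no_three_common_sorted[OF t that(1,2)])
    have "c \<in> {i, j, k}" using that(3) by blast
    then show "c < length \<tau>s" using ijk by auto
    show "J \<in> lab ` set (\<tau>s ! l) \<and> J' \<in> lab ` set (\<tau>s ! l)" if "l \<in> {a, b, c}" for l
      by (rule J) (use that \<open>{a, b, c} = {i, j, k}\<close> in blast)
  qed
  consider "i < j" "j < k" | "i < k" "k < j" | "j < i" "i < k" | "j < k" "k < i" | "k < i" "i < j" | "k < j" "j < i"
    using ijk by linarith
  then show ?thesis
    by cases (use *[of i j k] *[of i k j] *[of j i k] *[of j k i] *[of k i j] *[of k j i] in \<open>auto simp: insert_commute\<close>)
qed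

lemma swap_trails:
  assumes tr: "trails as \<tau>s" and t: "tour C (concat \<tau>s)" and ij: "i < j" "j < m"
    and i: "\<tau>s ! i = u1 @ s1 @ v1" "s1 \<noteq> []" "lab (hd s1) = J" "lab (last s1) = J"
      "J \<notin> lab ` set u1" "J \<notin> lab ` set v1"
    and j: "\<tau>s ! j = u2 @ s2 @ v2" "s2 \<noteq> []" "lab (hd s2) = J" "lab (last s2) = J"
      "J \<notin> lab ` set u2" "J \<notin> lab ` set v2"
    and other: "\<And>l. l < m \<Longrightarrow> l \<noteq> i \<Longrightarrow> l \<noteq> j \<Longrightarrow> J \<notin> lab ` set (\<tau>s ! l)"
  defines "\<tau>s' \<equiv> \<tau>s[i := u1 @ rv s2 @ v1, j := u2 @ rv s1 @ v2]"
  shows "trails as \<tau>s'" "tour C (concat \<tau>s')"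
proof -
  have len: "length \<tau>s = m" "length as = m" using tr by (auto simp: trails_def)
  obtain X Y Z where upd: "\<And>a b. concat (\<tau>s[i := a, j := b]) = X @ a @ Y @ b @ Z"
    and sub: "set X \<union> set Y \<union> set Z \<subseteq> (\<Union>k\<in>{..<length \<tau>s} - {i, j}. set (\<tau>s ! k))"
    using concat_split2[of i j \<tau>s] ij len by metis
  have "\<tau>s[i := \<tau>s ! i, j := \<tau>s ! j] = \<tau>s" by simp
  then have c: "concat \<tau>s = X @ \<tau>s ! i @ Y @ \<tau>s ! j @ Z" using upd[of "\<tau>s ! i" "\<tau>s ! j"] by simp
  have JX: "J \<notin> lab ` set X" "J \<notin> lab ` set Y" "J \<notin> lab ` set Z"
  proof -
    have "J \<notin> lab ` (\<Union>k\<in>{..<length \<tau>s} - {i, j}. set (\<tau>s ! k))" using other len by blast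
    then show "J \<notin> lab ` set X" "J \<notin> lab ` set Y" "J \<notin> lab ` set Z" using sub by blast+
  qed
  have tour1: "tour C ((X @ u1) @ s1 @ (v1 @ Y @ u2) @ s2 @ (v2 @ Z))" using t unfolding c i(1) j(1) by simp
  then have "tour C ((X @ u1) @ rv s2 @ (v1 @ Y @ u2) @ rv s1 @ (v2 @ Z))"
    by (rule tour_swap) (use i j JX in \<open>auto simp del: lab_und\<close>)
  then show "tour C (concat \<tau>s')" unfolding \<tau>s'_def upd by simp
  \<comment> \<open>The edges of \<open>J\<close> form a closed path, so the two hulls have the same endpoints.\<close>
  let ?f = "filter (\<lambda>e. lab e = J)"
  have cl: "\<exists>x. path x (?f ((X @ u1) @ s1 @ (v1 @ Y @ u2) @ s2 @ (v2 @ Z))) x" using tour1 unfolding tour_def by blast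
  have "?f ((X @ u1) @ s1 @ (v1 @ Y @ u2) @ s2 @ (v2 @ Z)) = ?f s1 @ ?f s2"
  proof -
    have "?f X = []" "?f u1 = []" "?f v1 = []" "?f Y = []" "?f u2 = []" "?f v2 = []" "?f Z = []"
      using JX i(5,6) j(5,6) by (force simp: filter_empty_conv)+
    then show ?thesis by simp
  qed
  from cl[unfolded this] obtain x y where xy: "path x (?f s1) y" "path y (?f s2) x"
    unfolding path_append by blast
  have fs: "?f s \<noteq> [] \<and> hd (?f s) = hd s \<and> last (?f s) = last s" if s: "s \<noteq> []" "lab (hd s) = J" "lab (last s) = J" for s
  proof -
    have "?f s \<noteq> []" using s by (cases s) auto
    moreover have "hd (?f s) = hd s" using s by (cases s) auto
    moreover have "last (?f s) = last s" using s by (cases s rule: rev_cases) auto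
    ultimately show ?thesis by blast
  qed
  have x: "x = st (hd s1)" "y = en (last s1)" "y = st (hd s2)" "x = en (last s2)"
    using path_ends[OF xy(1)] path_ends[OF xy(2)] fs[OF i(2-4)] fs[OF j(2-4)] by auto
  have seg: "path a (u @ w @ v) b" if p: "path a (u @ s @ v) b" "s \<noteq> []" and w: "path (st (hd s)) w (en (last s))" for a u s v b w
  proof -
    obtain z1 z2 where z: "path a u z1" "path z1 s z2" "path z2 v b" using p(1) by (auto simp: path_append)
    then have "z1 = st (hd s)" "z2 = en (last s)" using path_ends[OF z(2) p(2)] by auto
    then show ?thesis using z w by (auto simp: path_append)
  qed
  have p: "path (as ! i) (u1 @ s1 @ v1) (as ! (Suc i mod m))" "path (as ! j) (u2 @ s2 @ v2) (as ! (Suc j mod m))"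
    using tr ij i(1) j(1) unfolding trails_def by (metis less_trans)+
  have mid: "path (st (hd s1)) s1 (en (last s1))" "path (st (hd s2)) s2 (en (last s2))"
    using p path_ends[of _ s1] path_ends[of _ s2] i(2) j(2) by (auto simp: path_append)
  have "path (as ! i) (u1 @ rv s2 @ v1) (as ! (Suc i mod m))"
    by (rule seg[OF p(1) i(2)]) (use path_rv[OF mid(2)] x in simp)
  moreover have "path (as ! j) (u2 @ rv s1 @ v2) (as ! (Suc j mod m))"
    by (rule seg[OF p(2) j(2)]) (use path_rv[OF mid(1)] x in simp)
  ultimately show "trails as \<tau>s'"
    using tr ij len unfolding trails_def \<tau>s'_def by (auto simp: nth_list_update)
qed

text \<open>
  A trail that avoids the edges of type \<open>g\<close> but visits many cells shares two of these cells, in the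
  same way, with exactly one other trail. Exchanging the segments of the two trails that belong to one of
  these cells transfers its edge of type \<open>g\<close>, and the other trail keeps the one of the second cell.
\<close>

lemma improve_trails:
  assumes tr: "trails as \<tau>s" and t: "tour C (concat \<tau>s)" and g: "g < m" and e: "e < m"
    and bad: "\<not> good g (\<tau>s ! e)" and many: "2 ^ m < card (lab ` set (\<tau>s ! e))"
  shows "\<exists>\<tau>s'. trails as \<tau>s' \<and> tour C (concat \<tau>s') \<and>
     {i. i < m \<and> good g (\<tau>s ! i)} \<subset> {i. i < m \<and> good g (\<tau>s' ! i)}"
proof -
  have len: "length \<tau>s = m" using tr by (auto simp: trails_def)
  define touched where "touched J = {i. i < m \<and> J \<in> lab ` set (\<tau>s ! i)}" for J
  have "card (touched ` (lab ` set (\<tau>s ! e))) \<le> card (Pow {..<m})"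
    by (rule card_mono) (auto simp: touched_def)
  then have "\<not> inj_on touched (lab ` set (\<tau>s ! e))"
    using many by (intro pigeonhole) (simp add: card_Pow)
  then obtain J J' where JJ: "J \<in> lab ` set (\<tau>s ! e)" "J' \<in> lab ` set (\<tau>s ! e)" "touched J = touched J'" "J \<noteq> J'"
    by (auto simp: inj_on_def)
  have gedge: "\<exists>t<m. t \<noteq> e \<and> (\<exists>b. (H, g, b) \<in> set (\<tau>s ! t))" if H: "H \<in> lab ` set (\<tau>s ! e)" for H
  proof -
    have "\<tau>s ! e \<in> set \<tau>s" using e len by simp
    then have "set (\<tau>s ! e) \<subseteq> set (concat \<tau>s)" by auto
    then have "H \<in> lab ` set (concat \<tau>s)" using H by blast
    then have "H \<in> C" using tour_lab[OF t] by blast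
    then have "(H, g) \<in> set (map und (concat \<tau>s))" using t g by (simp add: tour_def)
    then obtain b where "(H, g, b) \<in> set (concat \<tau>s)" using und_mem by blast
    then obtain es where "es \<in> set \<tau>s" "(H, g, b) \<in> set es" by auto
    then obtain l where "l < m" "(H, g, b) \<in> set (\<tau>s ! l)" using len in_set_conv_nth[of es \<tau>s] by auto
    then show ?thesis using bad by (auto simp: good_def)
  qed
  obtain t b where tb: "t < m" "t \<noteq> e" "(J, g, b) \<in> set (\<tau>s ! t)" using gedge[OF JJ(1)] by blast
  have et: "e \<in> touched J" "t \<in> touched J" using JJ(1) tb e by (force simp: touched_def)+
  have only: "touched J = {e, t}"
  proof (rule ccontr)
    assume "touched J \<noteq> {e, t}"
    then obtain f where f: "f \<in> touched J" "f \<noteq> e" "f \<noteq> t" using et by blast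
    have "J = J'"
    proof (rule no_three_common[OF t, of e t f])
      show "J \<in> lab ` set (\<tau>s ! l) \<and> J' \<in> lab ` set (\<tau>s ! l)" if "l \<in> {e, t, f}" for l
      proof -
        have "l \<in> touched J" "l \<in> touched J'" using that et f(1) JJ(3) by auto
        then show ?thesis by (simp add: touched_def)
      qed
    qed (use e tb f len in \<open>auto simp: touched_def\<close>)
    then show False using JJ(4) by simp
  qed
  obtain t' b' where tb': "t' < m" "t' \<noteq> e" "(J', g, b') \<in> set (\<tau>s ! t')" using gedge[OF JJ(2)] by blast
  then have "t' \<in> touched J'" by (force simp: touched_def)
  then have t': "t' = t" using only JJ(3) tb'(2) by auto
  have other: "J \<notin> lab ` set (\<tau>s ! l)" if "l < m" "l \<noteq> e" "l \<noteq> t" for l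
    using only that by (auto simp: touched_def)
  obtain u1 s1 v1 where 1: "\<tau>s ! e = u1 @ s1 @ v1" "s1 \<noteq> []" "lab (hd s1) = J" "lab (last s1) = J"
      "J \<notin> lab ` set u1" "J \<notin> lab ` set v1"
    by (rule label_hull[OF JJ(1)])
  have "J \<in> lab ` set (\<tau>s ! t)" using tb(3) by force
  then obtain u2 s2 v2 where 2: "\<tau>s ! t = u2 @ s2 @ v2" "s2 \<noteq> []" "lab (hd s2) = J" "lab (last s2) = J"
      "J \<notin> lab ` set u2" "J \<notin> lab ` set v2"
    by (rule label_hull)
  have J's2: "J' \<notin> lab ` set s2"
  proof
    assume "J' \<in> lab ` set s2"
    then obtain s' where s': "map lab s2 = J # s' @ [J]" "J' \<in> set s'"
      using hull_inner[OF 2(2-4), of J'] JJ(4) by auto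
    have Je: "J' \<in> set (map lab (\<tau>s ! e))" using JJ(2) by auto
    show False
    proof (cases "e < t")
      case True
      obtain X Y Z where "\<And>a b. concat (\<tau>s[e := a, t := b]) = X @ a @ Y @ b @ Z"
        using concat_split2[of e t \<tau>s] True tb(1) len by metis
      from this[of "\<tau>s ! e" "\<tau>s ! t"] have c: "concat \<tau>s = X @ \<tau>s ! e @ Y @ \<tau>s ! t @ Z" by simp
      have nc: "noncross (map lab X @ map lab (\<tau>s ! e) @ map lab Y @ map lab u2 @ map lab s2 @ map lab v2 @ map lab Z)"
        using t unfolding tour_def c 2(1) by simp
      have "J' = J"
        by (rule noncrossD[of "map lab X @ map lab (\<tau>s ! e) @ map lab Y @ map lab u2" "[J]" s' "[J] @ map lab v2 @ map lab Z"])
           (use nc s' Je in simp_all)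
      then show False using JJ(4) by simp
    next
      case False
      then have "t < e" using tb(2) by simp
      then obtain X Y Z where "\<And>a b. concat (\<tau>s[t := a, e := b]) = X @ a @ Y @ b @ Z"
        using concat_split2[of t e \<tau>s] e len by metis
      from this[of "\<tau>s ! t" "\<tau>s ! e"] have c: "concat \<tau>s = X @ \<tau>s ! t @ Y @ \<tau>s ! e @ Z" by simp
      have nc: "noncross (map lab X @ map lab u2 @ map lab s2 @ map lab v2 @ map lab Y @ map lab (\<tau>s ! e) @ map lab Z)"
        using t unfolding tour_def c 2(1) by simp
      have "J = J'"
        by (rule noncrossD[of "map lab X @ map lab u2 @ [J]" s' "[J] @ map lab v2 @ map lab Y" "map lab (\<tau>s ! e) @ map lab Z"])
           (use nc s' Je in simp_all)
      then show False using JJ(4) by simp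
    qed
  qed
  define \<tau>s' where "\<tau>s' = \<tau>s[e := u1 @ rv s2 @ v1, t := u2 @ rv s1 @ v2]"
  have sw: "trails as \<tau>s' \<and> tour C (concat \<tau>s')"
  proof (cases "e < t")
    case True
    show ?thesis unfolding \<tau>s'_def
      using swap_trails[OF tr t True tb(1) 1 2] other by blast
  next
    case False
    then have "t < e" using tb(2) by simp
    have "\<tau>s' = \<tau>s[t := u2 @ rv s1 @ v2, e := u1 @ rv s2 @ v1]"
      unfolding \<tau>s'_def using tb(2) by (simp add: list_update_swap)
    then show ?thesis using swap_trails[OF tr t \<open>t < e\<close> e 2 1] other by simp
  qed
  have nth': "\<tau>s' ! e = u1 @ rv s2 @ v1" "\<tau>s' ! t = u2 @ rv s1 @ v2"
     "\<And>i. i \<noteq> e \<Longrightarrow> i \<noteq> t \<Longrightarrow> \<tau>s' ! i = \<tau>s ! i"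
    using len e tb(1,2) by (auto simp: \<tau>s'_def)
  have "(J, g, b) \<in> set s2" using tb(3) 2(1,5,6) by force
  then have "(J, g, \<not> b) \<in> set (rv s2)" by (force simp: rv_def)
  then have ge: "good g (\<tau>s' ! e)" by (auto simp: good_def nth')
  have "(J', g, b') \<in> set u2 \<union> set v2"
  proof -
    have "(J', g, b') \<notin> set s2" using J's2 by force
    then show ?thesis using tb'(3) t' 2(1) by auto
  qed
  then have gt: "good g (\<tau>s' ! t)" by (auto simp: good_def nth')
  have "{i. i < m \<and> good g (\<tau>s ! i)} \<subseteq> {i. i < m \<and> good g (\<tau>s' ! i)}"
  proof
    fix i assume i: "i \<in> {i. i < m \<and> good g (\<tau>s ! i)}"
    then have "i \<noteq> e" using bad by auto
    then show "i \<in> {i. i < m \<and> good g (\<tau>s' ! i)}" using i gt nth'(3)[of i] by (cases "i = t") auto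
  qed
  moreover have "e \<in> {i. i < m \<and> good g (\<tau>s' ! i)}" "e \<notin> {i. i < m \<and> good g (\<tau>s ! i)}" using ge e bad by auto
  ultimately have "{i. i < m \<and> good g (\<tau>s ! i)} \<subset> {i. i < m \<and> good g (\<tau>s' ! i)}" by blast
  then show ?thesis using sw by blast
qed

text \<open>
  An exchange makes one more trail good and spoils none, so finitely many exchanges suffice.
\<close>

lemma all_trails_good:
  assumes tr: "trails as \<tau>s" and t: "tour C (concat \<tau>s)" and g: "g < m" and C: "C \<noteq> {}"
    and many: "\<And>i es. \<lbrakk>2 \<le> m; i < m; path (as ! i) es (as ! (Suc i mod m)); und ` set es \<subseteq> C \<times> {..<m}\<rbrakk> \<Longrightarrow> 2 ^ m < card (lab ` set es)"
  shows "\<exists>\<tau>s'. trails as \<tau>s' \<and> tour C (concat \<tau>s') \<and> (\<forall>i<m. good g (\<tau>s' ! i))"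
  using tr t
proof (induction "m - card {i. i < m \<and> good g (\<tau>s ! i)}" arbitrary: \<tau>s rule: less_induct)
  case (less \<tau>s)
  show ?case
  proof (cases "\<forall>i<m. good g (\<tau>s ! i)")
    case False
    then obtain e where e: "e < m" "\<not> good g (\<tau>s ! e)" by blast
    have len: "length \<tau>s = m" using less.prems by (auto simp: trails_def)
    have "2 \<le> m"
    proof (rule ccontr)
      assume "\<not> 2 \<le> m"
      then have m1: "m = 1" "e = 0" using m_pos e by auto
      obtain J where "J \<in> C" using C by blast
      then have "(J, g) \<in> set (map und (concat \<tau>s))" using less.prems(2) g by (simp add: tour_def)
      then obtain b where "(J, g, b) \<in> set (concat \<tau>s)" using und_mem by blast
      moreover have "concat \<tau>s = \<tau>s ! 0" using len m1 by (cases \<tau>s) auto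
      ultimately show False using e m1 by (auto simp: good_def)
    qed
    moreover have "path (as ! e) (\<tau>s ! e) (as ! (Suc e mod m))" using less.prems(1) e by (simp add: trails_def)
    moreover have "und ` set (\<tau>s ! e) \<subseteq> C \<times> {..<m}"
    proof -
      have "\<tau>s ! e \<in> set \<tau>s" using e len by simp
      then have "und ` set (\<tau>s ! e) \<subseteq> set (map und (concat \<tau>s))" by auto
      also have "\<dots> = C \<times> {..<m}" using less.prems(2) by (simp add: tour_def)
      finally show ?thesis .
    qed
    ultimately have "2 ^ m < card (lab ` set (\<tau>s ! e))" using many e(1) by blast
    then obtain \<tau>s' where \<tau>s': "trails as \<tau>s'" "tour C (concat \<tau>s')"
       "{i. i < m \<and> good g (\<tau>s ! i)} \<subset> {i. i < m \<and> good g (\<tau>s' ! i)}"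
      using improve_trails[OF less.prems g e] by blast
    have "card {i. i < m \<and> good g (\<tau>s ! i)} < card {i. i < m \<and> good g (\<tau>s' ! i)}"
      by (rule psubset_card_mono[OF _ \<tau>s'(3)]) simp
    moreover have "card {i. i < m \<and> good g (\<tau>s' ! i)} \<le> card {..<m}" by (rule card_mono) auto
    ultimately have "m - card {i. i < m \<and> good g (\<tau>s' ! i)} < m - card {i. i < m \<and> good g (\<tau>s ! i)}" by simp
    then show ?thesis using less.hyps \<tau>s' by blast
  qed (use less.prems in blast)
qed

definition uses where
  "uses C \<tau>s \<longleftrightarrow> distinct (map und (concat \<tau>s)) \<and> set (map und (concat \<tau>s)) = C \<times> {..<m}"

text \<open>
  The whole cycle of the new cell is inserted at a point that it shares with an edge of some trail; this
  trail then contains all edges of the cell.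
\<close>

lemma add_cell:
  assumes tr: "trails as \<tau>s" and us: "uses C \<tau>s" and L: "L \<notin> C" and J: "J \<in> C" "meets J L"
  shows "\<exists>\<tau>s'. trails as \<tau>s' \<and> uses (insert L C) \<tau>s' \<and> (\<forall>i<m. set (\<tau>s ! i) \<subseteq> set (\<tau>s' ! i)) \<and>
     (\<exists>i<m. \<forall>k<m. \<exists>b. (L, k, b) \<in> set (\<tau>s' ! i))"
proof -
  have len: "length \<tau>s = m" using tr by (auto simp: trails_def)
  obtain k k' where k: "k < m" "k' < m" "pts J k = pts L k'" using J(2) by (auto simp: meets_def)
  have "(J, k) \<in> set (map und (concat \<tau>s))" using us J(1) k(1) by (simp add: uses_def)
  then obtain b where "(J, k, b) \<in> set (concat \<tau>s)" using und_mem by blast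
  then obtain es where es: "es \<in> set \<tau>s" "(J, k, b) \<in> set es" by auto
  then obtain i where i: "i < m" "\<tau>s ! i = es" using len by (auto simp: in_set_conv_nth)
  have "(J, k) \<in> set (map und (\<tau>s ! i))" using es(2) i(2) by force
  note i = i(1) this
  have "path (as ! i) (\<tau>s ! i) (as ! (Suc i mod m))" using tr i(1) by (simp add: trails_def)
  then obtain u v where uv: "\<tau>s ! i = u @ v" "path (as ! i) u (pts J k)" "path (pts J k) v (as ! (Suc i mod m))"
    using path_visit i(2) by blast
  obtain B where B: "path (pts L k') B (pts L k')" "map und B = map (Pair L) ([k'..<m] @ [0..<k'])"
    using cyc_rotated[OF k(2), of L] by metis
  have "{k'..<m} \<union> {0..<k'} = {..<m}" using k(2) by auto
  then have setB: "set (map und B) = {L} \<times> {..<m}" unfolding B(2) by (auto simp: image_Un[symmetric])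
  have dB: "distinct (map und B)" using B(2) k(2) by (auto simp: distinct_map inj_on_def)
  define \<tau>s' where "\<tau>s' = \<tau>s[i := u @ B @ v]"
  obtain X Z where upd: "\<And>a. concat (\<tau>s[i := a]) = X @ a @ Z" using concat_split1[of i \<tau>s] i(1) len by metis
  have "concat \<tau>s = X @ \<tau>s ! i @ Z" using upd[of "\<tau>s ! i"] by (simp only: list_update_id)
  then have c: "concat \<tau>s = X @ u @ v @ Z" using uv(1) by simp
  have c': "concat \<tau>s' = X @ u @ B @ v @ Z" unfolding \<tau>s'_def upd by simp
  have "trails as \<tau>s'"
  proof -
    have "path (as ! i) (u @ B @ v) (as ! (Suc i mod m))" using uv B(1) k(3) by (auto simp: path_append)
    then show ?thesis using tr len i(1) unfolding trails_def \<tau>s'_def by (auto simp: nth_list_update)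
  qed
  moreover have "uses (insert L C) \<tau>s'"
    unfolding uses_def
  proof
    have old: "distinct (map und (X @ u @ v @ Z))" "set (map und (X @ u @ v @ Z)) = C \<times> {..<m}"
      using us unfolding uses_def c by blast+
    have ms: "mset (map und (concat \<tau>s')) = mset (map und B @ map und (X @ u @ v @ Z))" unfolding c' by simp
    have "set (map und B) \<inter> set (map und (X @ u @ v @ Z)) = {}" unfolding setB old(2) using L by auto
    then have "distinct (map und B @ map und (X @ u @ v @ Z))" using dB old(1) by (simp only: distinct_append)
    then show "distinct (map und (concat \<tau>s'))" using mset_eq_imp_distinct_iff[OF ms] by blast
    have "set (map und (concat \<tau>s')) = set (map und B @ map und (X @ u @ v @ Z))" by (rule mset_eq_setD[OF ms])
    also have "\<dots> = insert L C \<times> {..<m}" unfolding set_append setB old(2) by auto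
    finally show "set (map und (concat \<tau>s')) = insert L C \<times> {..<m}" .
  qed
  moreover have "\<forall>l<m. set (\<tau>s ! l) \<subseteq> set (\<tau>s' ! l)"
  proof (intro allI impI)
    fix l assume "l < m"
    then show "set (\<tau>s ! l) \<subseteq> set (\<tau>s' ! l)"
      using len uv(1) by (cases "l = i") (auto simp: \<tau>s'_def)
  qed
  moreover have "\<exists>b. (L, l, b) \<in> set (\<tau>s' ! i)" if "l < m" for l
  proof -
    have "(L, l) \<in> set (map und B)" using setB that by auto
    then obtain b where "(L, l, b) \<in> set B" using und_mem by blast
    then show ?thesis using i(1) len by (auto simp: \<tau>s'_def)
  qed
  ultimately show ?thesis using i(1) by blast
qed

text \<open>
  Tour the connected set \<open>C\<close>, cut the tour at the points of \<open>A\<close>, and exchange segments until every trail has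
  an edge of type \<open>g\<close>. Inserting the cells outside of \<open>C\<close> afterwards creates a cell whose edges all
  belong to one trail.
\<close>

lemma trail_plan:
  assumes X: "finite X" "C \<subseteq> X" "C \<noteq> {}" "X - C \<noteq> {}" and con: "conn meets C"
    and dom: "\<And>L. L \<in> X - C \<Longrightarrow> \<exists>J\<in>C. meets J L"
    and A: "finite A" "card A = m" "\<And>a. a \<in> A \<Longrightarrow> \<exists>J\<in>C. \<exists>k<m. a = pts J k"
    and g: "g < m"
    and many: "\<And>a b es. \<lbrakk>a \<in> A; b \<in> A; a \<noteq> b; path a es b; und ` set es \<subseteq> X \<times> {..<m}\<rbrakk> \<Longrightarrow> 2 ^ m < card (lab ` set es)"
  shows "\<exists>as \<tau>s h. trails as \<tau>s \<and> uses X \<tau>s \<and> distinct as \<and> set as = A \<and>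
     (\<forall>i<m. good g (\<tau>s ! i)) \<and> h < m \<and> (\<exists>L\<in>X. \<forall>k<m. \<exists>b. (L, k, b) \<in> set (\<tau>s ! h))"
proof -
  have finC: "finite C" using X by (auto intro: finite_subset)
  obtain as \<tau>s where 1: "trails as \<tau>s" "tour C (concat \<tau>s)" "distinct as" "set as = A"
    using trails_exist[OF finC X(3) con A] by blast
  have len: "length as = m" using 1(1) by (simp add: trails_def)
  have "2 ^ m < card (lab ` set es)" if "2 \<le> m" "i < m" "path (as ! i) es (as ! (Suc i mod m))" "und ` set es \<subseteq> C \<times> {..<m}" for i es
  proof (rule many[OF _ _ _ that(3)])
    show "und ` set es \<subseteq> X \<times> {..<m}" by (rule order_trans[OF that(4)]) (use X(2) in auto)
    have "Suc i mod m \<noteq> i"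
    proof (cases "Suc i < m")
      case False
      then have "Suc i = m" using that(2) by simp
      then show ?thesis using that(1) by auto
    qed simp
    moreover have "Suc i mod m < m" using m_pos by simp
    ultimately show "as ! i \<noteq> as ! (Suc i mod m)" using nth_eq_iff_index_eq[OF 1(3)] that(2) len by metis
    show "as ! i \<in> A" "as ! (Suc i mod m) \<in> A" using 1(4) len that(2) m_pos nth_mem[of i as] nth_mem[of "Suc i mod m" as] by auto
  qed
  then obtain \<tau>s1 where 2: "trails as \<tau>s1" "tour C (concat \<tau>s1)" "\<forall>i<m. good g (\<tau>s1 ! i)"
    using all_trails_good[OF 1(1,2) g X(3)] by blast
  have u: "uses C \<tau>s1" using 2(2) by (simp add: uses_def tour_def)
  have "\<exists>\<tau>s. trails as \<tau>s \<and> uses (C \<union> Y) \<tau>s \<and> (\<forall>i<m. good g (\<tau>s ! i)) \<and>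
     (Y = {} \<or> (\<exists>h<m. \<exists>L\<in>X. \<forall>k<m. \<exists>b. (L, k, b) \<in> set (\<tau>s ! h)))" if "finite Y" "Y \<subseteq> X - C" for Y
    using that
  proof (induction Y rule: finite_induct)
    case empty
    then show ?case using 2 u by auto
  next
    case (insert L Y)
    then obtain \<tau>s where \<tau>s: "trails as \<tau>s" "uses (C \<union> Y) \<tau>s" "\<forall>i<m. good g (\<tau>s ! i)" by auto
    obtain J where J: "J \<in> C" "meets J L" using dom[of L] insert.prems by blast
    obtain \<tau>s' where \<tau>s': "trails as \<tau>s'" "uses (insert L (C \<union> Y)) \<tau>s'" "\<forall>i<m. set (\<tau>s ! i) \<subseteq> set (\<tau>s' ! i)"
        "\<exists>i<m. \<forall>k<m. \<exists>b. (L, k, b) \<in> set (\<tau>s' ! i)"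
      using add_cell[OF \<tau>s(1,2), of L J] J insert by auto
    have "\<forall>i<m. good g (\<tau>s' ! i)" using \<tau>s(3) \<tau>s'(3) unfolding good_def by blast
    then show ?case using \<tau>s' insert.prems by (intro exI[of _ \<tau>s']) auto
  qed
  from this[of "X - C"] X obtain \<tau>s2 where "trails as \<tau>s2" "uses (C \<union> (X - C)) \<tau>s2" "\<forall>i<m. good g (\<tau>s2 ! i)"
     "\<exists>h<m. \<exists>L\<in>X. \<forall>k<m. \<exists>b. (L, k, b) \<in> set (\<tau>s2 ! h)" by auto
  moreover have "C \<union> (X - C) = X" using X(2) by blast
  ultimately show ?thesis using 1(3,4) by metis
qed

end

section \<open>Connected dominating sets of cells\<close>

lemma conn_Un:
  assumes sym: "\<And>x y. R x y \<Longrightarrow> R y x" and C: "conn R C" and D: "conn R D"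
    and cd: "c \<in> C" "d \<in> D" "R c d"
  shows "conn R (C \<union> D)"
  unfolding conn_def
proof (intro allI impI)
  fix P assume P: "P \<subseteq> C \<union> D \<and> P \<noteq> {} \<and> P \<noteq> C \<union> D"
  show "\<exists>x\<in>P. \<exists>y\<in>C \<union> D - P. R x y"
  proof (cases "(P \<inter> C \<noteq> {} \<and> P \<inter> C \<noteq> C) \<or> (P \<inter> D \<noteq> {} \<and> P \<inter> D \<noteq> D)")
    case True
    then show ?thesis
    proof
      assume "P \<inter> C \<noteq> {} \<and> P \<inter> C \<noteq> C"
      then obtain x y where "x \<in> P \<inter> C" "y \<in> C - P \<inter> C" "R x y" using connD[OF C, of "P \<inter> C"] by blast
      then show ?thesis by blast
    next
      assume "P \<inter> D \<noteq> {} \<and> P \<inter> D \<noteq> D"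
      then obtain x y where "x \<in> P \<inter> D" "y \<in> D - P \<inter> D" "R x y" using connD[OF D, of "P \<inter> D"] by blast
      then show ?thesis by blast
    qed
  next
    case False
    have "P = (P \<inter> C) \<union> (P \<inter> D)" using P by blast
    then have "(c \<in> P \<and> d \<notin> P) \<or> (c \<notin> P \<and> d \<in> P)" using False P cd(1,2) by blast
    then show ?thesis using cd sym by blast
  qed
qed

lemma conn_singleton: "conn R {x}"
  by (auto simp: conn_def)

lemma conn_insert:
  assumes "\<And>x y. R x y \<Longrightarrow> R y x" "conn R C" "c \<in> C" "R c x"
  shows "conn R (insert x C)"
  using conn_Un[where R = R, OF assms(1,2) conn_singleton assms(3) _ assms(4)] by simp

lemma conn_Un_dominated:
  assumes sym: "\<And>x y. R x y \<Longrightarrow> R y x" and C: "conn R C" and F: "finite F" "\<And>f. f \<in> F \<Longrightarrow> \<exists>c\<in>C. R c f"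
  shows "conn R (C \<union> F)"
  using F
proof (induction F rule: finite_induct)
  case (insert f F)
  then obtain c where "c \<in> C" "R c f" by blast
  then have "conn R (insert f (C \<union> F))" using insert by (intro conn_insert[where R = R, OF sym, where c = c]) auto
  then show ?case by simp
qed (simp add: C)

text \<open>
  Grow a star with three leaves to a spanning tree, adding leaves and turning a leaf into an inner
  vertex only when it receives a new leaf: the inner vertices form a connected dominating set that
  misses at least three vertices.
\<close>

lemma three_leaves:
  fixes X :: "'v set"
  assumes sym: "\<And>x y. R x y \<Longrightarrow> R y x" and X: "finite X" "conn R X"
    and v: "v \<in> X" "E \<subseteq> X" "card E = 3" "v \<notin> E" "\<And>e. e \<in> E \<Longrightarrow> R v e"
  shows "\<exists>C\<subseteq>X. conn R C \<and> C \<noteq> {} \<and> (\<forall>x\<in>X - C. \<exists>c\<in>C. R c x) \<and> 3 \<le> card (X - C)"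
proof -
  define ok where "ok C D \<longleftrightarrow> C \<subseteq> X \<and> D \<subseteq> X \<and> C \<inter> D = {} \<and> conn R C \<and> C \<noteq> {} \<and>
    (\<forall>d\<in>D. \<exists>c\<in>C. R c d) \<and> 3 \<le> card D" for C D
  have "ok {v} E" using v by (auto simp: ok_def conn_singleton)
  then have ex: "\<exists>C D. ok C D" by blast
  define f :: "'v set \<times> 'v set \<Rightarrow> nat" where "f p = card (fst p \<union> snd p)" for p
  have bound: "f p < Suc (card X)" if "ok (fst p) (snd p)" for p
    using that X(1) unfolding f_def ok_def less_Suc_eq_le by (intro card_mono) auto
  obtain p where p: "ok (fst p) (snd p)" "\<And>p'. ok (fst p') (snd p') \<Longrightarrow> f p' \<le> f p"
  proof -
    obtain C D where "ok (fst (C, D)) (snd (C, D))" using ex by auto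
    from ex_has_greatest_nat[where P = "\<lambda>p. ok (fst p) (snd p)" and f = f, OF this] bound that
    show ?thesis by blast
  qed
  obtain C D where CD: "p = (C, D)" by (cases p)
  have o: "ok C D" and mx: "\<And>C' D'. ok C' D' \<Longrightarrow> card (C' \<union> D') \<le> card (C \<union> D)"
    using p CD by (force simp: f_def)+
  have fin: "finite C" "finite D" using o X(1) by (auto simp: ok_def intro: finite_subset)
  have "C \<union> D = X"
  proof (rule ccontr)
    assume "C \<union> D \<noteq> X"
    then obtain x y where xy: "x \<in> C \<union> D" "y \<in> X - (C \<union> D)" "R x y"
      using connD[OF X(2), of "C \<union> D"] o by (auto simp: ok_def)
    have bigger: "card (insert y (C \<union> D)) = Suc (card (C \<union> D))" using fin xy(2) by simp
    show False
    proof (cases "x \<in> C")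
      case True
      have "card (insert y D) \<ge> 3" using o fin xy(2) by (auto simp: ok_def)
      then have "ok C (insert y D)" using o xy True unfolding ok_def by blast
      then show False using mx[of C "insert y D"] bigger by simp
    next
      case False
      then have xD: "x \<in> D" using xy(1) by blast
      obtain c where c: "c \<in> C" "R c x" using o xD unfolding ok_def by blast
      have "conn R (insert x C)" by (rule conn_insert[where R = R, OF sym _ c]) (use o in \<open>auto simp: ok_def\<close>)
      moreover have "card (insert y (D - {x})) = Suc (card (D - {x}))"
        using fin xy(2) by (intro card_insert_disjoint) auto
      then have "card (insert y (D - {x})) = card D" by (simp only: card_Suc_Diff1[OF fin(2) xD])
      moreover have "\<forall>d\<in>insert y (D - {x}). \<exists>c\<in>insert x C. R c d" using o xy(3) unfolding ok_def by blast
      moreover have "insert x C \<subseteq> X" "insert y (D - {x}) \<subseteq> X" "insert x C \<inter> insert y (D - {x}) = {}"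
        "3 \<le> card D"
        using o xy xD unfolding ok_def by blast+
      ultimately have "ok (insert x C) (insert y (D - {x}))" unfolding ok_def by simp
      moreover have "insert x C \<union> insert y (D - {x}) = insert y (C \<union> D)" using xD by blast
      ultimately show False using mx[of "insert x C" "insert y (D - {x})"] bigger by simp
    qed
  qed
  then have "X - C = D" using o by (auto simp: ok_def)
  then show ?thesis using o by (auto simp: ok_def)
qed

context similitude_system
begin

text \<open>
  The dichotomy of the construction: if no level is branching, then the graph of every level is
  connected with at most two neighbours for each cell, hence a path or a cycle.
\<close>

definition branching where
  "branching A k \<longleftrightarrow> (\<exists>v\<in>words N k. \<exists>E\<subseteq>words N k. card E = 3 \<and> v \<notin> E \<and> (\<forall>e\<in>E. adj A v e))"

lemma adj_symD: "adj A I J \<Longrightarrow> adj A J I"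
  using adj_sym by blast

lemma adj_refl: "A \<noteq> {} \<Longrightarrow> adj A I I"
  by (auto simp: adj_def)

lemma conn_append: "conn (adj A) C \<Longrightarrow> conn (adj A) ((\<lambda>u. I @ u) ` C)"
  unfolding conn_def
proof (intro allI impI)
  fix P assume C: "\<forall>P. P \<subseteq> C \<and> P \<noteq> {} \<and> P \<noteq> C \<longrightarrow> (\<exists>x\<in>P. \<exists>y\<in>C - P. adj A x y)"
    and P: "P \<subseteq> (\<lambda>u. I @ u) ` C \<and> P \<noteq> {} \<and> P \<noteq> (\<lambda>u. I @ u) ` C"
  define Q where "Q = {u \<in> C. I @ u \<in> P}"
  have PQ: "P = (\<lambda>u. I @ u) ` Q" using P by (auto simp: Q_def)
  then have "Q \<subseteq> C \<and> Q \<noteq> {} \<and> Q \<noteq> C" using P by (auto simp: Q_def)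
  then obtain x y where xy: "x \<in> Q" "y \<in> C - Q" "adj A x y" using C by blast
  then have "I @ x \<in> P" "I @ y \<in> (\<lambda>u. I @ u) ` C - P" using PQ by auto
  then show "\<exists>x\<in>P. \<exists>y\<in>(\<lambda>u. I @ u) ` C - P. adj A x y" using adj_append[OF xy(3), of I] by blast
qed

text \<open>
  Replacing each vertex of a spanning tree of the \<open>n\<close>-th level by a copy of a dominating set that misses
  three cells, and adding the cells needed for the connections, of which there are two for each
  edge of the tree, leaves out at least one cell in each copy on average.
\<close>

lemma core_exists:
  assumes A: "skeleton A" and br: "branching A k" and n: "card A < N ^ n"
  shows "\<exists>C\<subseteq>words N (n + k). conn (adj A) C \<and> C \<noteq> {} \<and> words N (n + k) - C \<noteq> {} \<and>
     (\<forall>L\<in>words N (n + k) - C. \<exists>J\<in>C. adj A J L) \<and> (\<forall>a\<in>A. \<exists>J\<in>C. a \<in> word_map S J ` A)"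
proof -
  let ?X = "words N (n + k)"
  have Ane: "A \<noteq> {}" and finA: "finite A" using A by (auto simp: skeleton_def)
  obtain v E where v: "v \<in> words N k" "E \<subseteq> words N k" "card E = 3" "v \<notin> E" "\<forall>e\<in>E. adj A v e"
    using br by (auto simp: branching_def)
  obtain C0 where C0: "C0 \<subseteq> words N k" "conn (adj A) C0" "C0 \<noteq> {}" "\<forall>x\<in>words N k - C0. \<exists>c\<in>C0. adj A c x"
      "3 \<le> card (words N k - C0)"
    using three_leaves[OF adj_symD finite_words conn_words[OF A] v(1-4)] v(5) by blast
  have dom0: "\<exists>c\<in>C0. adj A c u" if "u \<in> words N k" for u
    using C0(4) that adj_refl[OF Ane] by (cases "u \<in> C0") auto
  define blk where "blk I = (\<lambda>u. I @ u) ` C0" for I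
  have connblk: "conn (adj A) (blk I)" for I unfolding blk_def by (rule conn_append[OF C0(2)])
  have domblk: "\<exists>c\<in>blk I. adj A c (I @ u)" if "u \<in> words N k" for I u
    using dom0[OF that] adj_append unfolding blk_def by blast
  obtain I0 where I0: "I0 \<in> words N n"
    using n card_words[of N n] by (metis card.empty equals0I not_less_zero)
  have "\<exists>Z. finite Z \<and> Z \<subseteq> ?X \<and> card Z \<le> 2 * card (words N n) \<and> conn (adj A) (Z \<union> (\<Union>I\<in>words N n. blk I))"
  proof (rule conn_induct[OF finite_words conn_words[OF A] I0,
      where P = "\<lambda>Y. \<exists>Z. finite Z \<and> Z \<subseteq> ?X \<and> card Z \<le> 2 * card Y \<and> conn (adj A) (Z \<union> (\<Union>I\<in>Y. blk I))"])
    show "\<exists>Z. finite Z \<and> Z \<subseteq> ?X \<and> card Z \<le> 2 * card {I0} \<and> conn (adj A) (Z \<union> (\<Union>I\<in>{I0}. blk I))"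
      using connblk by (intro exI[of _ "{}"]) auto
    fix Y I J assume Y: "Y \<subseteq> words N n" "I0 \<in> Y"
      "\<exists>Z. finite Z \<and> Z \<subseteq> ?X \<and> card Z \<le> 2 * card Y \<and> conn (adj A) (Z \<union> (\<Union>I\<in>Y. blk I))"
      "I \<in> Y" "J \<in> words N n - Y" "adj A I J"
    then obtain Z where Z: "finite Z" "Z \<subseteq> ?X" "card Z \<le> 2 * card Y" "conn (adj A) (Z \<union> (\<Union>I\<in>Y. blk I))" by blast
    obtain u w where uw: "u \<in> words N k" "w \<in> words N k" "adj A (I @ u) (J @ w)"
      using adj_refine[OF A Y(6)] by blast
    let ?Z = "insert (J @ w) (insert (I @ u) Z)"
    obtain c where c: "c \<in> blk I" "adj A c (I @ u)" using domblk[OF uw(1)] by blast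
    obtain d where d: "d \<in> blk J" "adj A d (J @ w)" using domblk[OF uw(2)] by blast
    let ?B = "\<Union>I\<in>Y. blk I"
    have cB: "c \<in> Z \<union> ?B" using c(1) Y(4) by auto
    have c1: "conn (adj A) (insert (I @ u) (Z \<union> ?B))"
      by (rule conn_insert[where R = "adj A", OF adj_symD Z(4) cB c(2)])
    have c2: "conn (adj A) (insert (J @ w) (insert (I @ u) (Z \<union> ?B)))"
      by (rule conn_insert[where R = "adj A", OF adj_symD c1 insertI1 uw(3)])
    have c3: "conn (adj A) (insert (J @ w) (insert (I @ u) (Z \<union> ?B)) \<union> blk J)"
      by (rule conn_Un[where R = "adj A", OF adj_symD c2 connblk insertI1 d(1) adj_symD[OF d(2)]])
    have "insert (J @ w) (insert (I @ u) (Z \<union> ?B)) \<union> blk J = ?Z \<union> (\<Union>I\<in>insert J Y. blk I)" by blast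
    then have "conn (adj A) (?Z \<union> (\<Union>I\<in>insert J Y. blk I))" using c3 by (simp only:)
    moreover have "card ?Z \<le> Suc (Suc (card Z))" by (simp add: card_insert_if Z(1))
    then have "card ?Z \<le> 2 * card (insert J Y)"
      using Z(3) Y(1,5) finite_subset[OF Y(1) finite_words] by simp
    moreover have "?Z \<subseteq> ?X" using Z(2) words_append[of I N n u k] words_append[of J N n w k] uw Y by auto
    moreover have "finite ?Z" using Z(1) by simp
    ultimately show "\<exists>Z. finite Z \<and> Z \<subseteq> ?X \<and> card Z \<le> 2 * card (insert J Y) \<and>
        conn (adj A) (Z \<union> (\<Union>I\<in>insert J Y. blk I))"
      by (intro exI[of _ ?Z] conjI)
  qed
  then obtain Z where Z: "finite Z" "Z \<subseteq> ?X" "card Z \<le> 2 * N ^ n" "conn (adj A) (Z \<union> (\<Union>I\<in>words N n. blk I))"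
    by (auto simp: card_words)
  let ?C1 = "Z \<union> (\<Union>I\<in>words N n. blk I)"
  have dom1: "\<exists>c\<in>?C1. adj A c w" if "w \<in> ?X" for w
  proof -
    obtain I u where "w = I @ u" "I \<in> words N n" "u \<in> words N k" using \<open>w \<in> ?X\<close> by (rule words_append_split)
    then show ?thesis using domblk[of u I] by blast
  qed
  have "\<exists>J\<in>?X. a \<in> word_map S J ` A" if "a \<in> A" for a using skeleton_cover[OF A, of "n + k"] that by blast
  then have "\<forall>a\<in>A. \<exists>J. J \<in> ?X \<and> a \<in> word_map S J ` A" by blast
  from bchoice[OF this] obtain h where h: "\<And>a. a \<in> A \<Longrightarrow> h a \<in> ?X \<and> a \<in> word_map S (h a) ` A" by blast
  define C where "C = ?C1 \<union> h ` A"
  have blkX: "blk I \<subseteq> ?X" if "I \<in> words N n" for I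
    using that C0(1) words_append[of I N n _ k] by (auto simp: blk_def)
  have CX: "C \<subseteq> ?X" using Z(2) blkX h unfolding C_def by blast
  have "conn (adj A) C"
    unfolding C_def using adj_symD Z(4) by (rule conn_Un_dominated) (use finA dom1 h in auto)
  moreover have "C \<noteq> {}" using Ane by (simp add: C_def)
  moreover have "\<forall>L\<in>?X - C. \<exists>J\<in>C. adj A J L"
  proof
    fix L assume "L \<in> ?X - C"
    then obtain c where "c \<in> ?C1" "adj A c L" by (metis DiffD1 dom1)
    moreover have "c \<in> C" using \<open>c \<in> ?C1\<close> unfolding C_def by (rule UnI1)
    ultimately show "\<exists>J\<in>C. adj A J L" by (intro bexI)
  qed
  moreover have "\<forall>a\<in>A. \<exists>J\<in>C. a \<in> word_map S J ` A"
  proof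
    fix a assume a: "a \<in> A"
    then have "h a \<in> C" unfolding C_def by simp
    then show "\<exists>J\<in>C. a \<in> word_map S J ` A" using h[OF a] by (intro bexI[of _ "h a"]) simp_all
  qed
  moreover have "?X - C \<noteq> {}"
  proof
    assume "?X - C = {}"
    define Y where "Y = (\<lambda>(I, u). I @ u) ` (words N n \<times> (words N k - C0))"
    let ?B = "\<Union>I\<in>words N n. blk I"
    have YX: "Y \<subseteq> ?X" unfolding Y_def by (auto intro: words_append)
    have YB: "Y \<inter> ?B = {}" unfolding Y_def blk_def by (auto simp: words_length)
    have XC: "?X \<subseteq> (Z \<union> ?B) \<union> h ` A" using \<open>?X - C = {}\<close> unfolding C_def by simp
    have "Y \<subseteq> Z \<union> h ` A"
    proof
      fix y assume y: "y \<in> Y"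
      have "y \<in> (Z \<union> ?B) \<union> h ` A" by (rule subsetD[OF XC subsetD[OF YX y]])
      then show "y \<in> Z \<union> h ` A"
      proof (elim UnE)
        assume "y \<in> ?B"
        then have "y \<in> Y \<inter> ?B" using y by (intro IntI)
        then show ?thesis unfolding YB by (rule emptyE)
      qed (rule UnI1, assumption, rule UnI2, assumption)
    qed
    then have "card Y \<le> card (Z \<union> h ` A)" using Z(1) finA by (intro card_mono) auto
    also have "\<dots> \<le> card Z + card (h ` A)" by (rule card_Un_le)
    also have "\<dots> \<le> 2 * N ^ n + card A" using Z(3) card_image_le[OF finA, of h] by simp
    finally have "card Y < 3 * N ^ n" using n by simp
    moreover have "card Y = N ^ n * card (words N k - C0)"
    proof -
      have "inj_on (\<lambda>(I, u). I @ u) (words N n \<times> (words N k - C0))"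
        by (rule inj_on_subset[OF inj_on_append_words[of N n k]]) auto
      then show ?thesis unfolding Y_def by (simp add: card_image card_words)
    qed
    moreover have "3 * N ^ n \<le> N ^ n * card (words N k - C0)" using C0(5) by (simp add: mult.commute)
    ultimately show False by simp
  qed
  ultimately show ?thesis using CX by (intro exI[of _ C] conjI)
qed

section \<open>Plans of trails in the branching case\<close>

abbreviation vertex where "vertex \<sigma> \<equiv> (\<lambda>J k. word_map S J (\<sigma> ! k))"

lemma cycle_system_vertex: "skeleton A \<Longrightarrow> set \<sigma> = A \<Longrightarrow> distinct \<sigma> \<Longrightarrow> cycle_system (card A)"
  by unfold_locales (auto simp: skeleton_def card_gt_0_iff)

text \<open>
  A path cannot move farther than the number of cells that it visits times the size of a cell: leaving a
  cell for the last time, it has moved at most by the diameter of this cell.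
\<close>

lemma path_displacement:
  assumes m: "cycle_system m" and \<sigma>: "length \<sigma> = m" "set \<sigma> \<subseteq> K"
    and p: "cycle_system.path (vertex \<sigma>) m a es b" "cycle_system.und ` set es \<subseteq> words N q \<times> {..<m}"
  shows "dist a b \<le> real (card (fst ` set es)) * (rmax ^ q * diamK)"
  using p
proof (induction "length es" arbitrary: a es rule: less_induct)
  case less
  interpret cycle_system "vertex \<sigma>" m by (rule m)
  show ?case
  proof (cases es)
    case Nil
    then show ?thesis using less.prems(1) by simp
  next
    case (Cons e es')
    let ?J = "fst e"
    have "\<exists>x\<in>set es. fst x = ?J" using Cons by simp
    from split_list_last_prop[OF this]
    obtain u e' w where w: "es = u @ e' # w" "fst e' = ?J" "\<forall>x\<in>set w. fst x \<noteq> ?J" by blast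
    have in_words: "fst x \<in> words N q" "fst (snd x) < m" if "x \<in> set es" for x
      using less.prems(2) that by (cases x; force)+
    have ends: "st x \<in> cell (fst x)" "en x \<in> cell (fst x)" if "x \<in> set es" for x
    proof -
      obtain J k c where x: "x = (J, k, c)" by (cases x)
      have "k < length \<sigma>" "Suc k mod m < length \<sigma>" using \<sigma>(1) in_words(2)[OF that] x m_pos by auto
      then have "\<sigma> ! k \<in> set \<sigma>" "\<sigma> ! (Suc k mod m) \<in> set \<sigma>" using nth_mem by blast+
      then have "\<sigma> ! k \<in> K" "\<sigma> ! (Suc k mod m) \<in> K" using \<sigma>(2) by blast+
      then show "st x \<in> cell (fst x)" "en x \<in> cell (fst x)" by (auto simp: x cell_def)
    qed
    have "path (en e') w b" using less.prems(1) unfolding w(1) by (auto simp: path_append)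
    moreover have "length w < length es" using w(1) by simp
    ultimately have "dist (en e') b \<le> real (card (fst ` set w)) * (rmax ^ q * diamK)"
      using less.hyps[of w "en e'"] less.prems(2) w(1) by auto
    moreover have "dist a (en e') \<le> rmax ^ q * diamK"
    proof (rule dist_cell_le_level)
      show "?J \<in> words N q" using in_words(1)[of e] Cons by simp
      show "a \<in> cell ?J" using ends(1)[of e] less.prems(1) Cons by auto
      show "en e' \<in> cell ?J" using ends(2)[of e'] w(1,2) by simp
    qed
    moreover have "card (fst ` set w) + 1 \<le> card (fst ` set es)"
    proof -
      have "card (insert ?J (fst ` set w)) = Suc (card (fst ` set w))" using w(3) by (subst card_insert_disjoint) auto
      moreover have "insert ?J (fst ` set w) \<subseteq> fst ` set es" using w(1,2) by (auto simp: image_iff)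
      then have "card (insert ?J (fst ` set w)) \<le> card (fst ` set es)" by (intro card_mono) auto
      ultimately show ?thesis by simp
    qed
    then have "(real (card (fst ` set w)) + 1) * (rmax ^ q * diamK) \<le> real (card (fst ` set es)) * (rmax ^ q * diamK)"
      using rmax_pos diamK_nonneg by (intro mult_right_mono) auto
    ultimately show ?thesis using dist_triangle[of a b "en e'"] by (simp add: algebra_simps)
  qed
qed

lemma branching_level:
  assumes A: "skeleton A" and br: "branching A k"
  shows "\<exists>q n. 0 < q \<and> q = n + k \<and> card A < N ^ n \<and>
     (\<forall>a\<in>A. \<forall>b\<in>A. a \<noteq> b \<longrightarrow> 2 ^ card A * (rmax ^ q * diamK) < dist a b)"
proof -
  have finA: "finite A" using A by (simp add: skeleton_def)
  have "(\<lambda>q. 2 ^ card A * (rmax ^ q * diamK)) \<longlonglongrightarrow> 0"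
    using rmax_power_tendsto_0 by (intro tendsto_mult_right_zero tendsto_mult_left_zero)
  then have "eventually (\<lambda>q. 2 ^ card A * (rmax ^ q * diamK) < dist a b) sequentially" if "a \<noteq> b" for a b
    using that by (intro order_tendstoD(2)[of _ 0]) auto
  then have "eventually (\<lambda>q. \<forall>a\<in>A. \<forall>b\<in>A. a \<noteq> b \<longrightarrow> 2 ^ card A * (rmax ^ q * diamK) < dist a b) sequentially"
    using finA by (intro eventually_ball_finite ballI) (auto intro: eventually_mono)
  then obtain q0 where q0: "\<And>q. q \<ge> q0 \<Longrightarrow> \<forall>a\<in>A. \<forall>b\<in>A. a \<noteq> b \<longrightarrow> 2 ^ card A * (rmax ^ q * diamK) < dist a b"
    by (auto simp: eventually_sequentially)
  define n where "n = Suc (q0 + card A)"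
  have "card A < 2 ^ card A" by simp
  also have "(2::nat) ^ card A \<le> N ^ card A" using N_ge_2 by (rule power_mono) simp
  also have "\<dots> \<le> N ^ n" using N_ge_2 by (intro power_increasing) (auto simp: n_def)
  finally show ?thesis using q0[of "n + k"] by (intro exI[of _ "n + k"] exI[of _ n]) (auto simp: n_def)
qed

text \<open>
  The trail of index \<open>i\<close> replaces the segment from the \<open>i\<close>-th skeleton point to the next one by a walk
  through smaller cells. Every trail contains a segment of type \<open>g'\<close>, and the trail that replaces a
  segment of type \<open>g\<close> contains all segments of one cell. Two consecutive plans therefore provide a cell
  that is visited by the descendants of a single segment.
\<close>

definition planned where
  "planned A q \<sigma> g \<sigma>' g' \<tau>s \<longleftrightarrow>
     cycle_system.trails (vertex \<sigma>') (card A) \<sigma> \<tau>s \<and> cycle_system.uses (card A) (words N q) \<tau>s \<and>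
     (\<forall>i<card A. cycle_system.good g' (\<tau>s ! i)) \<and>
     (\<exists>L\<in>words N q. \<forall>k<card A. \<exists>b. (L, k, b) \<in> set (\<tau>s ! g))"

definition states where "states A = {(\<sigma>, g). distinct \<sigma> \<and> set \<sigma> = A \<and> g < card A}"

lemma plan_step:
  assumes A: "skeleton A" and br: "branching A k" and q: "q = n + k" "card A < N ^ n"
    and far: "\<forall>a\<in>A. \<forall>b\<in>A. a \<noteq> b \<longrightarrow> 2 ^ card A * (rmax ^ q * diamK) < dist a b"
    and s: "(\<sigma>', g') \<in> states A"
  shows "\<exists>\<sigma> g \<tau>s. (\<sigma>, g) \<in> states A \<and> planned A q \<sigma> g \<sigma>' g' \<tau>s"
proof -
  have \<sigma>': "distinct \<sigma>'" "set \<sigma>' = A" "g' < card A" using s by (auto simp: states_def)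
  have len: "length \<sigma>' = card A" using \<sigma>'(1,2) distinct_card by metis
  have AK: "A \<subseteq> K" "finite A" using A by (auto simp: skeleton_def)
  have cs: "cycle_system (card A)" by (rule cycle_system_vertex[OF A \<sigma>'(2,1)])
  interpret cycle_system "vertex \<sigma>'" "card A" by (rule cs)
  have nthA: "a \<in> A \<longleftrightarrow> (\<exists>l<card A. a = \<sigma>' ! l)" for a
    using \<sigma>'(2) len by (auto simp: in_set_conv_nth)
  have meets: "meets = adj A"
  proof (intro ext iffI)
    fix I J assume "meets I J"
    then show "adj A I J" unfolding meets_def adj_def using nthA by blast
  next
    fix I J assume "adj A I J"
    then obtain a b where "a \<in> A" "b \<in> A" "word_map S I a = word_map S J b" by (auto simp: adj_def)
    then show "meets I J" unfolding meets_def using nthA by metis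
  qed
  obtain C where C: "C \<subseteq> words N q" "conn (adj A) C" "C \<noteq> {}" "words N q - C \<noteq> {}"
     "\<forall>L\<in>words N q - C. \<exists>J\<in>C. adj A J L" "\<forall>a\<in>A. \<exists>J\<in>C. a \<in> word_map S J ` A"
    using core_exists[OF A br q(2)] q(1) by blast
  have "\<exists>as \<tau>s h. trails as \<tau>s \<and> uses (words N q) \<tau>s \<and> distinct as \<and> set as = A \<and>
     (\<forall>i<card A. good g' (\<tau>s ! i)) \<and> h < card A \<and> (\<exists>L\<in>words N q. \<forall>k<card A. \<exists>b. (L, k, b) \<in> set (\<tau>s ! h))"
  proof (rule trail_plan[OF finite_words C(1,3,4)])
    show "conn meets C" unfolding meets by (rule C(2))
    show "\<exists>J\<in>C. meets J L" if "L \<in> words N q - C" for L unfolding meets using C(5) that by blast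
    show "\<exists>J\<in>C. \<exists>k<card A. a = word_map S J (\<sigma>' ! k)" if aA: "a \<in> A" for a
    proof -
      obtain J where J: "J \<in> C" "a \<in> word_map S J ` A" using C(6) aA by blast
      then obtain b where b: "b \<in> A" "a = word_map S J b" by blast
      obtain l where "l < card A" "b = \<sigma>' ! l" using nthA[of b] b(1) by blast
      then show ?thesis using J(1) b(2) by blast
    qed
    show "2 ^ card A < card (fst ` set es)" if "a \<in> A" "b \<in> A" "a \<noteq> b" "path a es b"
      "und ` set es \<subseteq> words N q \<times> {..<card A}" for a b es
    proof (rule ccontr)
      assume "\<not> 2 ^ card A < card (fst ` set es)"
      then have "card (fst ` set es) \<le> 2 ^ card A" by simp
      then have le: "real (card (fst ` set es)) \<le> 2 ^ card A" by (metis of_nat_le_iff of_nat_numeral of_nat_power)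
      have "dist a b \<le> real (card (fst ` set es)) * (rmax ^ q * diamK)"
        by (rule path_displacement[OF cs len _ that(4,5)]) (use \<sigma>'(2) AK in simp)
      also have "\<dots> \<le> 2 ^ card A * (rmax ^ q * diamK)"
        using le rmax_pos diamK_nonneg by (intro mult_right_mono) auto
      finally show False using bspec[OF bspec[OF far that(1)] that(2)] that(3) by linarith
    qed
  qed (use AK \<sigma>'(3) in auto)
  then obtain as \<tau>s h where p: "trails as \<tau>s" "uses (words N q) \<tau>s" "distinct as" "set as = A"
     "\<forall>i<card A. good g' (\<tau>s ! i)" "h < card A"
     "\<exists>L\<in>words N q. \<forall>k<card A. \<exists>b. (L, k, b) \<in> set (\<tau>s ! h)"
    by (elim exE conjE)
  have "(as, h) \<in> states A" using p(3,4,6) by (simp add: states_def)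
  moreover have "planned A q as h \<sigma>' g' \<tau>s" unfolding planned_def by (intro conjI p)
  ultimately show ?thesis by (intro exI conjI)
qed

text \<open>
  The orbit of a point in a finite set runs into a cycle, and a cycle can be followed backwards.
\<close>

lemma backward_orbit:
  assumes "finite X" "x0 \<in> X" "\<And>x. x \<in> X \<Longrightarrow> F x \<in> X"
  shows "\<exists>s. \<forall>n::nat. s n \<in> X \<and> F (s (Suc n)) = s n"
proof -
  have in_X: "(F ^^ i) x0 \<in> X" for i using assms(2,3) by (induction i) auto
  have "finite (range (\<lambda>i. (F ^^ i) x0))" by (rule finite_subset[OF _ assms(1)]) (use in_X in auto)
  then have "\<not> inj (\<lambda>i. (F ^^ i) x0)" using finite_imageD infinite_UNIV_nat by blast
  then obtain i j where "i \<noteq> j" "(F ^^ i) x0 = (F ^^ j) x0" by (auto simp: inj_def)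
  then have "\<exists>i j. i < j \<and> (F ^^ i) x0 = (F ^^ j) x0" by (metis linorder_neqE_nat)
  then obtain i j where ij: "i < j" "(F ^^ i) x0 = (F ^^ j) x0" by blast
  define y where "y = (F ^^ i) x0"
  have "(F ^^ ((j - i) + i)) x0 = (F ^^ i) x0" using ij by simp
  then have y: "(F ^^ (j - i)) y = y" unfolding y_def by (simp only: funpow_add comp_apply)
  define p where "p = j - i - 1"
  have yp: "(F ^^ Suc p) y = y" using y ij(1) by (simp add: p_def Suc_diff_Suc)
  define s where "s n = (F ^^ (n * p)) y" for n
  have "s n \<in> X" for n
    using in_X[of "n * p + i"] by (simp add: s_def y_def funpow_add)
  moreover have "F (s (Suc n)) = s n" for n
  proof -
    have "F (s (Suc n)) = (F ^^ (n * p + Suc p)) y" by (simp add: s_def add.commute)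
    also have "\<dots> = (F ^^ (n * p)) ((F ^^ Suc p) y)" by (simp only: funpow_add comp_apply)
    finally show ?thesis by (simp only: yp s_def)
  qed
  ultimately show ?thesis by blast
qed

text \<open>
  Plans are built from fine to coarse: the order in which the finer cells are traversed determines
  the order of the skeleton points in the coarser one. As there are finitely many
  orders, a periodic one provides plans for all levels.
\<close>

lemma plan_sequence:
  assumes A: "skeleton A" and br: "branching A k"
  shows "\<exists>q \<sigma> g \<tau>. 0 < q \<and> (\<forall>n::nat. (\<sigma> n, g n) \<in> states A \<and> planned A q (\<sigma> n) (g n) (\<sigma> (Suc n)) (g (Suc n)) (\<tau> n))"
proof -
  obtain q n where q: "0 < q" "q = n + k" "card A < N ^ n"
    "\<forall>a\<in>A. \<forall>b\<in>A. a \<noteq> b \<longrightarrow> 2 ^ card A * (rmax ^ q * diamK) < dist a b"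
    using branching_level[OF A br] by (elim exE conjE)
  have A': "finite A" "A \<noteq> {}" using A by (auto simp: skeleton_def)
  have "\<forall>x\<in>states A. \<exists>y. y \<in> states A \<and> (\<exists>\<tau>s. planned A q (fst y) (snd y) (fst x) (snd x) \<tau>s)"
  proof
    fix x assume "x \<in> states A"
    then have "(fst x, snd x) \<in> states A" by simp
    from plan_step[OF A br q(2-4) this]
    obtain \<sigma> g \<tau>s where "(\<sigma>, g) \<in> states A" "planned A q \<sigma> g (fst x) (snd x) \<tau>s"
      by (elim exE conjE)
    then show "\<exists>y. y \<in> states A \<and> (\<exists>\<tau>s. planned A q (fst y) (snd y) (fst x) (snd x) \<tau>s)"
      by (intro exI[of _ "(\<sigma>, g)"]) auto
  qed
  from bchoice[OF this] obtain F where F: "\<And>x. x \<in> states A \<Longrightarrow> F x \<in> states A"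
    "\<And>x. x \<in> states A \<Longrightarrow> \<exists>\<tau>s. planned A q (fst (F x)) (snd (F x)) (fst x) (snd x) \<tau>s"
    by blast
  have fin: "finite (states A)"
  proof (rule finite_subset)
    show "states A \<subseteq> {\<sigma>. set \<sigma> \<subseteq> A \<and> length \<sigma> = card A} \<times> {..<card A}"
      by (auto simp: states_def distinct_card)
    show "finite ({\<sigma>. set \<sigma> \<subseteq> A \<and> length \<sigma> = card A} \<times> {..<card A})"
      using finite_lists_length_eq[OF A'(1)] by (intro finite_cartesian_product) simp_all
  qed
  obtain \<sigma>0 where "set \<sigma>0 = A" "distinct \<sigma>0" using finite_distinct_list[OF A'(1)] by blast
  then have x0: "(\<sigma>0, 0) \<in> states A" using A' by (auto simp: states_def card_gt_0_iff)
  obtain s where s: "\<And>n::nat. s n \<in> states A" "\<And>n. F (s (Suc n)) = s n"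
    using backward_orbit[where F = F, OF fin x0 F(1)] by blast
  have "\<exists>\<tau>s. planned A q (fst (s n)) (snd (s n)) (fst (s (Suc n))) (snd (s (Suc n))) \<tau>s" for n
    using F(2)[OF s(1), of "Suc n"] s(2) by simp
  then have "\<forall>n. \<exists>\<tau>s. planned A q (fst (s n)) (snd (s n)) (fst (s (Suc n))) (snd (s (Suc n))) \<tau>s" by blast
  from choice[OF this]
  obtain \<tau> where "\<And>n. planned A q (fst (s n)) (snd (s n)) (fst (s (Suc n))) (snd (s (Suc n))) (\<tau> n)" by blast
  then show ?thesis using q(1) s(1)
    by (intro exI[of _ q] exI[of _ "\<lambda>n. fst (s n)"] exI[of _ "\<lambda>n. snd (s n)"] exI[of _ \<tau>]) auto
qed

end

section \<open>Pieces in the branching case\<close>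

lemma distinct_concat_mapI:
  assumes "distinct (map h xs)" "\<And>x. x \<in> set xs \<Longrightarrow> distinct (f x)"
    "\<And>x y. \<lbrakk>x \<in> set xs; y \<in> set xs; h x \<noteq> h y\<rbrakk> \<Longrightarrow> set (f x) \<inter> set (f y) = {}"
  shows "distinct (concat (map f xs))"
  using assms
proof (induction xs)
  case (Cons x xs)
  have "set (f x) \<inter> set (concat (map f xs)) = {}"
  proof (intro equals0I)
    fix z assume z: "z \<in> set (f x) \<inter> set (concat (map f xs))"
    then obtain y where y: "y \<in> set xs" "z \<in> set (f y)" by auto
    then have "h x \<noteq> h y" using Cons.prems(1) by (metis distinct.simps(2) image_eqI list.simps(9) set_map)
    then have "set (f x) \<inter> set (f y) = {}" using Cons.prems(3) y(1) by simp
    then show False using z y(2) by auto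
  qed
  moreover have "distinct (concat (map f xs))"
    by (rule Cons.IH) (use Cons.prems in auto)
  ultimately show ?case using Cons.prems(2)[of x] by simp
qed simp

lemma distinct_concat_nth:
  assumes "distinct (concat ys)" "i < length ys"
  shows "distinct (ys ! i)" "\<lbrakk>j < length ys; i \<noteq> j\<rbrakk> \<Longrightarrow> set (ys ! i) \<inter> set (ys ! j) = {}"
proof -
  obtain X Z where "concat (ys[i := ys ! i]) = X @ ys ! i @ Z" using concat_split1[OF assms(2)] by blast
  then have "concat ys = X @ ys ! i @ Z" by (simp only: list_update_id)
  then show "distinct (ys ! i)" using assms(1) by simp
  have *: "set (ys ! a) \<inter> set (ys ! b) = {}" if ab: "a < b" "b < length ys" for a b
  proof -
    obtain X Y Z where "concat (ys[a := ys ! a, b := ys ! b]) = X @ ys ! a @ Y @ ys ! b @ Z"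
      using concat_split2[OF ab] by blast
    then have "concat ys = X @ ys ! a @ Y @ ys ! b @ Z" by (simp only: list_update_id)
    then show ?thesis using assms(1) by auto
  qed
  show "set (ys ! i) \<inter> set (ys ! j) = {}" if "j < length ys" "i \<noteq> j"
    using *[of i j] *[of j i] that assms(2) by (cases "i < j") (auto simp: Int_commute)
qed

context moran_system
begin

text \<open>
  A piece \<open>(w, k, b)\<close> is the segment from the \<open>k\<close>-th skeleton point to the next one in the cell of \<open>w\<close>,
  traversed backwards if \<open>b\<close> is false; its children form the planned trail. The trail contains a
  segment of the distinguished type in some subcell \<open>J\<close>, and the trail of that segment contains all
  segments of a subcell \<open>L\<close>, so the piece owns the cell of \<open>w @ J @ L\<close>.
\<close>

lemma piece_system_branching:
  assumes A: "skeleton A" and br: "branching A k0"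
  shows "\<exists>q (L0 :: (nat list \<times> nat \<times> bool) list) ch wd. piece_system N S r K s q L0 ch wd"
proof -
  obtain q \<sigma> g \<tau> where q: "0 < q" and
    pl: "\<And>n::nat. (\<sigma> n, g n) \<in> states A" "\<And>n. planned A q (\<sigma> n) (g n) (\<sigma> (Suc n)) (g (Suc n)) (\<tau> n)"
    using plan_sequence[OF A br] by metis
  define m where "m = card A"
  have \<sigma>: "distinct (\<sigma> n)" "set (\<sigma> n) = A" "g n < m" "length (\<sigma> n) = m" for n
  proof -
    show 1: "distinct (\<sigma> n)" "set (\<sigma> n) = A" "g n < m" using pl(1)[of n] by (auto simp: states_def m_def)
    show "length (\<sigma> n) = m" using 1(1,2) distinct_card m_def by metis
  qed
  have cs: "cycle_system m" unfolding m_def by (rule cycle_system_vertex[OF A \<sigma>(2) \<sigma>(1)])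
  have m: "0 < m" using cs by (simp add: cycle_system_def)
  have AK: "A \<subseteq> K" using A by (simp add: skeleton_def)
  have \<sigma>K: "\<sigma> n ! i \<in> K" if "i < m" for n i using \<sigma>(2,4)[of n] AK nth_mem[of i "\<sigma> n"] that by auto
  have len: "length (\<tau> n) = m" for n
    using pl(2)[of n] unfolding planned_def m_def[symmetric] cycle_system.trails_def[OF cs] by blast
  have pth: "cycle_system.path (vertex (\<sigma> (Suc n))) m (\<sigma> n ! i) (\<tau> n ! i) (\<sigma> n ! (Suc i mod m))" if "i < m" for n i
    using pl(2)[of n] that unfolding planned_def m_def[symmetric] cycle_system.trails_def[OF cs] by blast
  have us: "distinct (map cycle_system.und (concat (\<tau> n)))"
    "set (map cycle_system.und (concat (\<tau> n))) = words N q \<times> {..<m}" for n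
    using pl(2)[of n] unfolding planned_def m_def[symmetric] cycle_system.uses_def[OF cs] by blast+
  have gd: "\<exists>J b. (J, g (Suc n), b) \<in> set (\<tau> n ! i)" if "i < m" for n i
    using pl(2)[of n] that unfolding planned_def m_def[symmetric] cycle_system.good_def[OF cs] by blast
  have pure: "\<exists>L\<in>words N q. \<forall>k<m. \<exists>b. (L, k, b) \<in> set (\<tau> n ! g n)" for n
    using pl(2)[of n] unfolding planned_def m_def[symmetric] by blast
  define U where "U n i = set (map cycle_system.und (\<tau> n ! i))" for n i
  have U_iff: "(J, l) \<in> U n i \<longleftrightarrow> (\<exists>b. (J, l, b) \<in> set (\<tau> n ! i))" for J l n i
  proof
    show "(J, l) \<in> U n i \<Longrightarrow> \<exists>b. (J, l, b) \<in> set (\<tau> n ! i)"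
      unfolding U_def by (rule cycle_system.und_mem[OF cs])
    assume "\<exists>b. (J, l, b) \<in> set (\<tau> n ! i)"
    then obtain b where "(J, l, b) \<in> set (\<tau> n ! i)" ..
    then have "cycle_system.und (J, l, b) \<in> U n i" unfolding U_def list.set_map by (rule imageI)
    then show "(J, l) \<in> U n i" unfolding cycle_system.und.simps[OF cs] .
  qed
  have mapmap: "map cycle_system.und (concat (\<tau> n)) = concat (map (map cycle_system.und) (\<tau> n))" for n
    by (rule map_concat)
  have dist1: "distinct (map cycle_system.und (\<tau> n ! i))" if "i < m" for n i
    using distinct_concat_nth(1)[of "map (map cycle_system.und) (\<tau> n)" i] us(1)[of n] that len unfolding mapmap by simp
  have dist2: "U n i \<inter> U n j = {}" if "i < m" "j < m" "i \<noteq> j" for n i j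
    using distinct_concat_nth(2)[of "map (map cycle_system.und) (\<tau> n)" i j] us(1)[of n] that len
    unfolding mapmap U_def by simp
  have U_all: "(\<Union>i<m. U n i) = words N q \<times> {..<m}" for n
  proof -
    have "set (\<tau> n) = (\<lambda>i. \<tau> n ! i) ` {..<m}" using len[of n] by (auto simp: set_conv_nth)
    then have "set (map cycle_system.und (concat (\<tau> n))) = (\<Union>i<m. U n i)"
      by (simp add: U_def image_UN)
    then show ?thesis using us(2)[of n] by (simp only:)
  qed
  have cov: "\<exists>i<m. (J, l) \<in> U n i" if "J \<in> words N q" "l < m" for J l n
    using U_all[of n] that by blast
  have inw: "J \<in> words N q \<and> l < m" if "(J, l) \<in> U n i" "i < m" for J l n i
    using U_all[of n] that by blast
  define \<rho> where "\<rho> n i o' = (if o' then \<tau> n ! i else cycle_system.rv (\<tau> n ! i))" for n i o'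
  have \<rho>und: "set (map cycle_system.und (\<rho> n i o')) = set (map cycle_system.und (\<tau> n ! i))"
    "distinct (map cycle_system.und (\<rho> n i o')) = distinct (map cycle_system.und (\<tau> n ! i))" for n i o'
    by (simp_all add: \<rho>_def cycle_system.rv_maps(1)[OF cs] del: set_map list.set_map)
  have \<rho>mem: "(\<exists>b. (J, l, b) \<in> set (\<rho> n i o')) \<longleftrightarrow> (\<exists>b. (J, l, b) \<in> set (\<tau> n ! i))" for J l n i o'
  proof -
    have "(\<exists>b. (J, l, b) \<in> set es) \<longleftrightarrow> (J, l) \<in> set (map cycle_system.und es)" for es :: "(nat list \<times> nat \<times> bool) list"
      using cycle_system.und_mem[OF cs, of J l es] by (force simp: cycle_system.und.simps[OF cs])
    then show ?thesis using \<rho>und(1) by simp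
  qed
  define ch :: "nat list \<times> nat \<times> bool \<Rightarrow> (nat list \<times> nat \<times> bool) list" where
    "ch = (\<lambda>(w, k, o'). map (\<lambda>(J, l, b). (w @ J, l, b)) (\<rho> (length w div q) k o'))"
  define L0 :: "(nat list \<times> nat \<times> bool) list" where "L0 = map (\<lambda>k. ([], k, True)) [0..<m]"
  define wk :: "nat list \<times> nat \<times> bool \<Rightarrow> nat list \<times> nat" where "wk = (\<lambda>(w, k, o'). (w, k))"
  let ?lv = "chain_level L0 ch"
  have ch_eq: "ch (w, k, o') = map (\<lambda>(J, l, b). (w @ J, l, b)) (\<rho> n k o')" if "w \<in> words N (n * q)" for w k o' n
    using that q by (simp add: ch_def words_length)
  have ch_wk: "set (map wk (ch (w, k, o'))) = (\<lambda>(J, l). (w @ J, l)) ` U n k"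
    "distinct (map wk (ch (w, k, o')))"
    if w: "w \<in> words N (n * q)" and k: "k < m" for w k o' n
  proof -
    have eq: "map wk (ch (w, k, o')) = map (\<lambda>(J, l). (w @ J, l)) (map cycle_system.und (\<rho> n k o'))"
      unfolding ch_eq[OF w] by (auto simp: wk_def cycle_system.und.simps[OF cs])
    have d: "distinct (map cycle_system.und (\<rho> n k o'))" unfolding \<rho>und(2) by (rule dist1[OF k])
    show "set (map wk (ch (w, k, o'))) = (\<lambda>(J, l). (w @ J, l)) ` U n k"
      by (simp only: eq U_def list.set_map \<rho>und(1)[unfolded list.set_map])
    show "distinct (map wk (ch (w, k, o')))"
      unfolding eq by (subst distinct_map) (intro conjI d inj_onI, auto split: prod.splits)
  qed
  have ch_mem: "(\<exists>b. (v, l, b) \<in> set (ch (w, k, o'))) \<longleftrightarrow> (\<exists>J. v = w @ J \<and> (J, l) \<in> U n k)"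
    if w: "w \<in> words N (n * q)" and k: "k < m" for v l w k o' n
  proof -
    have "(\<exists>b. (v, l, b) \<in> set (ch (w, k, o'))) \<longleftrightarrow> (v, l) \<in> set (map wk (ch (w, k, o')))"
      by (force simp: wk_def)
    then show ?thesis unfolding ch_wk(1)[OF w k] by auto
  qed
  have lev: "set (map wk (?lv n)) = words N (n * q) \<times> {..<m} \<and> distinct (map wk (?lv n))" for n
  proof (induction n)
    case 0
    have "map wk L0 = map (\<lambda>k. ([], k)) [0..<m]" by (simp add: L0_def wk_def)
    then show ?case unfolding chain_level.simps(1) by (simp only:) (auto simp: distinct_map inj_on_def)
  next
    case (Suc n)
    have mem: "w \<in> words N (n * q) \<and> k < m" if "(w, k, o') \<in> set (?lv n)" for w k o'
    proof -
      have "wk (w, k, o') \<in> wk ` set (?lv n)" using that by (rule imageI)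
      then show ?thesis unfolding list.set_map[symmetric] conjunct1[OF Suc] by (simp add: wk_def)
    qed
    have eq: "map wk (?lv (Suc n)) = concat (map (\<lambda>p. map wk (ch p)) (?lv n))" by (simp add: map_concat o_def)
    have "distinct (concat (map (\<lambda>p. map wk (ch p)) (?lv n)))"
    proof (rule distinct_concat_mapI[where h = wk])
      show "distinct (map wk (?lv n))" using Suc by blast
      show "distinct (map wk (ch p))" if "p \<in> set (?lv n)" for p
        using ch_wk(2) mem that by (cases p) blast
      fix p p' assume p: "p \<in> set (?lv n)" "p' \<in> set (?lv n)" "wk p \<noteq> wk p'"
      obtain w k b w' k' b' where pp: "p = (w, k, b)" "p' = (w', k', b')" by (cases p, cases p')
      have W: "w \<in> words N (n * q)" "k < m" "w' \<in> words N (n * q)" "k' < m" using mem p(1,2) pp by blast+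
      show "set (map wk (ch p)) \<inter> set (map wk (ch p')) = {}"
      proof (intro equals0I)
        fix z assume "z \<in> set (map wk (ch p)) \<inter> set (map wk (ch p'))"
        then have zz: "z \<in> (\<lambda>(J, l). (w @ J, l)) ` U n k" "z \<in> (\<lambda>(J, l). (w' @ J, l)) ` U n k'"
          unfolding pp ch_wk(1)[OF W(1,2)] ch_wk(1)[OF W(3,4)] by blast+
        obtain J l where z1: "z = (w @ J, l)" "(J, l) \<in> U n k" using zz(1) by auto
        obtain J' l' where z2: "z = (w' @ J', l')" "(J', l') \<in> U n k'" using zz(2) by auto
        note z = z1 z2
        have "w = w'" "J = J'" "l = l'" using W(1,3) z1(1) z2(1) by (auto simp: words_length)
        then have "k \<noteq> k'" using p(3) pp by (auto simp: wk_def)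
        then show False using dist2[OF W(2,4)] z(2,4) \<open>J = J'\<close> \<open>l = l'\<close> by blast
      qed
    qed
    moreover have "set (concat (map (\<lambda>p. map wk (ch p)) (?lv n))) = words N (Suc n * q) \<times> {..<m}"
    proof (intro equalityI subsetI)
      fix z assume "z \<in> set (concat (map (\<lambda>p. map wk (ch p)) (?lv n)))"
      then obtain p where p: "p \<in> set (?lv n)" "z \<in> set (map wk (ch p))" by auto
      obtain w k b where pp: "p = (w, k, b)" by (cases p)
      have W: "w \<in> words N (n * q)" "k < m" using mem p(1) pp by blast+
      obtain J l where z: "z = (w @ J, l)" "(J, l) \<in> U n k"
        using p(2) unfolding pp ch_wk(1)[OF W] by auto
      have "J \<in> words N q" "l < m" using inw[OF z(2) W(2)] by blast+
      then show "z \<in> words N (Suc n * q) \<times> {..<m}" using words_append[OF W(1), of J q] z(1) by (simp add: add.commute)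
    next
      fix z assume "z \<in> words N (Suc n * q) \<times> {..<m}"
      then obtain v l where z: "z = (v, l)" "v \<in> words N (n * q + q)" "l < m" by (auto simp: add.commute)
      obtain w J where v: "v = w @ J" "w \<in> words N (n * q)" "J \<in> words N q" using z(2) by (rule words_append_split)
      obtain k where kb: "k < m" "(J, l) \<in> U n k" using cov[OF v(3) z(3)] by blast
      have "(w, k) \<in> set (map wk (?lv n))" unfolding conjunct1[OF Suc] using v(2) kb(1) by simp
      then have "(w, k) \<in> wk ` set (?lv n)" unfolding list.set_map .
      then obtain p where p0: "(w, k) = wk p" "p \<in> set (?lv n)" by (rule imageE)
      obtain w1 k1 o' where "p = (w1, k1, o')" by (cases p)
      then have p: "(w, k, o') \<in> set (?lv n)" using p0 by (simp add: wk_def)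
      have "(w @ J, l) \<in> set (map wk (ch (w, k, o')))"
        unfolding ch_wk(1)[OF v(2) kb(1)] using imageI[OF kb(2), of "\<lambda>(J, l). (w @ J, l)"] by simp
      then show "z \<in> set (concat (map (\<lambda>p. map wk (ch p)) (?lv n)))" using p z(1) v(1) by auto
    qed
    ultimately show ?case by (simp only: eq)
  qed
  have mem: "w \<in> words N (n * q) \<and> k < m" if "(w, k, o') \<in> set (?lv n)" for w k o' n
  proof -
    have "wk (w, k, o') \<in> wk ` set (?lv n)" using that by (rule imageI)
    then show ?thesis unfolding list.set_map[symmetric] conjunct1[OF lev] by (simp add: wk_def)
  qed
  have wk_inj: "p = p'" if "p \<in> set (?lv n)" "p' \<in> set (?lv n)" "wk p = wk p'" for p p' n
    using conjunct2[OF lev[of n]] that unfolding distinct_map by (blast dest: inj_onD)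
  \<comment> \<open>The pieces of one level form a closed walk through images of the skeleton.\<close>
  define bg where "bg n = (\<lambda>(w, k, o'). word_map S w (if o' then \<sigma> n ! k else \<sigma> n ! (Suc k mod m)))" for n
  define fn where "fn n = (\<lambda>(w, k, o'). word_map S w (if o' then \<sigma> n ! (Suc k mod m) else \<sigma> n ! k))" for n
  define walk where "walk n = rec_list (\<lambda>x y. x = y) (\<lambda>p _ W x y. bg n p = x \<and> W (fn n p) y)" for n
  have walk_simps: "walk n [] x y \<longleftrightarrow> x = y" "walk n (p # ps) x y \<longleftrightarrow> bg n p = x \<and> walk n ps (fn n p) y" for n p ps x y
    by (simp_all add: walk_def)
  have walk_append: "walk n (ps @ ps') x y \<longleftrightarrow> (\<exists>z. walk n ps x z \<and> walk n ps' z y)" for n ps ps' x y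
    by (induction ps arbitrary: x) (auto simp: walk_simps)
  have path_walk: "walk (Suc n) (map (\<lambda>(J, l, b). (w @ J, l, b)) es) (word_map S w x) (word_map S w y)"
    if "cycle_system.path (vertex (\<sigma> (Suc n))) m x es y" for n w x es y
    using that
  proof (induction es arbitrary: x)
    case Nil
    then show ?case by (simp add: walk_simps cycle_system.path.simps(1)[OF cs])
  next
    case (Cons e es)
    obtain J l b where e: "e = (J, l, b)" by (cases e)
    have p: "cycle_system.st (vertex (\<sigma> (Suc n))) m e = x"
       "cycle_system.path (vertex (\<sigma> (Suc n))) m (cycle_system.en (vertex (\<sigma> (Suc n))) m e) es y"
      using Cons.prems unfolding cycle_system.path.simps(2)[OF cs] by blast+
    have "bg (Suc n) (w @ J, l, b) = word_map S w x"
      using p(1) unfolding e cycle_system.st.simps[OF cs] by (auto simp: bg_def word_map_append)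
    moreover have "fn (Suc n) (w @ J, l, b) = word_map S w (cycle_system.en (vertex (\<sigma> (Suc n))) m e)"
      unfolding e cycle_system.en.simps[OF cs] by (simp add: fn_def word_map_append)
    ultimately show ?case using Cons.IH[OF p(2)] by (simp add: e walk_simps)
  qed
  have ch_walk: "walk (Suc n) (ch p) (bg n p) (fn n p)" if p: "p \<in> set (?lv n)" for p n
  proof -
    obtain w k o' where pp: "p = (w, k, o')" by (cases p)
    have W: "w \<in> words N (n * q)" "k < m" using mem p pp by blast+
    show ?thesis
      unfolding pp ch_eq[OF W(1)] bg_def fn_def case_prod_conv
      by (rule path_walk) (use pth[OF W(2), of n] cycle_system.path_rv[OF cs pth[OF W(2), of n]] in \<open>auto simp: \<rho>_def\<close>)
  qed
  have walk_concat: "walk (Suc n) (concat (map ch ps)) x y"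
    if "walk n ps x y" "\<And>p. p \<in> set ps \<Longrightarrow> walk (Suc n) (ch p) (bg n p) (fn n p)" for n ps x y
    using that
  proof (induction ps arbitrary: x)
    case (Cons p ps)
    have "walk (Suc n) (ch p) x (fn n p)" using Cons.prems(1) Cons.prems(2)[of p] by (simp add: walk_simps)
    moreover have "walk (Suc n) (concat (map ch ps)) (fn n p) y"
      by (rule Cons.IH) (use Cons.prems in \<open>simp_all add: walk_simps\<close>)
    ultimately show ?case by (auto simp only: list.map concat.simps walk_append)
  qed (simp add: walk_simps)
  have walk_lv: "walk n (?lv n) (\<sigma> 0 ! 0) (\<sigma> 0 ! 0)" for n
  proof (induction n)
    case 0
    have "walk 0 (map (\<lambda>k. ([], k, True)) [i..<m]) (\<sigma> 0 ! i) (\<sigma> 0 ! 0)" if "i < m" for i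
      using that
    proof (induction "m - i" arbitrary: i)
      case (Suc d)
      show ?case
      proof (cases "Suc i < m")
        case True
        then show ?thesis using Suc(1)[of "Suc i"] Suc(2) by (simp add: upt_conv_Cons walk_simps bg_def fn_def)
      next
        case False
        then have "m = Suc i" using Suc.prems by simp
        then show ?thesis by (simp add: walk_simps bg_def fn_def)
      qed
    qed simp
    from this[OF m] show ?case by (simp add: L0_def)
  next
    case (Suc n)
    show ?case unfolding chain_level.simps by (rule walk_concat[OF Suc]) (rule ch_walk)
  qed
  have cells: "bg n p \<in> cell (fst p)" "fn n p \<in> cell (fst p)" if p: "p \<in> set (?lv n)" for n p
  proof -
    obtain w k o' where pp: "p = (w, k, o')" by (cases p)
    have "k < m" using mem p pp by blast
    then have "\<sigma> n ! k \<in> K" "\<sigma> n ! (Suc k mod m) \<in> K" using \<sigma>K m by simp_all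
    then show "bg n p \<in> cell (fst p)" "fn n p \<in> cell (fst p)" by (auto simp: pp bg_def fn_def cell_def)
  qed
  have succ: "successively (\<lambda>p p'. cell (fst p) \<inter> cell (fst p') \<noteq> {}) ps"
    if "walk n ps x y" "set ps \<subseteq> set (?lv n)" for n ps x y
    using that
  proof (induction ps arbitrary: x)
    case (Cons p ps)
    show ?case
    proof (cases ps)
      case (Cons p' ps')
      have "fn n p = bg n p'" using Cons.prems(1) by (simp add: Cons walk_simps)
      then have "cell (fst p) \<inter> cell (fst p') \<noteq> {}" using cells[of p n] cells[of p' n] Cons.prems(2) Cons by auto
      moreover have "successively (\<lambda>p p'. cell (fst p) \<inter> cell (fst p') \<noteq> {}) ps"
        using Cons.IH[of "fn n p"] Cons.prems by (simp add: walk_simps)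
      ultimately show ?thesis by (simp add: Cons)
    qed simp
  qed simp
  have "piece_system N S r K s q L0 ch fst"
  proof unfold_locales
    show "0 < q" by (rule q)
    show "distinct (?lv n)" for n using lev[of n] by (auto simp: distinct_map)
    show "fst p = []" if "p \<in> set L0" for p using that by (auto simp: L0_def)
    show "\<exists>b\<in>words N q. fst p' = fst p @ b" if p: "p \<in> set (?lv n)" "p' \<in> set (ch p)" for p p' n
    proof -
      obtain w k o' v l b where pp: "p = (w, k, o')" "p' = (v, l, b)" by (cases p, cases p')
      have W: "w \<in> words N (n * q)" "k < m" using mem p(1) pp by blast+
      obtain J where "v = w @ J" "(J, l) \<in> U n k" using p(2) pp ch_mem[OF W] by blast
      then show ?thesis using inw[OF _ W(2)] pp by auto
    qed
    show "\<exists>p\<in>set (?lv n). fst p = I" if I: "I \<in> words N (n * q)" for I n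
    proof -
      have "(I, 0) \<in> set (map wk (?lv n))" unfolding conjunct1[OF lev] using I m by simp
      then have "(I, 0) \<in> wk ` set (?lv n)" unfolding list.set_map .
      then obtain p where p0: "(I, 0) = wk p" "p \<in> set (?lv n)" by (rule imageE)
      obtain w1 k1 o' where "p = (w1, k1, o')" by (cases p)
      then show ?thesis using p0 by (intro bexI[of _ p]) (simp_all add: wk_def)
    qed
    show "successively (\<lambda>p p'. cell (fst p) \<inter> cell (fst p') \<noteq> {}) (?lv n)" for n
      by (rule succ[OF walk_lv order_refl])
    show "\<exists>b\<in>words N (2 * q). \<forall>p'\<in>set (?lv (n + 2)). fst p' = fst p @ b \<longrightarrow> p' \<in> set (chain_level [p] ch 2)"
      if p: "p \<in> set (?lv n)" for p n
    proof -
      obtain w k o' where pp: "p = (w, k, o')" by (cases p)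
      have W: "w \<in> words N (n * q)" "k < m" using mem p pp by blast+
      obtain J where J: "(J, g (Suc n)) \<in> U n k" using gd[OF W(2), of n] unfolding U_iff by blast
      have Jw: "J \<in> words N q" using inw[OF J W(2)] by blast
      have wJ: "w @ J \<in> words N (Suc n * q)" using words_append[OF W(1) Jw] by (simp add: add.commute)
      obtain c where c: "(w @ J, g (Suc n), c) \<in> set (ch p)" using ch_mem[OF W, of "w @ J" "g (Suc n)" o'] J pp by blast
      obtain L where L: "L \<in> words N q" "\<And>l. l < m \<Longrightarrow> (L, l) \<in> U (Suc n) (g (Suc n))"
        using pure[of "Suc n"] unfolding U_iff by blast
      show ?thesis
      proof (intro bexI[of _ "J @ L"] ballI impI)
        show "J @ L \<in> words N (2 * q)" using words_append[OF Jw L(1)] by (simp add: mult_2)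
        fix p' assume p': "p' \<in> set (?lv (n + 2))" "fst p' = fst p @ J @ L"
        obtain v l b' where pp': "p' = (v, l, b')" by (cases p')
        have l: "l < m" using mem p'(1) pp' by blast
        obtain d where d: "((w @ J) @ L, l, d) \<in> set (ch (w @ J, g (Suc n), c))"
          using ch_mem[OF wJ \<sigma>(3)[of "Suc n"], of "(w @ J) @ L" l c] L(2)[OF l] by blast
        have two: "chain_level xs ch 2 = concat (map ch (concat (map ch xs)))" for xs
          by (simp add: numeral_2_eq_2)
        have in2: "((w @ J) @ L, l, d) \<in> set (chain_level [p] ch 2)" unfolding two using c d by auto
        have lv2: "?lv (n + 2) = chain_level (?lv n) ch 2" by (rule chain_level_add)
        have "((w @ J) @ L, l, d) \<in> set (?lv (n + 2))" unfolding lv2 two using c d p by auto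
        moreover have "wk ((w @ J) @ L, l, d) = wk p'" using p'(2) pp pp' by (simp add: wk_def)
        ultimately have "((w @ J) @ L, l, d) = p'" using wk_inj p'(1) by blast
        then show "p' \<in> set (chain_level [p] ch 2)" using in2 by simp
      qed
    qed
  qed
  then show ?thesis by blast
qed

section \<open>Pieces in the chain case\<close>

text \<open>
  A longest simple path cannot be left from one of its ends, by maximality, nor from an inner vertex,
  which would have a third neighbour.
\<close>

lemma hamiltonian_path:
  fixes X :: "'v set"
  assumes sym: "\<And>x y. R x y \<Longrightarrow> R y x" and X: "finite X" "X \<noteq> {}" "conn R X"
    and deg: "\<And>v E. \<lbrakk>v \<in> X; E \<subseteq> X; card E = 3; v \<notin> E; \<forall>e\<in>E. R v e\<rbrakk> \<Longrightarrow> False"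
  shows "\<exists>Q. distinct Q \<and> set Q = X \<and> successively R Q"
proof -
  define ok where "ok Q \<longleftrightarrow> Q \<noteq> [] \<and> distinct Q \<and> set Q \<subseteq> X \<and> successively R Q" for Q
  obtain x0 where "x0 \<in> X" using X(2) by blast
  then have ok0: "ok [x0]" by (simp add: ok_def)
  have bound: "length Q < Suc (card X)" if "ok Q" for Q
    using that card_mono[OF X(1), of "set Q"] distinct_card[of Q] by (simp add: ok_def)
  obtain Q where Q: "ok Q" and max: "\<And>Q'. ok Q' \<Longrightarrow> length Q' \<le> length Q"
    using ex_has_greatest_nat[where P = ok and f = length, OF ok0] bound by blast
  have "set Q = X"
  proof (rule ccontr)
    assume "set Q \<noteq> X"
    then obtain x y where xy: "x \<in> set Q" "y \<in> X - set Q" "R x y"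
      using connD[OF X(3), of "set Q"] Q by (auto simp: ok_def)
    obtain u v where uv: "Q = u @ x # v" using xy(1) by (meson split_list)
    show False
    proof (cases "u = [] \<or> v = []")
      case True
      then show False
      proof
        assume "u = []"
        then have "ok (y # Q)" using Q xy sym[OF xy(3)] uv by (auto simp: ok_def)
        then show False using max by fastforce
      next
        assume "v = []"
        then have "ok (Q @ [y])" using Q xy uv by (auto simp: ok_def successively_append_iff)
        then show False using max by fastforce
      qed
    next
      case False
      let ?E = "{last u, hd v, y}"
      have d: "last u \<noteq> hd v" "last u \<noteq> y" "hd v \<noteq> y" "x \<noteq> last u" "x \<noteq> hd v" "x \<noteq> y" and s: "?E \<subseteq> X"
      proof -
        have lu: "last u \<in> set u" and hv: "hd v \<in> set v" using False by auto
        have dQ: "distinct (u @ x # v)" "set (u @ x # v) \<subseteq> X" using Q uv by (auto simp: ok_def)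
        show "last u \<noteq> hd v" "x \<noteq> last u" "x \<noteq> hd v" using lu hv dQ(1) by auto
        show "last u \<noteq> y" "hd v \<noteq> y" "x \<noteq> y" using lu hv xy(2) uv by auto
        show "?E \<subseteq> X" using lu hv dQ(2) xy(2) by auto
      qed
      have "R (last u) x" "R x (hd v)"
        using Q uv False by (auto simp: ok_def successively_append_iff successively_Cons)
      then have "\<forall>e\<in>?E. R x e" using sym xy(3) by blast
      moreover have "card ?E = 3" using d by simp
      moreover have "x \<in> X" using xy(1) Q by (auto simp: ok_def)
      ultimately show False using deg[of x ?E] s d by blast
    qed
  qed
  then show ?thesis using Q by (auto simp: ok_def)
qed

text \<open>
  The cells of level one are arranged in a path. Two neighbouring cells of a level touch each other in
  end cells of their copies of this path, since an inner cell would have a third neighbour; for the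
  same reason a cell touches its two neighbours in different ends. Hence the copies, suitably
  oriented, join to a path through the next level, and each cell is visited once.
\<close>

lemma piece_system_chain:
  assumes A: "skeleton A" and nb: "\<And>k. \<not> branching A k"
  shows "\<exists>(L0 :: nat list list) ch. piece_system N S r K s 1 L0 ch (\<lambda>I. I)"
proof -
  have AK: "A \<subseteq> K" using A by (simp add: skeleton_def)
  have three: False
    if "v \<in> words N k" "a \<in> words N k" "b \<in> words N k" "c \<in> words N k" "adj A v a" "adj A v b" "adj A v c"
      "a \<noteq> b" "a \<noteq> c" "b \<noteq> c" "v \<noteq> a" "v \<noteq> b" "v \<noteq> c" for v a b c k
  proof -
    have "card {a, b, c} = 3" using that by simp
    then have "branching A k" unfolding branching_def
      by (intro bexI[of _ v] exI[of _ "{a, b, c}"]) (use that in auto)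
    then show False using nb by blast
  qed
  have N2: "2 \<le> N" using sys by (simp add: similitude_ifs_def)
  have ne: "words N n \<noteq> {}" for n using card_words[of N n] N2 by (metis card.empty power_not_zero not_numeral_le_zero)
  have "\<exists>Q. distinct Q \<and> set Q = words N 1 \<and> successively (adj A) Q"
  proof (rule hamiltonian_path[where R = "adj A", OF adj_symD finite_words ne conn_words[OF A]])
    fix v E assume "v \<in> words N 1" "E \<subseteq> words N 1" "card E = 3" "v \<notin> E" "\<forall>e\<in>E. adj A v e"
    then have "branching A 1" unfolding branching_def by (intro bexI[of _ v] exI[of _ E]) simp_all
    then show False using nb by blast
  qed
  then obtain Q where Q: "distinct Q" "set Q = words N 1" "successively (adj A) Q" by blast
  have "length Q = N" using distinct_card[OF Q(1)] Q(2) card_words[of N 1] by simp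
  then have lQ: "2 \<le> length Q" using N2 by simp
  obtain e1 Q' where Q1: "Q = e1 # Q'" "Q' \<noteq> []" using lQ by (cases Q) (auto simp: Suc_le_eq)
  obtain M e2 where Q2: "Q' = M @ [e2]" using Q1(2) by (meson rev_exhaust)
  have QM: "Q = e1 # M @ [e2]" using Q1 Q2 by simp
  have e12: "e1 \<noteq> e2" "e1 \<in> words N 1" "e2 \<in> words N 1" using Q(1,2) QM by auto
  have sQ: "set (e1 # M @ [e2]) = words N 1" using Q(2) unfolding QM .
  have inner: "\<exists>a\<in>words N 1. \<exists>b\<in>words N 1. a \<noteq> b \<and> u \<noteq> a \<and> u \<noteq> b \<and> adj A u a \<and> adj A u b"
    if u: "u \<in> words N 1" "u \<notin> {e1, e2}" for u
  proof -
    have "u \<in> set M" using u QM Q(2) by auto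
    then obtain X Y where M: "M = X @ u # Y" by (meson split_list)
    let ?X = "e1 # X" and ?Y = "Y @ [e2]"
    have q: "Q = ?X @ u # ?Y" using QM M by simp
    have in': "last ?X \<in> set ?X" "hd ?Y \<in> set ?Y" by (rule last_in_set, simp, rule hd_in_set, simp)
    have d: "distinct (?X @ u # ?Y)" using Q(1) q by simp
    have w: "set ?X \<subseteq> words N 1" "set ?Y \<subseteq> words N 1" using Q(2) q by auto
    have s: "successively (adj A) (?X @ (u # ?Y))" using Q(3) q by simp
    have "adj A (last ?X) u" "successively (adj A) (u # ?Y)" using s unfolding successively_append_iff by auto
    moreover have "adj A u (hd ?Y)" using calculation(2) unfolding successively_Cons by auto
    moreover have "last ?X \<noteq> hd ?Y" "u \<noteq> last ?X" "u \<noteq> hd ?Y" using d in' by fastforce+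
    ultimately show ?thesis using in' w adj_symD by blast
  qed
  have nbr: "\<exists>a\<in>words N 1. u \<noteq> a \<and> adj A u a" if u: "u \<in> {e1, e2}" for u
  proof -
    let ?h = "hd (M @ [e2])" and ?l = "last (e1 # M)"
    have in': "?h \<in> set (M @ [e2])" "?l \<in> set (e1 # M)" by (rule hd_in_set, simp, rule last_in_set, simp)
    have s: "successively (adj A) (e1 # (M @ [e2]))" "successively (adj A) ((e1 # M) @ [e2])" using Q(3) QM by simp_all
    have "adj A e1 ?h" using s(1) unfolding successively_Cons by auto
    moreover have "adj A ?l e2" using s(2) unfolding successively_append_iff by auto
    moreover have "?h \<in> words N 1" "?l \<in> words N 1"
      using in' unfolding sQ[symmetric] by (simp_all only: set_simps set_append) blast+
    moreover have "e1 \<noteq> ?h" "e2 \<noteq> ?l"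
    proof -
      have d: "distinct (e1 # (M @ [e2]))" "distinct ((e1 # M) @ [e2])" using Q(1) QM by simp_all
      show "e1 \<noteq> ?h" using d(1) in'(1) by (metis distinct.simps(2))
      show "e2 \<noteq> ?l" using d(2) in'(2) by (metis distinct_append disjoint_iff list.set_intros(1))
    qed
    ultimately show ?thesis using u adj_symD[of A ?l e2] by (elim insertE emptyE) blast+
  qed
  \<comment> \<open>A cell whose last letter is inside the path already has two neighbours in its own parent.\<close>
  have half: "x \<in> {e1, e2}"
    if h: "I \<in> words N n" "x \<in> words N 1" "z \<in> words N (n + 1)" "adj A (I @ x) z" "take n z \<noteq> I" for I x z n
  proof (rule ccontr)
    assume "x \<notin> {e1, e2}"
    then obtain a b where ab: "a \<in> words N 1" "b \<in> words N 1" "a \<noteq> b" "x \<noteq> a" "x \<noteq> b" "adj A x a" "adj A x b"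
      using inner[OF h(2)] by blast
    have z: "z \<noteq> I @ c" for c using h(1,5) by (auto simp: words_length)
    show False
      by (rule three[of "I @ x" "n + 1" "I @ a" "I @ b" z])
        (use h ab z z[symmetric] in \<open>auto intro: words_append adj_append simp del: One_nat_def\<close>)
  qed
  have link: "\<exists>x\<in>{e1, e2}. \<exists>y\<in>{e1, e2}. adj A (I @ x) (I' @ y)"
    if I: "I \<in> words N n" "I' \<in> words N n" "I \<noteq> I'" "adj A I I'" for I I' n
  proof -
    obtain x y where xy: "x \<in> words N 1" "y \<in> words N 1" "adj A (I @ x) (I' @ y)"
      using adj_refine[OF A I(4)] by blast
    have w: "I @ x \<in> words N (n + 1)" "I' @ y \<in> words N (n + 1)" by (rule words_append[OF I(1) xy(1)], rule words_append[OF I(2) xy(2)])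
    have t: "take n (I @ x) = I" "take n (I' @ y) = I'" using I(1,2) by (simp_all add: words_length)
    have "x \<in> {e1, e2}" by (rule half[OF I(1) xy(1) w(2) xy(3)]) (use t I(3) in simp)
    moreover have "y \<in> {e1, e2}" by (rule half[OF I(2) xy(2) w(1) adj_symD[OF xy(3)]]) (use t I(3) in simp)
    ultimately show ?thesis using xy(3) by blast
  qed
  define blk where "blk b I = map (\<lambda>u. I @ u) (if b then Q else rev Q)" for b :: bool and I :: "nat list"
  have blk_ends: "hd (blk b I) = I @ (if b then e1 else e2)" "last (blk b I) = I @ (if b then e2 else e1)"
    "blk b I \<noteq> []" for b I
    by (auto simp: blk_def QM hd_map last_map)
  have blk_succ: "successively (adj A) (blk b I)" for b I
  proof -
    have "successively (adj A) (rev Q)" unfolding successively_rev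
      by (rule successively_mono[OF Q(3)]) (use adj_symD in blast)
    then have "successively (adj A) (if b then Q else rev Q)" using Q(3) by simp
    then show ?thesis unfolding blk_def successively_map
      by (rule successively_mono) (rule adj_append)
  qed
  have blk_set: "set (blk b I) = (\<lambda>u. I @ u) ` words N 1" "distinct (blk b I)" for b I
    using Q(1,2) by (auto simp: blk_def distinct_map inj_on_def)
  \<comment> \<open>The blocks are oriented one after the other: the end of a block at which the next one is
    attached differs from the end at which the previous one is attached.\<close>
  have claim: "\<exists>o'. hd (blk (o' I) I) = I @ y \<and> successively (adj A) (concat (map (\<lambda>I. blk (o' I) I) (I # rest)))"
    if "successively (adj A) (I # rest)" "distinct (I # rest)" "set (I # rest) \<subseteq> words N n" "y \<in> {e1, e2}"
      "\<And>I' rs. rest = I' # rs \<Longrightarrow> \<exists>x\<in>{e1, e2}. \<exists>y'\<in>{e1, e2}. x \<noteq> y \<and> adj A (I @ x) (I' @ y')"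
    for I rest y n
    using that
  proof (induction rest arbitrary: I y)
    case Nil
    show ?case
      by (rule exI[of _ "\<lambda>_. y = e1"]) (use Nil(4) e12(1) blk_ends blk_succ in auto)
  next
    case (Cons I' rs)
    obtain x y' where x: "x \<in> {e1, e2}" "y' \<in> {e1, e2}" "x \<noteq> y" "adj A (I @ x) (I' @ y')"
      using Cons.prems(5)[OF refl] by blast
    have w: "I \<in> words N n" "I' \<in> words N n" "I \<noteq> I'" using Cons.prems(2,3) by auto
    have "\<exists>o'. hd (blk (o' I') I') = I' @ y' \<and> successively (adj A) (concat (map (\<lambda>I. blk (o' I) I) (I' # rs)))"
    proof (rule Cons.IH)
      show "successively (adj A) (I' # rs)" using Cons.prems(1) by simp
      show "distinct (I' # rs)" "set (I' # rs) \<subseteq> words N n" using Cons.prems(2,3) by auto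
      show "y' \<in> {e1, e2}" by (rule x(2))
      fix I2 rs' assume rs: "rs = I2 # rs'"
      have w2: "I2 \<in> words N n" "I' \<noteq> I2" "I \<noteq> I2" using Cons.prems(2,3) rs by auto
      have "adj A I' I2" using Cons.prems(1) rs by simp
      then obtain x2 y2 where x2: "x2 \<in> {e1, e2}" "y2 \<in> {e1, e2}" "adj A (I' @ x2) (I2 @ y2)"
        using link[OF w(2) w2(1,2)] by blast
      have "x2 \<noteq> y'"
      proof
        assume eq: "x2 = y'"
        obtain a where a: "a \<in> words N 1" "y' \<noteq> a" "adj A y' a" using nbr[OF x(2)] by blast
        have ew: "x \<in> words N 1" "y' \<in> words N 1" "y2 \<in> words N 1" using x(1,2) x2(2) e12 by auto
        have L: "length I = n" "length I' = n" "length I2 = n" using w w2 by (simp_all add: words_length)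
        show False
          by (rule three[of "I' @ y'" "n + 1" "I @ x" "I2 @ y2" "I' @ a"])
            (use w w2 ew a L x2(3) eq adj_symD[OF x(4)] in \<open>auto intro: words_append adj_append simp del: One_nat_def\<close>)
      qed
      then show "\<exists>x\<in>{e1, e2}. \<exists>y''\<in>{e1, e2}. x \<noteq> y' \<and> adj A (I' @ x) (I2 @ y'')" using x2 by blast
    qed
    then obtain o' where o': "hd (blk (o' I') I') = I' @ y'" "successively (adj A) (concat (map (\<lambda>I. blk (o' I) I) (I' # rs)))" by blast
    let ?o = "o'(I := (y = e1))" and ?T = "concat (map (\<lambda>I. blk (o' I) I) (I' # rs))"
    have m': "map (\<lambda>I. blk (?o I) I) (I' # rs) = map (\<lambda>I. blk (o' I) I) (I' # rs)"
      by (rule map_cong[OF refl]) (use Cons.prems(2) in auto)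
    have "map (\<lambda>I. blk (?o I) I) (I # I' # rs) = blk (y = e1) I # map (\<lambda>I. blk (o' I) I) (I' # rs)"
      unfolding m'[symmetric] by simp
    then have eq: "concat (map (\<lambda>I. blk (?o I) I) (I # I' # rs)) = blk (y = e1) I @ ?T"
      by (simp only: concat.simps)
    have hT: "hd ?T = I' @ y'" using o'(1) blk_ends(3)[of "o' I'" I'] by simp
    have "last (blk (y = e1) I) = I @ x" using blk_ends(2) x(1,3) Cons.prems(4) e12(1) by auto
    then have "successively (adj A) (blk (y = e1) I @ ?T)"
      unfolding successively_append_iff using blk_succ o'(2) hT x(4) by simp
    moreover have "hd (blk (?o I) I) = I @ y" using blk_ends(1) Cons.prems(4) e12(1) by auto
    ultimately show ?case unfolding eq[symmetric] by blast
  qed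
  define good_list where "good_list n xs \<longleftrightarrow> distinct xs \<and> set xs = words N n \<and> successively (adj A) xs" for n xs
  have step: "\<exists>o'. good_list (Suc n) (concat (map (\<lambda>I. blk (o' I) I) xs))" if g: "good_list n xs" for n xs
  proof -
    have xs: "distinct xs" "set xs = words N n" "successively (adj A) xs" using g by (auto simp: good_list_def)
    have "xs \<noteq> []" using xs(2) ne[of n] by (metis list.set(1))
    then obtain I rest where I: "xs = I # rest" by (cases xs) auto
    have "\<exists>y\<in>{e1, e2}. \<forall>I' rs. rest = I' # rs \<longrightarrow> (\<exists>x\<in>{e1, e2}. \<exists>y'\<in>{e1, e2}. x \<noteq> y \<and> adj A (I @ x) (I' @ y'))"
    proof (cases rest)
      case (Cons I' rs)
      have h: "I \<in> words N n" "I' \<in> words N n" "I \<noteq> I'" "adj A I I'" using xs I Cons by auto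
      obtain x y' where x: "x \<in> {e1, e2}" "y' \<in> {e1, e2}" "adj A (I @ x) (I' @ y')"
        using link[OF h] by blast
      obtain y where "y \<in> {e1, e2}" "x \<noteq> y" using x(1) e12(1) by blast
      then show ?thesis using x Cons by blast
    qed (simp, blast)
    then obtain y where y: "y \<in> {e1, e2}"
      "\<And>I' rs. rest = I' # rs \<Longrightarrow> \<exists>x\<in>{e1, e2}. \<exists>y'\<in>{e1, e2}. x \<noteq> y \<and> adj A (I @ x) (I' @ y')" by blast
    have c: "successively (adj A) (I # rest)" "distinct (I # rest)" "set (I # rest) \<subseteq> words N n"
      using xs I by simp_all
    have "\<exists>o'. hd (blk (o' I) I) = I @ y \<and> successively (adj A) (concat (map (\<lambda>I. blk (o' I) I) (I # rest)))"
    proof (rule claim[OF c y(1)])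
      fix I' rs assume "rest = I' # rs"
      then show "\<exists>x\<in>{e1, e2}. \<exists>y'\<in>{e1, e2}. x \<noteq> y \<and> adj A (I @ x) (I' @ y')" by (rule y(2))
    qed
    then obtain o' where
      o': "hd (blk (o' I) I) = I @ y \<and> successively (adj A) (concat (map (\<lambda>I. blk (o' I) I) (I # rest)))" ..
    have "successively (adj A) (concat (map (\<lambda>I. blk (o' I) I) xs))" unfolding I by (rule conjunct2[OF o'])
    moreover
    have "set (concat (map (\<lambda>I. blk (o' I) I) xs)) = words N (Suc n)"
      unfolding Suc_eq_plus1 words_add set_concat list.set_map using xs(2) blk_set(1) by (auto simp del: One_nat_def)
    moreover have "distinct (concat (map (\<lambda>I. blk (o' I) I) xs))"
    proof (rule distinct_concat_mapI[where h = id])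
      fix I J assume "I \<in> set xs" "J \<in> set xs" "id I \<noteq> id J"
      then have "length I = n" "length J = n" "I \<noteq> J" using xs(2) by (simp_all add: words_length)
      then show "set (blk (o' I) I) \<inter> set (blk (o' J) J) = {}" unfolding blk_set by auto
    qed (use xs(1) blk_set(2) in auto)
    ultimately show ?thesis unfolding good_list_def by (intro exI[of _ o'] conjI)
  qed
  define ori where "ori n xs = (SOME o'. good_list (Suc n) (concat (map (\<lambda>I. blk (o' I) I) xs)))" for n xs
  have ori: "good_list (Suc n) (concat (map (\<lambda>I. blk (ori n xs I) I) xs))" if "good_list n xs" for n xs
    unfolding ori_def by (rule someI_ex[OF step[OF that]])
  define f where "f = rec_nat [[]] (\<lambda>n xs. concat (map (\<lambda>I. blk (ori n xs I) I) xs))"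
  have f_simps: "f 0 = [[]]" "f (Suc n) = concat (map (\<lambda>I. blk (ori n (f n) I) I) (f n))" for n by (simp_all add: f_def)
  have gf: "good_list n (f n)" for n
  proof (induction n)
    case 0
    show ?case by (simp add: f_simps good_list_def)
  next
    case (Suc n)
    show ?case unfolding f_simps by (rule ori[OF Suc])
  qed
  define ch where "ch I = blk (ori (length I) (f (length I)) I) I" for I
  have lv: "chain_level [[]] ch n = f n" for n
  proof (induction n)
    case (Suc n)
    have "map ch (f n) = map (\<lambda>I. blk (ori n (f n) I) I) (f n)"
      by (rule map_cong[OF refl]) (use gf[of n] in \<open>auto simp: ch_def good_list_def words_length\<close>)
    then show ?case unfolding chain_level.simps Suc f_simps by (simp only:)
  qed (simp add: f_simps)
  have ch_set: "set (ch I) = (\<lambda>u. I @ u) ` words N 1" for I unfolding ch_def by (rule blk_set(1))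
  have "piece_system N S r K s 1 [[]] ch (\<lambda>I. I)"
  proof unfold_locales
    show "(0::nat) < 1" by simp
    show "distinct (chain_level [[]] ch n)" for n using gf[of n] by (simp add: lv good_list_def)
    show "p = []" if "p \<in> set [[]]" for p :: "nat list" using that by simp
    show "\<exists>b\<in>words N 1. p' = p @ b" if "p \<in> set (chain_level [[]] ch n)" "p' \<in> set (ch p)" for p p' n
      using that(2) unfolding ch_set by blast
    show "\<exists>p\<in>set (chain_level [[]] ch n). p = I" if "I \<in> words N (n * 1)" for I n
      using that gf[of n] by (simp add: lv good_list_def)
    show "successively (\<lambda>p p'. cell p \<inter> cell p' \<noteq> {}) (chain_level [[]] ch n)" for n
    proof -
      have "successively (adj A) (f n)" using gf[of n] by (simp add: good_list_def)
      then show ?thesis unfolding lv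
        by (rule successively_mono) (use AK in \<open>auto simp: adj_def cell_def\<close>)
    qed
    show "\<exists>b\<in>words N (2 * 1). \<forall>p'\<in>set (chain_level [[]] ch (n + 2)). p' = p @ b \<longrightarrow> p' \<in> set (chain_level [p] ch 2)"
      if p: "p \<in> set (chain_level [[]] ch n)" for p n
    proof -
      have lev: "set (chain_level [[]] ch n) = words N n" using gf[of n] by (simp add: lv good_list_def)
      obtain b where b: "b \<in> words N (2 * 1)" using ne by blast
      have "p' \<in> set (chain_level [p] ch 2)" if p': "p' \<in> set (chain_level [[]] ch (n + 2))" "p' = p @ b" for p'
      proof -
        have "p' \<in> set (concat (map (\<lambda>p0. chain_level [p0] ch 2) (chain_level [[]] ch n)))"
          using p'(1) unfolding chain_level_add chain_level_conv_concat[of "chain_level [[]] ch n" ch 2] .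
        then obtain p0 where p0: "p0 \<in> words N n" "p' \<in> set (chain_level [p0] ch 2)" unfolding lev[symmetric] by auto
        have "\<exists>v. p' = p0 @ v" using p0(2) unfolding numeral_2_eq_2 by (auto simp: ch_set)
        then have "take n p' = p0" using p0(1) by (auto simp: words_length)
        moreover have "take n p' = p" using p'(2) p lev by (auto simp: words_length)
        ultimately show ?thesis using p0(2) by simp
      qed
      then show ?thesis using b by blast
    qed
  qed
  then show ?thesis by blast
qed

end

section \<open>Existence of space-filling curves\<close>

theorem theorem1p5:
  fixes N :: nat
    and S :: "nat \<Rightarrow> 'a::euclidean_space \<Rightarrow> 'a"
    and r :: "nat \<Rightarrow> real"
    and K :: "'a set"
  assumes "similitude_ifs N S r"
    and "invariant_set N S K"
    and "connected K"
    and "finite_type N S r K"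
    and "open_set_condition N S"
  shows "\<exists>\<psi>. space_filling_curve K \<psi>"
proof -
  obtain s where s: "s > 0" "(\<Sum>j\<in>{1..N}. r j powr s) = 1"
    using similarity_dimension_exists[OF assms(1)] by blast
  interpret moran_system N S r K s
    by unfold_locales (use assms(1,2) s in simp_all)
  obtain A where A: "skeleton A" using finite_type_skeleton[OF assms(4,3)] by blast
  show ?thesis
  proof (cases "\<exists>k. branching A k")
    case True
    then obtain k where "branching A k" ..
    from piece_system_branching[OF A this] obtain q ch wd and L0 :: "(nat list \<times> nat \<times> bool) list"
      where "piece_system N S r K s q L0 ch wd" by blast
    from piece_system.space_filling_psi[OF this assms(5)] show ?thesis by blast
  next
    case False
    then have "\<And>k. \<not> branching A k" by blast
    from piece_system_chain[OF A this] obtain ch and L0 :: "nat list list"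
      where "piece_system N S r K s 1 L0 ch (\<lambda>I. I)" by blast
    from piece_system.space_filling_psi[OF this assms(5)] show ?thesis by blast
  qed
qed

end
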